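(* There exists a constant $C_1<\infty$ such that for every $u\in C_0^\infty(\mathbb{B})$, $u\not\equiv 0$, \[ \int_{\mathbb{B}}e^{\frac{4\pi u^{2}}{\|u\|_{\mathcal{H}}}}\,dx\,dy\le C_{1}, \qquad\text{where }\ \|u\|_{\mathcal{H}}=\int_{\mathbb{B}}|\nabla u|^{2}\,dx\,dy-\int_{\mathbb{B}}\frac{u^{2}}{(1-|z|^{2})^{2}}\,dx\,dy . \]
   Context: $\mathbb{B}=\{z=x+iy\in\mathbb{C}:|z|<1\}$ is the open unit disc, $\nabla$ the Euclidean gradient, $dx\,dy$ Lebesgue measure, and $C_0^\infty(\mathbb{B})$ the smooth real-valued functions with compact support in $\mathbb{B}$. (For $u\not\equiv0$ in $C_0^\infty(\mathbb{B})$ the quantity $\|u\|_{\mathcal{H}}$ is positive by the Hardy inequality on the disc.) *)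

theory Defs
  imports "HOL-Analysis.Analysis"
begin

fun iter_pd :: "complex list \<Rightarrow> (complex \<Rightarrow> real) \<Rightarrow> complex \<Rightarrow> real" where
  "iter_pd [] f = f"
| "iter_pd (v # vs) f = (\<lambda>x. frechet_derivative (iter_pd vs f) (at x) v)"

definition smooth_fun :: "(complex \<Rightarrow> real) \<Rightarrow> bool" where
  "smooth_fun f \<longleftrightarrow> (\<forall>vs x. iter_pd vs f differentiable (at x))"

definition C0_inf_disc :: "(complex \<Rightarrow> real) \<Rightarrow> bool" where
  "C0_inf_disc u \<longleftrightarrow> smooth_fun u \<and> compact (closure {z. u z \<noteq> 0})
     \<and> closure {z. u z \<noteq> 0} \<subseteq> ball 0 1"

definition grad_sq :: "(complex \<Rightarrow> real) \<Rightarrow> complex \<Rightarrow> real" where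
  "grad_sq u z = (frechet_derivative u (at z) 1)\<^sup>2 + (frechet_derivative u (at z) \<i>)\<^sup>2"

definition H_norm :: "(complex \<Rightarrow> real) \<Rightarrow> real" where
  "H_norm u = (LINT z : ball 0 1 | lborel. grad_sq u z)
     - (LINT z : ball 0 1 | lborel. (u z)\<^sup>2 / (1 - (cmod z)\<^sup>2)\<^sup>2)"

end

theory Submission
  imports Defs
begin

text \<open>
  For every \<open>a\<close> in the disc the recentred function
  \<open>\<phi>\<^sub>a(w) = sqrt (1 - |w|\<^sup>2) / |1 - cnj a w|\<close> satisfies
  \<open>- \<Delta>\<phi>\<^sub>a / \<phi>\<^sub>a = 1 / (1 - |w|\<^sup>2)\<^sup>2 + V\<^sub>a\<close> with \<open>V\<^sub>a > 0\<close>, so that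
  the Hardy functional of \<open>u\<close> equals the integral of
  \<open>f\<^sub>a\<^sup>2 = |\<nabla>u - u \<nabla>\<phi>\<^sub>a / \<phi>\<^sub>a|\<^sup>2 + u\<^sup>2 V\<^sub>a\<close>. On the ball of radius \<open>d / 4\<close> around
  \<open>a\<close>, where \<open>d = 1 - |a|\<^sup>2\<close>, one has \<open>V\<^sub>a \<ge> 1 / (4 d\<^sup>2)\<close>; hence representing a cutoff of
  \<open>u / \<phi>\<^sub>a\<close> by its gradient bounds \<open>|u|\<close> near \<open>a\<close> by the potential
  \<open>(1 / 2\<pi>) \<integral> f\<^sub>a(w) (1 / |z - w| + C / d) dw\<close>. Such potentials satisfy the exponential
  inequality with the sharp constant \<open>4\<pi>\<close>, uniformly in \<open>a\<close> after rescaling. Averaging the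
  resulting local inequalities over \<open>a\<close> with weight \<open>d\<^sup>-\<^sup>2\<close> gives the global one.
\<close>

subsection \<open>Radial integrals in the plane\<close>

text \<open>Recentring is forced by the boundary. For \<open>a = 0\<close> the gain is only
  \<open>hardy_V 0 w = 1 / hardy_S w\<close>, too small near the circle to control \<open>u\<close>
  on the scale of the distance to it. Recentred at \<open>a\<close>, the gain has size d^-2 near
  \<open>a\<close>, while the total energy is the same for every \<open>a\<close>. Sharpness hinges
  on the coefficient 1 / (2 pi) of 1 / |z - w|. Since phi_a is Lipschitz on scale d and the cutoff
  has zero gradient at z, all errors are bounded kernels and change only additive constants. In the
  exponential inequality, duality and Cauchy-Schwarz give e^n |E_n| <= const for the level sets E_n,
  which is not summable over n. The missing decay comes from concentration: a nearly extremal level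
  leaves the density little mass in small balls, so much higher levels cannot be nearly extremal as
  well. Hence the number of n with e^n |E_n| >= e^-k grows only linearly in k.\<close>

lemma nn_integral_lborel_affine:
  fixes f :: "complex \<Rightarrow> ennreal"
  assumes [measurable]: "f \<in> borel_measurable borel" and c: "c \<noteq> 0"
  shows "(\<integral>\<^sup>+w. f w \<partial>lborel) = ennreal (c\<^sup>2) * (\<integral>\<^sup>+w. f (a + c *\<^sub>R w) \<partial>lborel)"
  by (subst lborel_affine[OF c, of a])
    (simp add: nn_integral_density nn_integral_distr nn_integral_cmult)

lemma nn_integral_lborel_translate:
  fixes f :: "complex \<Rightarrow> ennreal"
  assumes [measurable]: "f \<in> borel_measurable borel"
  shows "(\<integral>\<^sup>+w. f (w + a) \<partial>lborel) = (\<integral>\<^sup>+w. f w \<partial>lborel)"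
  using nn_integral_lborel_affine[of f 1 a] assms by (simp add: add.commute)

lemma nn_integral_lborel_diff_radial:
  fixes f :: "complex \<Rightarrow> ennreal"
  assumes [measurable]: "f \<in> borel_measurable borel" and even: "\<And>w. f (- w) = f w"
  shows "(\<integral>\<^sup>+w. f (z - w) \<partial>lborel) = (\<integral>\<^sup>+w. f w \<partial>lborel)"
proof -
  have "f (z - w) = f (w + (- z))" for w
    using even[of "z - w"] by simp
  then show ?thesis
    using nn_integral_lborel_translate[of f "- z"] by simp
qed

lemma emeasure_lborel_ball_complex:
  assumes "0 \<le> r"
  shows "emeasure lborel (ball (z::complex) r) = ennreal (pi * r\<^sup>2)"
    and "emeasure lborel (cball (z::complex) r) = ennreal (pi * r\<^sup>2)"
  using assms unit_ball_vol_numeral(1)[of Num.One]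
  by (simp_all add: emeasure_ball emeasure_cball)

text \<open>A substitute for polar coordinates: F(|w|) is F(b) plus the integral of G over [|w|, b],
  and after exchanging the integrals each disc |w| <= s contributes its area pi s^2. Counting whole
  discs instead of annuli makes this an upper bound only.\<close>

lemma nn_integral_radial_le:
  fixes F G :: "real \<Rightarrow> real"
  assumes F: "\<And>s. 0 < s \<Longrightarrow> (F has_real_derivative - G s) (at s)"
    and G: "\<And>s. 0 < s \<Longrightarrow> 0 \<le> G s" and [measurable]: "G \<in> borel_measurable borel"
    and a: "0 \<le> a" and b: "0 < b" "0 \<le> F b"
  shows "(\<integral>\<^sup>+w. ennreal (F (cmod w)) * indicator {w. w \<noteq> 0 \<and> a \<le> cmod w \<and> cmod w < b} w \<partial>lborel)
    \<le> ennreal (pi * b\<^sup>2 * F b) + (\<integral>\<^sup>+s. ennreal (pi * s\<^sup>2 * G s) * indicator {a..b} s \<partial>lborel)"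
proof -
  let ?A = "{w::complex. w \<noteq> 0 \<and> a \<le> cmod w \<and> cmod w < b}"
  have A[measurable]: "?A \<in> sets borel" by measurable
  have "{p \<in> space (borel \<Otimes>\<^sub>M borel). cmod (snd p) \<le> fst p} \<in> sets (borel \<Otimes>\<^sub>M borel)"
    by measurable
  then have [measurable]: "{(s, w::complex). cmod w \<le> s} \<in> sets (borel \<Otimes>\<^sub>M borel)"
    by (simp add: space_pair_measure case_prod_beta')
  have F_eq: "ennreal (F (cmod w)) = ennreal (F b) + (\<integral>\<^sup>+s. ennreal (G s) * indicator {cmod w..b} s \<partial>lborel)"
    if "w \<in> ?A" for w
  proof -
    have "(\<integral>\<^sup>+s. ennreal (G s) * indicator {cmod w..b} s \<partial>lborel) = ennreal (- F b - (- F (cmod w)))"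
    proof (rule nn_integral_FTC_Icc)
      fix s assume "s \<in> {cmod w..b}"
      then have "0 < s" using that by (auto intro: less_le_trans[of _ "cmod w"])
      from DERIV_minus[OF F[OF this]] G[OF this]
      show "((\<lambda>s. - F s) has_real_derivative G s) (at s)" "0 \<le> G s" by simp_all
    qed (use that in auto)
    moreover have "F b \<le> F (cmod w)"
    proof (rule DERIV_nonpos_imp_nonincreasing[where f = F])
      fix s assume "cmod w \<le> s" "s \<le> b"
      then have "0 < s" using that by (auto intro: less_le_trans[of _ "cmod w"])
      from F[OF this] G[OF this] show "\<exists>y. (F has_real_derivative y) (at s) \<and> y \<le> 0"
        by (auto intro: exI[of _ "- G s"])
    qed (use that in auto)
    ultimately show ?thesis
      using b by (simp flip: ennreal_plus)
  qed
  have "(\<integral>\<^sup>+w. ennreal (F (cmod w)) * indicator ?A w \<partial>lborel) \<le>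
     (\<integral>\<^sup>+w. ennreal (F b) * indicator (cball (0::complex) b) w +
       (\<integral>\<^sup>+s. (ennreal (G s) * indicator {a..b} s) * indicator (cball 0 s) w \<partial>lborel) \<partial>lborel)"
  proof (rule nn_integral_mono)
    fix w :: complex
    show "ennreal (F (cmod w)) * indicator ?A w \<le> ennreal (F b) * indicator (cball (0::complex) b) w +
       (\<integral>\<^sup>+s. (ennreal (G s) * indicator {a..b} s) * indicator (cball 0 s) w \<partial>lborel)"
    proof (cases "w \<in> ?A")
      case True
      have "(\<integral>\<^sup>+s. ennreal (G s) * indicator {cmod w..b} s \<partial>lborel) \<le>
          (\<integral>\<^sup>+s. (ennreal (G s) * indicator {a..b} s) * indicator (cball 0 s) w \<partial>lborel)"
        using True by (intro nn_integral_mono) (auto split: split_indicator)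
      then show ?thesis using True F_eq[OF True] by (simp add: add_left_mono)
    qed simp
  qed
  also have "\<dots> = ennreal (F b) * emeasure lborel (cball (0::complex) b) +
      (\<integral>\<^sup>+w. (\<integral>\<^sup>+s. (ennreal (G s) * indicator {a..b} s) * indicator {(s, w). cmod w \<le> s} (s, w) \<partial>lborel) \<partial>lborel)"
  proof -
    have ind: "indicator (cball 0 s) w = (indicator {(s, w). cmod w \<le> s} (s, w) :: ennreal)" for s and w :: complex
      by (simp add: indicator_def)
    define h :: "complex \<Rightarrow> ennreal" where
      "h = (\<lambda>w. \<integral>\<^sup>+s. (ennreal (G s) * indicator {a..b} s) * indicator {(s, w). cmod w \<le> s} (s, w) \<partial>lborel)"
    have [measurable]: "h \<in> borel_measurable borel"
      unfolding h_def by measurable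
    have *: "(\<integral>\<^sup>+s. (ennreal (G s) * indicator {a..b} s) * indicator (cball 0 s) w \<partial>lborel) = h w" for w
      by (simp add: h_def ind)
    have [measurable]: "cball (0::complex) b \<in> sets borel" by simp
    show ?thesis
      unfolding * unfolding h_def[symmetric]
      by (subst nn_integral_add) (auto simp: nn_integral_cmult_indicator)
  qed
  also have "(\<integral>\<^sup>+w. (\<integral>\<^sup>+s. (ennreal (G s) * indicator {a..b} s) * indicator {(s, w). cmod w \<le> s} (s, w) \<partial>lborel) \<partial>lborel)
     = (\<integral>\<^sup>+s. (\<integral>\<^sup>+w. (ennreal (G s) * indicator {a..b} s) * indicator {(s, w). cmod w \<le> s} (s, w) \<partial>lborel) \<partial>lborel)"
    by (rule lborel_pair.Fubini') measurable
  also have "\<dots> = (\<integral>\<^sup>+s. (\<integral>\<^sup>+w. (ennreal (G s) * indicator {a..b} s) * indicator (cball 0 s) w \<partial>(lborel::complex measure)) \<partial>lborel)"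
    by (auto intro!: nn_integral_cong simp: indicator_def)
  also have "\<dots> = (\<integral>\<^sup>+s. ennreal (pi * s\<^sup>2 * G s) * indicator {a..b} s \<partial>lborel)"
  proof -
    have "(ennreal (G s) * indicator {a..b} s) * emeasure lborel (cball (0::complex) s)
        = ennreal (pi * s\<^sup>2 * G s) * indicator {a..b} s" for s
      using a by (cases "s = 0")
        (auto simp: emeasure_lborel_ball_complex G ennreal_mult[symmetric] mult_ac
          simp del: ennreal_mult' split: split_indicator)
    then show ?thesis by (simp add: nn_integral_cmult_indicator)
  qed
  also have "ennreal (F b) * emeasure lborel (cball (0::complex) b) = ennreal (pi * b\<^sup>2 * F b)"
    using b by (simp add: emeasure_lborel_ball_complex ennreal_mult'[symmetric] mult_ac)
  finally show ?thesis .
qed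

text \<open>The true value is 2 pi ln (b / a). The surplus pi is harmless, since only the factor of
  the logarithm enters the sharp constant.\<close>

lemma nn_integral_inverse_square_annulus:
  assumes "0 < a" "a \<le> b"
  shows "(\<integral>\<^sup>+w. ennreal (1 / (cmod w)\<^sup>2) * indicator {w. a \<le> cmod w \<and> cmod w < b} w \<partial>lborel)
    \<le> ennreal (2 * pi * ln (b / a) + pi)"
proof -
  have "(\<integral>\<^sup>+w. ennreal (1 / (cmod w)\<^sup>2) * indicator {w. a \<le> cmod w \<and> cmod w < b} w \<partial>lborel)
    = (\<integral>\<^sup>+w. ennreal (1 / (cmod w)\<^sup>2) * indicator {w. w \<noteq> 0 \<and> a \<le> cmod w \<and> cmod w < b} w \<partial>lborel)"
    using assms by (intro nn_integral_cong) (auto split: split_indicator)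
  also have "\<dots> \<le> ennreal (pi * b\<^sup>2 * (1 / b\<^sup>2)) + (\<integral>\<^sup>+s. ennreal (pi * s\<^sup>2 * (2 / s ^ 3)) * indicator {a..b} s \<partial>lborel)"
    using assms by (intro nn_integral_radial_le)
      (auto intro!: derivative_eq_intros simp: power2_eq_square power3_eq_cube field_simps)
  also have "(\<integral>\<^sup>+s. ennreal (pi * s\<^sup>2 * (2 / s ^ 3)) * indicator {a..b} s \<partial>lborel)
      = (\<integral>\<^sup>+s. ennreal (2 * pi / s) * indicator {a..b} s \<partial>lborel)"
    using assms by (intro nn_integral_cong) (auto split: split_indicator simp: power2_eq_square power3_eq_cube)
  also have "\<dots> = ennreal (2 * pi * ln b - 2 * pi * ln a)"
    using assms by (intro nn_integral_FTC_Icc)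
      (auto intro!: derivative_eq_intros simp flip: has_real_derivative_iff_has_vector_derivative)
  also have "ennreal (pi * b\<^sup>2 * (1 / b\<^sup>2)) + \<dots> = ennreal (2 * pi * ln (b / a) + pi)"
    using assms by (subst ennreal_plus[symmetric]) (auto simp: ln_div algebra_simps)
  finally show ?thesis .
qed

lemma nn_integral_inverse_norm_ball:
  assumes "0 < b"
  shows "(\<integral>\<^sup>+w. ennreal (1 / cmod w) * indicator {w. cmod w < b} w \<partial>lborel) \<le> ennreal (2 * pi * b)"
proof -
  have "(\<integral>\<^sup>+w. ennreal (1 / cmod w) * indicator {w. cmod w < b} w \<partial>lborel)
    = (\<integral>\<^sup>+w. ennreal (1 / cmod w) * indicator {w. w \<noteq> 0 \<and> 0 \<le> cmod w \<and> cmod w < b} w \<partial>lborel)"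
    using assms by (intro nn_integral_cong) (auto split: split_indicator)
  also have "\<dots> \<le> ennreal (pi * b\<^sup>2 * (1 / b)) + (\<integral>\<^sup>+s. ennreal (pi * s\<^sup>2 * (1 / s\<^sup>2)) * indicator {0..b} s \<partial>lborel)"
    using assms by (intro nn_integral_radial_le)
      (auto intro!: derivative_eq_intros simp: power2_eq_square power3_eq_cube field_simps)
  also have "(\<integral>\<^sup>+s. ennreal (pi * s\<^sup>2 * (1 / s\<^sup>2)) * indicator {0..b} s \<partial>lborel)
      \<le> (\<integral>\<^sup>+s. ennreal pi * indicator {0..b} s \<partial>lborel)"
    by (intro nn_integral_mono) (auto split: split_indicator intro!: ennreal_leI)
  also have "\<dots> = ennreal (pi * b)"
    using assms by (simp add: nn_integral_cmult_indicator ennreal_mult)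
  also have "ennreal (pi * b\<^sup>2 * (1 / b)) + \<dots> = ennreal (2 * pi * b)"
    using assms by (subst ennreal_plus[symmetric]) (auto simp: power2_eq_square)
  finally show ?thesis by (simp add: add_left_mono)
qed

subsection \<open>The truncated kernel\<close>

lemma ennreal_le_sqrtI:
  assumes "X\<^sup>2 \<le> ennreal c" "0 \<le> c"
  shows "X \<le> ennreal (sqrt c)"
proof (cases X)
  case (real x)
  then have "x\<^sup>2 \<le> c" using assms by (simp add: ennreal_power)
  then show ?thesis using real by (simp add: real_le_rsqrt ennreal_leI)
next
  case top
  then show ?thesis using assms by (simp add: power2_eq_square top_unique)
qed

lemma nn_integral_mult_le_sqrt:
  assumes [measurable]: "f \<in> borel_measurable M" "g \<in> borel_measurable M"
    and "(\<integral>\<^sup>+x. (f x)\<^sup>2 \<partial>M) \<le> ennreal A" "(\<integral>\<^sup>+x. (g x)\<^sup>2 \<partial>M) \<le> ennreal B" "0 \<le> A" "0 \<le> B"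
  shows "(\<integral>\<^sup>+x. f x * g x \<partial>M) \<le> ennreal (sqrt (A * B))"
proof (rule ennreal_le_sqrtI)
  have "(\<integral>\<^sup>+x. f x * g x \<partial>M)\<^sup>2 \<le> (\<integral>\<^sup>+x. (f x)\<^sup>2 \<partial>M) * (\<integral>\<^sup>+x. (g x)\<^sup>2 \<partial>M)"
    by (rule Cauchy_Schwarz_nn_integral) measurable
  also have "\<dots> \<le> ennreal A * ennreal B"
    using assms by (intro mult_mono) auto
  finally show "(\<integral>\<^sup>+x. f x * g x \<partial>M)\<^sup>2 \<le> ennreal (A * B)"
    using assms by (simp add: ennreal_mult)
qed (use assms in simp)

text \<open>The gradient kernel plus a bounded perturbation \<open>C\<close>, cut to a range of
  distances. The half-open range makes consecutive rings add up exactly. For points of the unit disc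
  the outer radius 2 cuts nothing off. On the diagonal, with \<open>a = 0 < b\<close>, the value is
  C / (2 pi) because 1 / 0 = 0.\<close>

definition ring_kernel :: "real \<Rightarrow> real \<Rightarrow> real \<Rightarrow> complex \<Rightarrow> complex \<Rightarrow> real" where
  "ring_kernel C a b z w =
     (if a \<le> cmod (z - w) \<and> cmod (z - w) < b then (1 / cmod (z - w) + C) / (2 * pi) else 0)"

lemma ring_kernel_measurable [measurable]:
  assumes [measurable]: "f \<in> borel_measurable M" "g \<in> borel_measurable M"
  shows "(\<lambda>x. ring_kernel C a b (f x) (g x)) \<in> borel_measurable M"
  unfolding ring_kernel_def by measurable

lemma ring_kernel_commute: "ring_kernel C a b z w = ring_kernel C a b w z"
  by (simp add: ring_kernel_def norm_minus_commute)

lemma ring_kernel_diff: "ring_kernel C a b z w = ring_kernel C a b 0 (z - w)"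
  unfolding ring_kernel_def by (simp only: diff_0 norm_minus_cancel)

lemma ring_kernel_nonneg: "0 \<le> C \<Longrightarrow> 0 \<le> ring_kernel C a b z w"
  by (simp add: ring_kernel_def)

lemma ring_kernel_split:
  assumes "0 \<le> a" "a \<le> b" "b \<le> c"
  shows "ring_kernel C 0 c z w = ring_kernel C 0 a z w + ring_kernel C a b z w + ring_kernel C b c z w"
  using assms by (simp add: ring_kernel_def)

lemma ring_kernel_le:
  assumes "0 \<le> C" "0 < a" "a \<le> 2"
  shows "ring_kernel C a b z w \<le> (1 + C) / a"
proof (cases "a \<le> cmod (z - w) \<and> cmod (z - w) < b")
  case True
  have "1 / cmod (z - w) \<le> 1 / a"
    using True assms by (intro divide_left_mono mult_pos_pos) auto
  moreover have "C * a \<le> C * 2" using assms by (intro mult_left_mono) auto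
  ultimately have "1 / cmod (z - w) + C \<le> (1 + 2 * C) / a"
    using assms by (simp add: field_simps)
  then have "(1 / cmod (z - w) + C) / (2 * pi) \<le> (1 + 2 * C) / a / (2 * pi)"
    by (intro divide_right_mono) auto
  also have "\<dots> \<le> (1 + 2 * C) / a / 2"
    using assms pi_gt3 by (intro divide_left_mono) auto
  also have "\<dots> \<le> (1 + C) / a"
    using assms by (simp add: field_simps)
  finally show ?thesis using True by (simp add: ring_kernel_def)
qed (use assms in \<open>auto simp: ring_kernel_def\<close>)

lemma nn_integral_ring_kernel_near:
  assumes "0 \<le> C" "0 < b" "b \<le> 2"
  shows "(\<integral>\<^sup>+w. ennreal (ring_kernel C 0 b z w) \<partial>lborel) \<le> ennreal ((1 + C) * b)"
proof -
  have [measurable]: "ball (0::complex) b \<in> sets borel" by simp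
  have "(\<integral>\<^sup>+w. ennreal (ring_kernel C 0 b z w) \<partial>lborel) = (\<integral>\<^sup>+w. ennreal (ring_kernel C 0 b 0 (z - w)) \<partial>lborel)"
    by (simp flip: ring_kernel_diff)
  also have "\<dots> = (\<integral>\<^sup>+w. ennreal (ring_kernel C 0 b 0 w) \<partial>lborel)"
    by (rule nn_integral_lborel_diff_radial) (measurable, simp add: ring_kernel_def)
  also have "\<dots> = (\<integral>\<^sup>+w. ennreal (1 / (2 * pi)) * (ennreal (1 / cmod w) * indicator {w. cmod w < b} w)
      + ennreal (C / (2 * pi)) * indicator (ball 0 b) w \<partial>lborel)"
    using assms by (intro nn_integral_cong)
      (auto simp: ring_kernel_def add_divide_distrib ennreal_mult[symmetric] simp flip: ennreal_plus split: split_indicator)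
  also have "\<dots> = ennreal (1 / (2 * pi)) * (\<integral>\<^sup>+w. ennreal (1 / cmod w) * indicator {w. cmod w < b} w \<partial>lborel)
      + ennreal (C / (2 * pi)) * emeasure lborel (ball (0::complex) b)"
    by (subst nn_integral_add) (auto simp: nn_integral_cmult nn_integral_cmult_indicator)
  also have "\<dots> \<le> ennreal (1 / (2 * pi)) * ennreal (2 * pi * b) + ennreal (C / (2 * pi)) * ennreal (pi * b\<^sup>2)"
    using assms by (intro add_mono mult_left_mono nn_integral_inverse_norm_ball)
      (auto simp: emeasure_lborel_ball_complex)
  also have "\<dots> = ennreal (b + C * b\<^sup>2 / 2)"
    using assms by (simp add: ennreal_mult[symmetric] flip: ennreal_plus)
  also have "\<dots> \<le> ennreal ((1 + C) * b)"
  proof (rule ennreal_leI)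
    have "(C * b) * b \<le> (C * b) * 2" using assms by (intro mult_left_mono) auto
    then show "b + C * b\<^sup>2 / 2 \<le> (1 + C) * b"
      by (simp add: power2_eq_square algebra_simps)
  qed
  finally show ?thesis .
qed

text \<open>Origin of the sharp constant: 1 / (4 pi^2 |z - w|^2) integrates to ln (b^2 / a^2) / (4
  pi). The logarithm is kept in squared radii because these are compared with areas. The summands 1,
  8 C and 4 C^2 come from the surplus pi, the cross term and the constant term, the latter two with
  b <= 2.\<close>

lemma nn_integral_ring_kernel_sq:
  assumes "0 \<le> C" "0 < a" "a \<le> b" "b \<le> 2"
  shows "(\<integral>\<^sup>+w. (ennreal (ring_kernel C a b z w))\<^sup>2 \<partial>lborel)
    \<le> ennreal ((ln (b\<^sup>2 / a\<^sup>2) + (1 + 8 * C + 4 * C\<^sup>2)) / (4 * pi))"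
proof -
  have [measurable]: "ball (0::complex) b \<in> sets borel" by simp
  have "(\<integral>\<^sup>+w. (ennreal (ring_kernel C a b z w))\<^sup>2 \<partial>lborel) = (\<integral>\<^sup>+w. (ennreal (ring_kernel C a b 0 (z - w)))\<^sup>2 \<partial>lborel)"
    by (simp flip: ring_kernel_diff)
  also have "\<dots> = (\<integral>\<^sup>+w. (ennreal (ring_kernel C a b 0 w))\<^sup>2 \<partial>lborel)"
    by (rule nn_integral_lborel_diff_radial) (measurable, simp add: ring_kernel_def)
  also have "\<dots> \<le> (\<integral>\<^sup>+w. ennreal (1 / (4 * pi\<^sup>2)) * (ennreal (1 / (cmod w)\<^sup>2) * indicator {w. a \<le> cmod w \<and> cmod w < b} w)
      + (ennreal (2 * C / (4 * pi\<^sup>2)) * (ennreal (1 / cmod w) * indicator {w. cmod w < b} w)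
      + ennreal (C\<^sup>2 / (4 * pi\<^sup>2)) * indicator (ball 0 b) w) \<partial>lborel)"
  proof (rule nn_integral_mono)
    fix w :: complex
    have "((1 / cmod w + C) / (2 * pi))\<^sup>2 = 1 / (4 * pi\<^sup>2) * (1 / (cmod w)\<^sup>2)
        + (2 * C / (4 * pi\<^sup>2) * (1 / cmod w) + C\<^sup>2 / (4 * pi\<^sup>2))"
      by (simp add: power_divide power2_sum add_divide_distrib power_mult_distrib power2_eq_square[of pi] mult_ac)
    then show "(ennreal (ring_kernel C a b 0 w))\<^sup>2 \<le>
      ennreal (1 / (4 * pi\<^sup>2)) * (ennreal (1 / (cmod w)\<^sup>2) * indicator {w. a \<le> cmod w \<and> cmod w < b} w)
      + (ennreal (2 * C / (4 * pi\<^sup>2)) * (ennreal (1 / cmod w) * indicator {w. cmod w < b} w)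
      + ennreal (C\<^sup>2 / (4 * pi\<^sup>2)) * indicator (ball 0 b) w)"
      using assms by (auto simp: ring_kernel_def ennreal_power ennreal_mult[symmetric]
          simp flip: ennreal_plus split: split_indicator)
  qed
  also have "\<dots> = ennreal (1 / (4 * pi\<^sup>2)) * (\<integral>\<^sup>+w. ennreal (1 / (cmod w)\<^sup>2) * indicator {w. a \<le> cmod w \<and> cmod w < b} w \<partial>lborel)
      + (ennreal (2 * C / (4 * pi\<^sup>2)) * (\<integral>\<^sup>+w. ennreal (1 / cmod w) * indicator {w. cmod w < b} w \<partial>lborel)
      + ennreal (C\<^sup>2 / (4 * pi\<^sup>2)) * emeasure lborel (ball (0::complex) b))"
    by (simp add: nn_integral_add nn_integral_cmult nn_integral_cmult_indicator)
  also have "\<dots> \<le> ennreal (1 / (4 * pi\<^sup>2)) * ennreal (2 * pi * ln (b / a) + pi)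
      + (ennreal (2 * C / (4 * pi\<^sup>2)) * ennreal (2 * pi * 2) + ennreal (C\<^sup>2 / (4 * pi\<^sup>2)) * ennreal (pi * 2\<^sup>2))"
  proof (intro add_mono mult_left_mono nn_integral_inverse_square_annulus)
    have "(\<integral>\<^sup>+w. ennreal (1 / cmod w) * indicator {w. cmod w < b} w \<partial>lborel) \<le> ennreal (2 * pi * b)"
      using assms by (intro nn_integral_inverse_norm_ball) auto
    also have "\<dots> \<le> ennreal (2 * pi * 2)" using assms by (intro ennreal_leI mult_left_mono) auto
    finally show "(\<integral>\<^sup>+w. ennreal (1 / cmod w) * indicator {w. cmod w < b} w \<partial>lborel) \<le> ennreal (2 * pi * 2)" .
    show "emeasure lborel (ball (0::complex) b) \<le> ennreal (pi * 2\<^sup>2)"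
      using assms power_mono[of b 2 2] by (subst emeasure_lborel_ball_complex) (auto intro!: ennreal_leI)
  qed (use assms in auto)
  also have "\<dots> = ennreal ((ln (b\<^sup>2 / a\<^sup>2) + (1 + 8 * C + 4 * C\<^sup>2)) / (4 * pi))"
  proof -
    have "ln (b\<^sup>2 / a\<^sup>2) = 2 * ln (b / a)"
      using assms by (simp add: ln_realpow flip: power_divide)
    moreover have "0 \<le> ln (b / a)" using assms by simp
    ultimately show ?thesis using assms
      by (simp add: ennreal_mult[symmetric] flip: ennreal_plus) (simp add: field_simps power2_eq_square)
  qed
  finally show ?thesis .
qed

text \<open>Cauchy-Schwarz on \<open>E\<close> moves the square inside at the cost of a factor t;
  exchanging the integrals then leaves another factor t.\<close>

lemma nn_integral_average_sq_le:
  fixes q :: "complex \<Rightarrow> complex \<Rightarrow> ennreal"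
  assumes [measurable]: "(\<lambda>(z, w). q z w) \<in> borel_measurable (borel \<Otimes>\<^sub>M borel)" "E \<in> sets borel"
    and E: "emeasure lborel E = ennreal t" "0 \<le> t"
    and q: "\<And>z. (\<integral>\<^sup>+w. (q z w)\<^sup>2 \<partial>lborel) \<le> ennreal M" and "0 \<le> M"
  shows "(\<integral>\<^sup>+w. (\<integral>\<^sup>+z. q z w * indicator E z \<partial>lborel)\<^sup>2 \<partial>lborel) \<le> ennreal (t\<^sup>2 * M)"
proof -
  have "(\<integral>\<^sup>+z. q z w * indicator E z \<partial>lborel)\<^sup>2 \<le> ennreal t * (\<integral>\<^sup>+z. (q z w)\<^sup>2 * indicator E z \<partial>lborel)" for w
  proof -
    have "(\<integral>\<^sup>+z. q z w * indicator E z \<partial>lborel)\<^sup>2 = (\<integral>\<^sup>+z. (q z w * indicator E z) * indicator E z \<partial>lborel)\<^sup>2"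
      by (intro arg_cong[where f = "\<lambda>x. x\<^sup>2"] nn_integral_cong) (auto split: split_indicator)
    also have "\<dots> \<le> (\<integral>\<^sup>+z. (q z w * indicator E z)\<^sup>2 \<partial>lborel) * (\<integral>\<^sup>+z. (indicator E z)\<^sup>2 \<partial>lborel)"
      by (rule Cauchy_Schwarz_nn_integral) measurable
    also have "(\<integral>\<^sup>+z. (indicator E z)\<^sup>2 \<partial>lborel) = (\<integral>\<^sup>+z. indicator E z \<partial>lborel)"
      by (intro nn_integral_cong) (auto split: split_indicator)
    also have "(\<integral>\<^sup>+z. (q z w * indicator E z)\<^sup>2 \<partial>lborel) = (\<integral>\<^sup>+z. (q z w)\<^sup>2 * indicator E z \<partial>lborel)"
      by (intro nn_integral_cong) (auto split: split_indicator)
    finally show ?thesis by (simp add: E mult.commute)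
  qed
  then have "(\<integral>\<^sup>+w. (\<integral>\<^sup>+z. q z w * indicator E z \<partial>lborel)\<^sup>2 \<partial>lborel)
      \<le> (\<integral>\<^sup>+w. ennreal t * (\<integral>\<^sup>+z. (q z w)\<^sup>2 * indicator E z \<partial>lborel) \<partial>lborel)"
    by (rule nn_integral_mono)
  also have "\<dots> = ennreal t * (\<integral>\<^sup>+w. (\<integral>\<^sup>+z. (q z w)\<^sup>2 * indicator E z \<partial>lborel) \<partial>lborel)"
    by (rule nn_integral_cmult) measurable
  also have "(\<integral>\<^sup>+w. (\<integral>\<^sup>+z. (q z w)\<^sup>2 * indicator E z \<partial>lborel) \<partial>lborel)
      = (\<integral>\<^sup>+z. (\<integral>\<^sup>+w. (q z w)\<^sup>2 * indicator E z \<partial>lborel) \<partial>lborel)"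
    by (rule lborel_pair.Fubini') measurable
  also have "\<dots> = (\<integral>\<^sup>+z. (\<integral>\<^sup>+w. (q z w)\<^sup>2 \<partial>lborel) * indicator E z \<partial>lborel)"
    by (intro nn_integral_cong nn_integral_multc) measurable
  also have "\<dots> \<le> (\<integral>\<^sup>+z. ennreal M * indicator E z \<partial>lborel)"
    by (intro nn_integral_mono mult_right_mono q) auto
  also have "\<dots> = ennreal M * ennreal t"
    by (simp add: nn_integral_cmult_indicator E)
  also have "ennreal t * (ennreal M * ennreal t) = ennreal (t\<^sup>2 * M)"
    using assms by (simp add: ennreal_mult[symmetric] power2_eq_square mult_ac)
  finally show ?thesis by (simp add: mult_left_mono)
qed

subsection \<open>Testing the potential on level sets\<close>

text \<open>The additive loss next to the logarithm: 1 + 8 C + 4 C^2 from the squared kernel, 3 as a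
  bound for ln 4 (outer radius 2), and 12 pi (1 + C)^2 from the interaction of near and far
  parts.\<close>

definition adams_const :: "real \<Rightarrow> real" where
  "adams_const C = 4 + 8 * C + 4 * C\<^sup>2 + 12 * pi * (1 + C)\<^sup>2"

lemma ring_kernel_self: "ring_kernel C a a z w = 0"
  by (auto simp: ring_kernel_def)

text \<open>As a function of \<open>w\<close> this is the potential of the indicator of
  \<open>E\<close> with the ring between \<open>a\<close> and \<open>r\<close> left out; for
  \<open>a = r\<close> nothing is left out.\<close>

definition test_kernel :: "real \<Rightarrow> real \<Rightarrow> real \<Rightarrow> complex set \<Rightarrow> complex \<Rightarrow> ennreal" where
  "test_kernel C a r E w =
     (\<integral>\<^sup>+z. ennreal (ring_kernel C 0 a z w + ring_kernel C r 2 z w) * indicator E z \<partial>lborel)"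

lemma test_kernel_measurable [measurable]:
  assumes [measurable]: "E \<in> sets borel"
  shows "test_kernel C a r E \<in> borel_measurable borel"
  unfolding test_kernel_def by measurable

lemma ln_four_le: "ln (4::real) \<le> 3"
  using ln_le_minus_one[of 4] by simp

text \<open>The kernel at distances below \<open>sqrt t\<close> and above \<open>r\<close>, integrated over \<open>E\<close>: near and far parts
  are almost orthogonal because the near part has small integral and the far part is bounded.\<close>

lemma
  assumes C: "0 \<le> C" and E[measurable]: "E \<in> sets borel"
    and t: "emeasure lborel E = ennreal t" "0 < t" and r: "sqrt t \<le> r" "r \<le> 2"
  shows test_kernel_le: "test_kernel C (sqrt t) r E w \<le> ennreal (2 * (1 + C) * sqrt t)"
    and nn_integral_test_kernel_sq: "(\<integral>\<^sup>+w. (test_kernel C (sqrt t) r E w)\<^sup>2 \<partial>lborel)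
        \<le> ennreal (t\<^sup>2 * ((ln (1 / r\<^sup>2) + adams_const C) / (4 * pi)))"
proof -
  define n where "n w = (\<integral>\<^sup>+z. ennreal (ring_kernel C 0 (sqrt t) z w) * indicator E z \<partial>lborel)" for w
  define F where "F w = (\<integral>\<^sup>+z. ennreal (ring_kernel C r 2 z w) * indicator E z \<partial>lborel)" for w
  have [measurable]: "n \<in> borel_measurable borel" "F \<in> borel_measurable borel"
    unfolding n_def F_def by measurable
  have sqt: "0 < sqrt t" "sqrt t \<le> 2" using t r by auto
  moreover from this r have "0 < r" by linarith
  ultimately have sqt: "0 < sqrt t" "sqrt t \<le> 2" "0 < r" by auto
  have eq: "test_kernel C (sqrt t) r E w = n w + F w" for w
    unfolding test_kernel_def n_def F_def
    by (subst nn_integral_add[symmetric]) (auto simp: C ring_kernel_nonneg distrib_right intro!: nn_integral_cong)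
  have n: "n w \<le> ennreal ((1 + C) * sqrt t)" for w
  proof -
    have "n w \<le> (\<integral>\<^sup>+z. ennreal (ring_kernel C 0 (sqrt t) w z) \<partial>lborel)"
      unfolding n_def by (intro nn_integral_mono) (auto split: split_indicator simp: ring_kernel_commute)
    also have "\<dots> \<le> ennreal ((1 + C) * sqrt t)"
      using sqt C by (intro nn_integral_ring_kernel_near) auto
    finally show ?thesis .
  qed
  have F: "F w \<le> ennreal ((1 + C) * sqrt t)" for w
  proof -
    have "F w \<le> (\<integral>\<^sup>+z. ennreal ((1 + C) / r) * indicator E z \<partial>lborel)"
      unfolding F_def using sqt r C by (intro nn_integral_mono mult_right_mono ennreal_leI ring_kernel_le) auto
    also have "\<dots> = ennreal ((1 + C) * (t / r))"
      using C sqt t by (simp add: nn_integral_cmult_indicator ennreal_mult[symmetric])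
    also have "\<dots> \<le> ennreal ((1 + C) * sqrt t)"
    proof (intro ennreal_leI mult_left_mono)
      have "sqrt t * sqrt t \<le> sqrt t * r" using r sqt by (intro mult_left_mono) auto
      then show "t / r \<le> sqrt t" using sqt t by (simp add: divide_le_eq)
    qed (use C in simp)
    finally show ?thesis .
  qed
  show "test_kernel C (sqrt t) r E w \<le> ennreal (2 * (1 + C) * sqrt t)"
  proof -
    have "n w + F w \<le> ennreal ((1 + C) * sqrt t) + ennreal ((1 + C) * sqrt t)"
      by (intro add_mono n F)
    also have "\<dots> = ennreal (2 * (1 + C) * sqrt t)"
      using C t by (simp flip: ennreal_plus)
    finally show ?thesis by (simp add: eq)
  qed
  have intn: "(\<integral>\<^sup>+w. n w \<partial>lborel) \<le> ennreal ((1 + C) * sqrt t * t)"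
  proof -
    have "(\<integral>\<^sup>+w. n w \<partial>lborel) = (\<integral>\<^sup>+z. (\<integral>\<^sup>+w. ennreal (ring_kernel C 0 (sqrt t) z w) * indicator E z \<partial>lborel) \<partial>lborel)"
      unfolding n_def by (rule lborel_pair.Fubini') measurable
    also have "\<dots> = (\<integral>\<^sup>+z. (\<integral>\<^sup>+w. ennreal (ring_kernel C 0 (sqrt t) z w) \<partial>lborel) * indicator E z \<partial>lborel)"
      by (intro nn_integral_cong nn_integral_multc) measurable
    also have "\<dots> \<le> (\<integral>\<^sup>+z. ennreal ((1 + C) * sqrt t) * indicator E z \<partial>lborel)"
      using sqt C by (intro nn_integral_mono mult_right_mono nn_integral_ring_kernel_near) auto
    also have "\<dots> = ennreal ((1 + C) * sqrt t * t)"
      using t C by (simp add: nn_integral_cmult_indicator ennreal_mult[symmetric])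
    finally show ?thesis .
  qed
  have le4: "(ln (2\<^sup>2 / r\<^sup>2) + (1 + 8 * C + 4 * C\<^sup>2)) / (4 * pi) \<ge> 0"
    using r sqt C power_mono[of r 2 2] by (intro divide_nonneg_nonneg add_nonneg_nonneg ln_ge_zero) auto
  have intF: "(\<integral>\<^sup>+w. (F w)\<^sup>2 \<partial>lborel) \<le> ennreal (t\<^sup>2 * ((ln (2\<^sup>2 / r\<^sup>2) + (1 + 8 * C + 4 * C\<^sup>2)) / (4 * pi)))"
    unfolding F_def using sqt r C t le4
    by (intro nn_integral_average_sq_le nn_integral_ring_kernel_sq) auto
  have "(\<integral>\<^sup>+w. (test_kernel C (sqrt t) r E w)\<^sup>2 \<partial>lborel) \<le>
      (\<integral>\<^sup>+w. (F w)\<^sup>2 + n w * ennreal (3 * (1 + C) * sqrt t) \<partial>lborel)"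
  proof (rule nn_integral_mono)
    fix w
    \<comment> \<open>Only the square of the far part carries a logarithm. Everything else contains
      a factor \<open>n w\<close>, so it costs the integral of \<open>n\<close> times the common sup
      bound; the 3 counts one \<open>n\<close> and two \<open>F\<close>.\<close>
    have "(n w + F w)\<^sup>2 = (F w)\<^sup>2 + n w * (n w + (F w + F w))"
      by (simp add: power2_eq_square algebra_simps)
    also have "\<dots> \<le> (F w)\<^sup>2 + n w * (ennreal ((1 + C) * sqrt t) + (ennreal ((1 + C) * sqrt t) + ennreal ((1 + C) * sqrt t)))"
      by (intro add_mono mult_left_mono n F) auto
    also have "ennreal ((1 + C) * sqrt t) + (ennreal ((1 + C) * sqrt t) + ennreal ((1 + C) * sqrt t))
        = ennreal (3 * (1 + C) * sqrt t)"
      using C t by (simp flip: ennreal_plus)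
    finally show "(test_kernel C (sqrt t) r E w)\<^sup>2 \<le> (F w)\<^sup>2 + n w * ennreal (3 * (1 + C) * sqrt t)"
      by (simp add: eq)
  qed
  also have "\<dots> = (\<integral>\<^sup>+w. (F w)\<^sup>2 \<partial>lborel) + (\<integral>\<^sup>+w. n w \<partial>lborel) * ennreal (3 * (1 + C) * sqrt t)"
    by (simp add: nn_integral_add nn_integral_multc)
  also have "\<dots> \<le> ennreal (t\<^sup>2 * ((ln (2\<^sup>2 / r\<^sup>2) + (1 + 8 * C + 4 * C\<^sup>2)) / (4 * pi)))
      + ennreal ((1 + C) * sqrt t * t) * ennreal (3 * (1 + C) * sqrt t)"
    by (intro add_mono mult_right_mono intF intn) auto
  also have "\<dots> = ennreal (t\<^sup>2 * ((ln (2\<^sup>2 / r\<^sup>2) + (1 + 8 * C + 4 * C\<^sup>2)) / (4 * pi))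
      + ((1 + C) * sqrt t * t) * (3 * (1 + C) * sqrt t))"
  proof -
    have *: "ennreal X + ennreal Y * ennreal Z = ennreal (X + Y * Z)" if "0 \<le> X" "0 \<le> Y" "0 \<le> Z" for X Y Z
      using that by (simp add: ennreal_mult)
    show ?thesis using C t by (intro * mult_nonneg_nonneg le4) auto
  qed
  also have "\<dots> \<le> ennreal (t\<^sup>2 * ((ln (1 / r\<^sup>2) + adams_const C) / (4 * pi)))"
  proof (rule ennreal_leI)
    have *: "((1 + C) * sqrt t * t) * (3 * (1 + C) * sqrt t) = t\<^sup>2 * (12 * pi * (1 + C)\<^sup>2 / (4 * pi))"
      using t by (simp add: power2_eq_square)
    have "ln (2\<^sup>2 / r\<^sup>2) \<le> 3 + ln (1 / r\<^sup>2)"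
      using sqt ln_four_le by (simp add: ln_div)
    then have "t\<^sup>2 * ((ln (2\<^sup>2 / r\<^sup>2) + (1 + 8 * C + 4 * C\<^sup>2)) / (4 * pi) + 12 * pi * (1 + C)\<^sup>2 / (4 * pi))
        \<le> t\<^sup>2 * ((ln (1 / r\<^sup>2) + adams_const C) / (4 * pi))"
      unfolding add_divide_distrib[symmetric]
      by (intro mult_left_mono divide_right_mono) (auto simp: adams_const_def)
    then show "t\<^sup>2 * ((ln (2\<^sup>2 / r\<^sup>2) + (1 + 8 * C + 4 * C\<^sup>2)) / (4 * pi))
      + ((1 + C) * sqrt t * t) * (3 * (1 + C) * sqrt t) \<le> t\<^sup>2 * ((ln (1 / r\<^sup>2) + adams_const C) / (4 * pi))"
      unfolding * by (simp add: distrib_left)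
  qed
  finally show "(\<integral>\<^sup>+w. (test_kernel C (sqrt t) r E w)\<^sup>2 \<partial>lborel)
        \<le> ennreal (t\<^sup>2 * ((ln (1 / r\<^sup>2) + adams_const C) / (4 * pi)))" .
qed

text \<open>Duality: integrating the lower bound \<open>l\<close> over \<open>E\<close> and
  exchanging the integrals pairs \<open>f\<close> with the potential of the indicator. The ring from
  sqrt t to \<open>r\<close> stays outside the pairing, so that it can be estimated separately for
  each z by the mass of \<open>f\<close> near z.\<close>

lemma potential_test_ineq:
  fixes f :: "complex \<Rightarrow> ennreal"
  assumes C: "0 \<le> C" and [measurable]: "f \<in> borel_measurable borel" "E \<in> sets borel"
    and t: "emeasure lborel E = ennreal t" "0 < t" and r: "sqrt t \<le> r" "r \<le> 2"
    and l: "0 \<le> l" "\<And>z. z \<in> E \<Longrightarrow> ennreal l \<le> (\<integral>\<^sup>+w. ennreal (ring_kernel C 0 2 z w) * f w \<partial>lborel)"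
  shows "ennreal (l * t) \<le> (\<integral>\<^sup>+w. f w * test_kernel C (sqrt t) r E w \<partial>lborel)
     + (\<integral>\<^sup>+z. (\<integral>\<^sup>+w. ennreal (ring_kernel C (sqrt t) r z w) * f w \<partial>lborel) * indicator E z \<partial>lborel)"
proof -
  let ?K = "\<lambda>z w. ring_kernel C 0 (sqrt t) z w + ring_kernel C r 2 z w"
  have "ennreal (l * t) = (\<integral>\<^sup>+z. ennreal l * indicator E z \<partial>lborel)"
    using l t by (simp add: nn_integral_cmult_indicator ennreal_mult)
  also have "\<dots> \<le> (\<integral>\<^sup>+z. (\<integral>\<^sup>+w. ennreal (?K z w) * f w \<partial>lborel) * indicator E z
      + (\<integral>\<^sup>+w. ennreal (ring_kernel C (sqrt t) r z w) * f w \<partial>lborel) * indicator E z \<partial>lborel)"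
  proof (rule nn_integral_mono)
    fix z
    have "(\<integral>\<^sup>+w. ennreal (ring_kernel C 0 2 z w) * f w \<partial>lborel) =
      (\<integral>\<^sup>+w. ennreal (?K z w) * f w + ennreal (ring_kernel C (sqrt t) r z w) * f w \<partial>lborel)"
      using t r C by (intro nn_integral_cong)
       (simp add: ring_kernel_split[of "sqrt t" r 2] ring_kernel_nonneg distrib_right[symmetric] add_ac flip: ennreal_plus)
    also have "\<dots> = (\<integral>\<^sup>+w. ennreal (?K z w) * f w \<partial>lborel) + (\<integral>\<^sup>+w. ennreal (ring_kernel C (sqrt t) r z w) * f w \<partial>lborel)"
      by (rule nn_integral_add) measurable
    finally show "ennreal l * indicator E z \<le> (\<integral>\<^sup>+w. ennreal (?K z w) * f w \<partial>lborel) * indicator E z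
      + (\<integral>\<^sup>+w. ennreal (ring_kernel C (sqrt t) r z w) * f w \<partial>lborel) * indicator E z"
      using l(2)[of z] by (auto split: split_indicator)
  qed
  also have "\<dots> = (\<integral>\<^sup>+z. (\<integral>\<^sup>+w. ennreal (?K z w) * f w \<partial>lborel) * indicator E z \<partial>lborel)
      + (\<integral>\<^sup>+z. (\<integral>\<^sup>+w. ennreal (ring_kernel C (sqrt t) r z w) * f w \<partial>lborel) * indicator E z \<partial>lborel)"
    by (rule nn_integral_add) measurable
  also have "(\<integral>\<^sup>+z. (\<integral>\<^sup>+w. ennreal (?K z w) * f w \<partial>lborel) * indicator E z \<partial>lborel)
      = (\<integral>\<^sup>+z. (\<integral>\<^sup>+w. ennreal (?K z w) * f w * indicator E z \<partial>lborel) \<partial>lborel)"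
    by (intro nn_integral_cong nn_integral_multc[symmetric]) measurable
  also have "\<dots> = (\<integral>\<^sup>+w. (\<integral>\<^sup>+z. ennreal (?K z w) * f w * indicator E z \<partial>lborel) \<partial>lborel)"
    by (rule lborel_pair.Fubini') measurable
  also have "\<dots> = (\<integral>\<^sup>+w. (\<integral>\<^sup>+z. f w * (ennreal (?K z w) * indicator E z) \<partial>lborel) \<partial>lborel)"
    by (simp add: mult_ac)
  also have "\<dots> = (\<integral>\<^sup>+w. f w * test_kernel C (sqrt t) r E w \<partial>lborel)"
    unfolding test_kernel_def by (intro nn_integral_cong nn_integral_cmult) measurable
  finally show ?thesis .
qed

section \<open>Upper bounds for levels in terms of the area of the level set\<close>

lemma nn_integral_sq_compl_le:
  fixes f :: "complex \<Rightarrow> ennreal"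
  assumes [measurable]: "f \<in> borel_measurable borel" "A \<in> sets borel"
    and f: "(\<integral>\<^sup>+w. (f w)\<^sup>2 \<partial>lborel) \<le> 1"
    and d: "(\<integral>\<^sup>+w. (f w)\<^sup>2 * indicator A w \<partial>lborel) = ennreal d" "0 \<le> d"
  shows "(\<integral>\<^sup>+w. (f w)\<^sup>2 * indicator (- A) w \<partial>lborel) \<le> ennreal (1 - d)" "d \<le> 1"
proof -
  let ?X = "\<integral>\<^sup>+w. (f w)\<^sup>2 * indicator (- A) w \<partial>lborel"
  have "(\<integral>\<^sup>+w. (f w)\<^sup>2 * indicator A w \<partial>lborel) + ?X = (\<integral>\<^sup>+w. (f w)\<^sup>2 \<partial>lborel)"
    by (subst nn_integral_add[symmetric]) (auto intro!: nn_integral_cong split: split_indicator)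
  then have *: "ennreal d + ?X \<le> 1" using f d by simp
  then have "?X \<noteq> top" by (auto simp: top_unique)
  then obtain x where x: "?X = ennreal x" "0 \<le> x" by (cases ?X) auto
  with * d have "d + x \<le> 1" by (simp flip: ennreal_plus)
  then show "?X \<le> ennreal (1 - d)" "d \<le> 1" using x by (auto intro: ennreal_leI)
qed

lemma adams_const_ge:
  assumes "0 \<le> C"
  shows "4 \<le> adams_const C" "1 + 8 * C + 4 * C\<^sup>2 \<le> adams_const C"
  using assms by (auto simp: adams_const_def)

lemma ln_inverse_adams_nonneg:
  assumes "0 \<le> C" "0 < t" "t \<le> 4"
  shows "0 \<le> ln (1 / t) + adams_const C"
proof -
  have "ln t \<le> ln 4" using assms by simp
  moreover have "ln (1 / t) = - ln t" using assms by (simp add: ln_div)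
  ultimately show ?thesis using ln_four_le adams_const_ge[OF assms(1)] by linarith
qed

text \<open>Mass placed on a set of area comparable to t is almost wasted. Off \<open>A\<close>,
  Cauchy-Schwarz yields the logarithm with the reduced mass 1 - d; on \<open>A\<close>, the test
  kernel is at most 2 (1 + C) sqrt t, so the mass d brings only a bounded amount. With
  \<open>A = {}\<close> and \<open>d = 0\<close> this is the weak-type bound.\<close>

lemma potential_level_le:
  fixes f :: "complex \<Rightarrow> ennreal"
  assumes C: "0 \<le> C" and [measurable]: "f \<in> borel_measurable borel" "E \<in> sets borel" "A \<in> sets borel"
    and f: "(\<integral>\<^sup>+w. (f w)\<^sup>2 \<partial>lborel) \<le> 1"
    and t: "emeasure lborel E = ennreal t" "0 < t" "t \<le> 4"
    and l: "0 \<le> l" "\<And>z. z \<in> E \<Longrightarrow> ennreal l \<le> (\<integral>\<^sup>+w. ennreal (ring_kernel C 0 2 z w) * f w \<partial>lborel)"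
    and A: "emeasure lborel A \<le> ennreal (pi * t)"
    and d: "(\<integral>\<^sup>+w. (f w)\<^sup>2 * indicator A w \<partial>lborel) = ennreal d" "0 \<le> d"
  shows "sqrt (4 * pi) * l \<le> sqrt ((1 - d) * (ln (1 / t) + adams_const C)) + 4 * pi * (1 + C) * sqrt d"
proof -
  let ?G = "test_kernel C (sqrt t) (sqrt t) E"
  have st: "sqrt t \<le> 2" using t real_sqrt_le_mono[of t 4] by simp
  note G = test_kernel_le[OF C \<open>E \<in> sets borel\<close> t(1,2) order_refl st]
  note G2 = nn_integral_test_kernel_sq[OF C \<open>E \<in> sets borel\<close> t(1,2) order_refl st]
  have L: "0 \<le> ln (1 / t) + adams_const C" using C t by (intro ln_inverse_adams_nonneg) auto
  have d1: "d \<le> 1" using nn_integral_sq_compl_le[OF _ _ f d] by simp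
  have "ennreal (l * t) \<le> (\<integral>\<^sup>+w. f w * ?G w \<partial>lborel)
     + (\<integral>\<^sup>+z. (\<integral>\<^sup>+w. ennreal (ring_kernel C (sqrt t) (sqrt t) z w) * f w \<partial>lborel) * indicator E z \<partial>lborel)"
    using C t st l by (intro potential_test_ineq) auto
  also have "\<dots> = (\<integral>\<^sup>+w. f w * ?G w \<partial>lborel)"
    by (simp add: ring_kernel_self)
  also have "\<dots> = (\<integral>\<^sup>+w. (f w * indicator (- A) w) * ?G w + (f w * indicator A w) * (?G w * indicator A w) \<partial>lborel)"
    by (intro nn_integral_cong) (auto split: split_indicator)
  also have "\<dots> = (\<integral>\<^sup>+w. (f w * indicator (- A) w) * ?G w \<partial>lborel)
      + (\<integral>\<^sup>+w. (f w * indicator A w) * (?G w * indicator A w) \<partial>lborel)"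
    by (rule nn_integral_add) measurable
  also have "\<dots> \<le> ennreal (sqrt ((1 - d) * (t\<^sup>2 * ((ln (1 / t) + adams_const C) / (4 * pi)))))
      + ennreal (sqrt (d * ((2 * (1 + C) * sqrt t)\<^sup>2 * (pi * t))))"
  proof (intro add_mono nn_integral_mult_le_sqrt)
    have "(\<integral>\<^sup>+w. (f w * indicator (- A) w)\<^sup>2 \<partial>lborel) = (\<integral>\<^sup>+w. (f w)\<^sup>2 * indicator (- A) w \<partial>lborel)"
      by (intro nn_integral_cong) (auto split: split_indicator)
    then show "(\<integral>\<^sup>+w. (f w * indicator (- A) w)\<^sup>2 \<partial>lborel) \<le> ennreal (1 - d)"
      using nn_integral_sq_compl_le[OF _ _ f d] by simp
    show "(\<integral>\<^sup>+w. (?G w)\<^sup>2 \<partial>lborel) \<le> ennreal (t\<^sup>2 * ((ln (1 / t) + adams_const C) / (4 * pi)))"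
      using G2 t by simp
    have "(\<integral>\<^sup>+w. (f w * indicator A w)\<^sup>2 \<partial>lborel) = (\<integral>\<^sup>+w. (f w)\<^sup>2 * indicator A w \<partial>lborel)"
      by (intro nn_integral_cong) (auto split: split_indicator)
    then show "(\<integral>\<^sup>+w. (f w * indicator A w)\<^sup>2 \<partial>lborel) \<le> ennreal d"
      using d by simp
    have "(\<integral>\<^sup>+w. (?G w * indicator A w)\<^sup>2 \<partial>lborel) \<le> (\<integral>\<^sup>+w. (ennreal (2 * (1 + C) * sqrt t))\<^sup>2 * indicator A w \<partial>lborel)"
    proof (rule nn_integral_mono)
      fix w
      have "(?G w * indicator A w)\<^sup>2 = (?G w)\<^sup>2 * indicator A w"
        by (auto split: split_indicator)
      also have "\<dots> \<le> (ennreal (2 * (1 + C) * sqrt t))\<^sup>2 * indicator A w"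
        by (intro mult_right_mono power_mono G) auto
      finally show "(?G w * indicator A w)\<^sup>2 \<le> (ennreal (2 * (1 + C) * sqrt t))\<^sup>2 * indicator A w" .
    qed
    also have "\<dots> = (ennreal (2 * (1 + C) * sqrt t))\<^sup>2 * emeasure lborel A"
      by (simp add: nn_integral_cmult_indicator)
    also have "\<dots> \<le> (ennreal (2 * (1 + C) * sqrt t))\<^sup>2 * ennreal (pi * t)"
      by (intro mult_left_mono A) auto
    also have "\<dots> = ennreal ((2 * (1 + C) * sqrt t)\<^sup>2 * (pi * t))"
      using C t by (subst ennreal_power) (auto simp: ennreal_mult)
    finally show "(\<integral>\<^sup>+w. (?G w * indicator A w)\<^sup>2 \<partial>lborel) \<le> ennreal ((2 * (1 + C) * sqrt t)\<^sup>2 * (pi * t))" .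
  qed (use d1 d L C t in auto)
  also have "\<dots> = ennreal (sqrt ((1 - d) * (t\<^sup>2 * ((ln (1 / t) + adams_const C) / (4 * pi))))
      + sqrt (d * ((2 * (1 + C) * sqrt t)\<^sup>2 * (pi * t))))"
    using d1 d L C t by (intro ennreal_plus[symmetric]) auto
  finally have "l * t \<le> sqrt ((1 - d) * (t\<^sup>2 * ((ln (1 / t) + adams_const C) / (4 * pi))))
      + sqrt (d * ((2 * (1 + C) * sqrt t)\<^sup>2 * (pi * t)))"
    using d1 d L C t by (subst (asm) ennreal_le_iff) auto
  also have "sqrt ((1 - d) * (t\<^sup>2 * ((ln (1 / t) + adams_const C) / (4 * pi))))
      = t * (sqrt ((1 - d) * (ln (1 / t) + adams_const C)) / sqrt (4 * pi))"
    using t by (simp add: real_sqrt_mult real_sqrt_divide)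
  also have "sqrt (d * ((2 * (1 + C) * sqrt t)\<^sup>2 * (pi * t))) = t * (2 * (1 + C) * sqrt pi * sqrt d)"
    using t C by (simp add: real_sqrt_mult power_mult_distrib)
  finally have "t * l \<le> t * (sqrt ((1 - d) * (ln (1 / t) + adams_const C)) / sqrt (4 * pi) + 2 * (1 + C) * sqrt pi * sqrt d)"
    by (simp add: algebra_simps)
  then have "l \<le> sqrt ((1 - d) * (ln (1 / t) + adams_const C)) / sqrt (4 * pi) + 2 * (1 + C) * sqrt pi * sqrt d"
    using t by simp
  then have "sqrt (4 * pi) * l \<le> sqrt (4 * pi) * (sqrt ((1 - d) * (ln (1 / t) + adams_const C)) / sqrt (4 * pi) + 2 * (1 + C) * sqrt pi * sqrt d)"
    by (intro mult_left_mono) auto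
  also have "\<dots> = sqrt ((1 - d) * (ln (1 / t) + adams_const C)) + 2 * (sqrt (4 * pi) * sqrt pi) * (1 + C) * sqrt d"
    by (simp add: distrib_left) (simp add: algebra_simps)
  also have "sqrt (4 * pi) * sqrt pi = 2 * pi"
    by (simp add: real_sqrt_mult)
  finally show ?thesis by simp
qed

text \<open>Scales beyond \<open>r\<close> and below sqrt t are paired with the full unit mass; a
  scale between sqrt t and \<open>r\<close> sees only the mass of one ball of radius
  \<open>r\<close>. Here \<open>d\<close> is the square root of that mass, unlike in
  \<open>potential_level_le\<close>.\<close>

lemma potential_level_le_local:
  fixes f :: "complex \<Rightarrow> ennreal"
  assumes C: "0 \<le> C" and [measurable]: "f \<in> borel_measurable borel" "E \<in> sets borel"
    and f: "(\<integral>\<^sup>+w. (f w)\<^sup>2 \<partial>lborel) \<le> 1"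
    and t: "emeasure lborel E = ennreal t" "0 < t" and r: "sqrt t \<le> r" "r \<le> 2"
    and l: "0 \<le> l" "\<And>z. z \<in> E \<Longrightarrow> ennreal l \<le> (\<integral>\<^sup>+w. ennreal (ring_kernel C 0 2 z w) * f w \<partial>lborel)"
    and d: "\<And>z. (\<integral>\<^sup>+w. (f w)\<^sup>2 * indicator (ball z r) w \<partial>lborel) \<le> ennreal (d\<^sup>2)" "0 \<le> d"
  shows "sqrt (4 * pi) * l \<le> sqrt (ln (1 / r\<^sup>2) + adams_const C) + d * sqrt (ln (r\<^sup>2 / t) + adams_const C)"
proof -
  let ?G = "test_kernel C (sqrt t) r E" and ?B = "adams_const C"
  have [measurable]: "ball z r \<in> sets borel" for z :: complex by simp
  have r0: "0 < r" using t r by (auto intro: less_le_trans[of _ "sqrt t"])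
  have tr: "t \<le> r\<^sup>2" using t r r0 by (simp add: real_sqrt_le_iff' sqrt_le_D)
  have L: "0 \<le> ln (1 / r\<^sup>2) + ?B"
    using C r0 power_mono[of r 2 2] r by (intro ln_inverse_adams_nonneg) auto
  have L': "0 \<le> ln (r\<^sup>2 / t) + ?B"
    using C tr t adams_const_ge[of C] by (intro add_nonneg_nonneg ln_ge_zero) auto
  note G2 = nn_integral_test_kernel_sq[OF C \<open>E \<in> sets borel\<close> t(1,2) r]
  have mid: "(\<integral>\<^sup>+w. ennreal (ring_kernel C (sqrt t) r z w) * f w \<partial>lborel)
      \<le> ennreal (sqrt ((ln (r\<^sup>2 / t) + ?B) / (4 * pi) * d\<^sup>2))" for z
  proof -
    have "(\<integral>\<^sup>+w. ennreal (ring_kernel C (sqrt t) r z w) * f w \<partial>lborel)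
       = (\<integral>\<^sup>+w. ennreal (ring_kernel C (sqrt t) r z w) * (f w * indicator (ball z r) w) \<partial>lborel)"
      by (intro nn_integral_cong) (auto split: split_indicator simp: ring_kernel_def dist_norm)
    also have "\<dots> \<le> ennreal (sqrt ((ln (r\<^sup>2 / t) + ?B) / (4 * pi) * d\<^sup>2))"
    proof (rule nn_integral_mult_le_sqrt)
      have "(\<integral>\<^sup>+w. (ennreal (ring_kernel C (sqrt t) r z w))\<^sup>2 \<partial>lborel)
        \<le> ennreal ((ln (r\<^sup>2 / (sqrt t)\<^sup>2) + (1 + 8 * C + 4 * C\<^sup>2)) / (4 * pi))"
        using C t r by (intro nn_integral_ring_kernel_sq) auto
      also have "\<dots> \<le> ennreal ((ln (r\<^sup>2 / t) + ?B) / (4 * pi))"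
        using t adams_const_ge[OF C] by (intro ennreal_leI divide_right_mono) auto
      finally show "(\<integral>\<^sup>+w. (ennreal (ring_kernel C (sqrt t) r z w))\<^sup>2 \<partial>lborel)
        \<le> ennreal ((ln (r\<^sup>2 / t) + ?B) / (4 * pi))" .
      have "(\<integral>\<^sup>+w. (f w * indicator (ball z r) w)\<^sup>2 \<partial>lborel) = (\<integral>\<^sup>+w. (f w)\<^sup>2 * indicator (ball z r) w \<partial>lborel)"
        by (intro nn_integral_cong) (auto split: split_indicator)
      then show "(\<integral>\<^sup>+w. (f w * indicator (ball z r) w)\<^sup>2 \<partial>lborel) \<le> ennreal (d\<^sup>2)"
        using d by simp
    qed (use L' in auto)
    finally show ?thesis .
  qed
  have "ennreal (l * t) \<le> (\<integral>\<^sup>+w. f w * ?G w \<partial>lborel)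
     + (\<integral>\<^sup>+z. (\<integral>\<^sup>+w. ennreal (ring_kernel C (sqrt t) r z w) * f w \<partial>lborel) * indicator E z \<partial>lborel)"
    using C t r l by (intro potential_test_ineq) auto
  also have "\<dots> \<le> ennreal (sqrt (1 * (t\<^sup>2 * ((ln (1 / r\<^sup>2) + ?B) / (4 * pi)))))
     + (\<integral>\<^sup>+z. ennreal (sqrt ((ln (r\<^sup>2 / t) + ?B) / (4 * pi) * d\<^sup>2)) * indicator E z \<partial>lborel)"
    using f G2 L by (intro add_mono nn_integral_mult_le_sqrt nn_integral_mono mult_right_mono mid) auto
  also have "\<dots> = ennreal (sqrt (1 * (t\<^sup>2 * ((ln (1 / r\<^sup>2) + ?B) / (4 * pi))))
     + sqrt ((ln (r\<^sup>2 / t) + ?B) / (4 * pi) * d\<^sup>2) * t)"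
    using L L' t by (simp add: nn_integral_cmult_indicator ennreal_mult)
  finally have "l * t \<le> sqrt (1 * (t\<^sup>2 * ((ln (1 / r\<^sup>2) + ?B) / (4 * pi))))
     + sqrt ((ln (r\<^sup>2 / t) + ?B) / (4 * pi) * d\<^sup>2) * t"
    using L L' t by (subst (asm) ennreal_le_iff) auto
  also have "sqrt (1 * (t\<^sup>2 * ((ln (1 / r\<^sup>2) + ?B) / (4 * pi)))) = sqrt (ln (1 / r\<^sup>2) + ?B) / sqrt (4 * pi) * t"
    using t by (simp add: real_sqrt_mult real_sqrt_divide)
  also have "sqrt ((ln (r\<^sup>2 / t) + ?B) / (4 * pi) * d\<^sup>2) = d * (sqrt (ln (r\<^sup>2 / t) + ?B) / sqrt (4 * pi))"
    using d by (simp add: real_sqrt_mult real_sqrt_divide)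
  also have "sqrt (ln (1 / r\<^sup>2) + ?B) / sqrt (4 * pi) * t + d * (sqrt (ln (r\<^sup>2 / t) + ?B) / sqrt (4 * pi)) * t
     = (sqrt (ln (1 / r\<^sup>2) + ?B) / sqrt (4 * pi) + d * (sqrt (ln (r\<^sup>2 / t) + ?B) / sqrt (4 * pi))) * t"
    by (simp add: distrib_right)
  finally have "l \<le> sqrt (ln (1 / r\<^sup>2) + ?B) / sqrt (4 * pi) + d * (sqrt (ln (r\<^sup>2 / t) + ?B) / sqrt (4 * pi))"
    using t by simp
  then have "sqrt (4 * pi) * l \<le> sqrt (4 * pi) * (sqrt (ln (1 / r\<^sup>2) + ?B) / sqrt (4 * pi) + d * (sqrt (ln (r\<^sup>2 / t) + ?B) / sqrt (4 * pi)))"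
    by (intro mult_left_mono) auto
  also have "\<dots> = sqrt (ln (1 / r\<^sup>2) + ?B) + d * sqrt (ln (r\<^sup>2 / t) + ?B)"
    by (simp add: distrib_left)
  finally show ?thesis .
qed

subsection \<open>Adams' inequality on the disc\<close>

text \<open>The two arithmetic facts behind the counting of levels: if the level \<open>x\<close> is attained up to
  an error \<open>s\<close>, then the density has little mass \<open>d\<close> in small balls, and therefore a second such level
  \<open>x + y\<close> cannot be far away.\<close>

lemma concentration_bound:
  fixes B c s x d L :: real
  assumes "1 \<le> B" "0 \<le> c" "0 \<le> s" "0 \<le> x" "0 \<le> d" "d \<le> 1" "0 \<le> L + B" "L \<le> x + s"
    and le: "sqrt x \<le> sqrt ((1 - d) * (L + B)) + c * sqrt d"
  shows "d * (x + s + B) \<le> (4 * B + 4 * c\<^sup>2) * (1 + s)"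
proof -
  \<comment> \<open>The quantity to be bounded is y^2. Multiplying the hypothesis by
    \<open>b\<close> turns it into a quadratic inequality for \<open>y\<close> in which the large x
    cancels.\<close>
  define b where "b = sqrt (x + s + B)"
  define y where "y = sqrt d * b"
  have b: "0 < b" "b\<^sup>2 = x + s + B" using assms by (auto simp: b_def)
  have y: "0 \<le> y" "y\<^sup>2 = d * (x + s + B)" using assms b by (auto simp: y_def power_mult_distrib)
  have "sqrt ((1 - d) * (L + B)) \<le> sqrt (1 - d) * b"
    unfolding b_def real_sqrt_mult using assms by (intro mult_left_mono) auto
  \<comment> \<open>The loss of mass enters linearly in d, whereas the gain is of order sqrt d; this
    produces -y^2 / 2 against c y.\<close>
  also have "sqrt (1 - d) \<le> 1 - d / 2"
    using assms by (intro real_le_lsqrt) (auto simp: power2_eq_square field_simps)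
  finally have "sqrt x \<le> (1 - d / 2) * b + c * sqrt d"
    using b le by (auto simp: mult_right_mono)
  then have "sqrt x * b \<le> ((1 - d / 2) * b + c * sqrt d) * b"
    using b by (intro mult_right_mono) auto
  also have "\<dots> = b\<^sup>2 - y\<^sup>2 / 2 + c * y"
    using assms by (simp add: y_def power_mult_distrib power2_eq_square algebra_simps)
  finally have 1: "sqrt x * b \<le> b\<^sup>2 - y\<^sup>2 / 2 + c * y" .
  have "sqrt x * sqrt x \<le> sqrt x * b"
    using assms unfolding b_def by (intro mult_left_mono) auto
  then have "x \<le> sqrt x * b" using assms by simp
  with 1 have "y\<^sup>2 \<le> 2 * (s + B) + 2 * c * y" using b by simp
  moreover have "2 * c * y \<le> 2 * c\<^sup>2 + y\<^sup>2 / 2"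
    using zero_le_power2[of "2 * c - y"] by (simp add: power2_eq_square algebra_simps)
  ultimately have "y\<^sup>2 \<le> 4 * (s + B) + 4 * c\<^sup>2" by simp
  also have "\<dots> \<le> (4 * B + 4 * c\<^sup>2) * (1 + s)"
  proof -
    have "1 * s \<le> B * s" using assms by (intro mult_right_mono) auto
    moreover have "0 \<le> c\<^sup>2 * s" using assms by simp
    ultimately show ?thesis by (simp add: algebra_simps)
  qed
  finally show ?thesis using y by simp
qed

lemma gap_bound:
  fixes B K s x y d m :: real
  assumes "1 \<le> B" "1 \<le> K" "0 \<le> s" "0 \<le> y" "0 \<le> d" "0 \<le> m"
    and x: "4 * K * (1 + s) \<le> x"
    and d: "d\<^sup>2 * (x + s + B) \<le> K * (1 + s)"
    and m: "m\<^sup>2 \<le> y + s + 2 * B"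
    and le: "sqrt (x + y) \<le> sqrt (x + s + B) + d * m"
  shows "y \<le> (3 + 4 * B + 8 * K) * (1 + s)"
proof -
  have K: "0 < K * (1 + s)" using assms by simp
  then have x0: "0 < x" using x by linarith
  \<comment> \<open>Half of the coefficient of \<open>m\<close> in the cross term when the
    hypothesis is squared; the bound on d makes it independent of the size of x.\<close>
  define p where "p = sqrt (x + s + B) * d"
  have p: "p\<^sup>2 \<le> K * (1 + s)"
    using d x0 assms by (simp add: p_def power_mult_distrib mult.commute)
  \<comment> \<open>The threshold on x serves to give d <= 1/2. Then d^2 m^2 and the cross term each
    contribute only m^2 / 4, and their sum, containing y / 2, is absorbed on the left.\<close>
  have "d\<^sup>2 * (4 * K * (1 + s)) \<le> d\<^sup>2 * (x + s + B)"
    using x assms by (intro mult_left_mono) auto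
  with d have "(4 * d\<^sup>2) * (K * (1 + s)) \<le> 1 * (K * (1 + s))" by (simp add: algebra_simps)
  then have d4: "4 * d\<^sup>2 \<le> 1" using K by (simp only: mult_le_cancel_right)
  have "x + y = (sqrt (x + y))\<^sup>2" using x0 assms by simp
  also have "\<dots> \<le> (sqrt (x + s + B) + d * m)\<^sup>2"
    using le x0 assms by (intro power_mono) auto
  also have "\<dots> = x + s + B + 2 * p * m + d\<^sup>2 * m\<^sup>2"
    using x0 assms by (simp add: power2_sum p_def power_mult_distrib)
  finally have 1: "y \<le> s + B + 2 * p * m + d\<^sup>2 * m\<^sup>2" by simp
  have "2 * p * m \<le> 4 * p\<^sup>2 + m\<^sup>2 / 4"
    using zero_le_power2[of "2 * p - m / 2"] by (simp add: power2_eq_square algebra_simps)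
  moreover have "d\<^sup>2 * m\<^sup>2 \<le> 1 / 4 * m\<^sup>2" using d4 by (intro mult_right_mono) auto
  ultimately have "y \<le> s + B + 4 * (K * (1 + s)) + (y + s + 2 * B) / 2"
    using 1 p m by argo
  then have "y \<le> 3 * s + 4 * B + 8 * (K * (1 + s))" by argo
  also have "\<dots> \<le> (3 + 4 * B + 8 * K) * (1 + s)"
    using assms by (simp add: algebra_simps)
  finally show ?thesis .
qed

text \<open>Terms are grouped by size: those of at least 1 are bounded by \<open>A\<close>, and
  those between e^-(k+1) and e^-k number at most K (2 + k), which is summable against e^-k.
  Finiteness is assumed explicitly because \<open>card\<close> of an infinite set is 0.\<close>

lemma suminf_le_of_level_counts:
  fixes a :: "nat \<Rightarrow> real"
  assumes a: "\<And>n. 0 \<le> a n" "\<And>n. a n \<le> A" and K: "0 \<le> K"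
    and S: "\<And>k::nat. finite {n. exp (- real k) \<le> a n} \<and> card {n. exp (- real k) \<le> a n} \<le> K * (1 + real k)"
  shows "(\<Sum>n. ennreal (a n)) \<le> ennreal (A * K + (\<Sum>k. exp (- real k) * (K * (2 + real k))))"
proof -
  define S where "S k = {n. exp (- real k) \<le> a n}" for k :: nat
  have cardS: "emeasure (count_space UNIV) (S k) \<le> ennreal (K * (1 + real k))" for k
    using assms(4)[of k] by (simp add: S_def emeasure_count_space ennreal_of_nat_eq_real_of_nat ennreal_leI)
  have A0: "0 \<le> A" using a[of 0] by simp
  have bound: "ennreal (a n) \<le> ennreal A * indicator (S 0) n + (\<Sum>k. ennreal (exp (- real k)) * indicator (S (Suc k)) n)" for n
  proof (cases "n \<in> S 0 \<or> a n = 0")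
    case True
    then show ?thesis using a[of n] by (auto intro: add_increasing2 ennreal_leI)
  next
    case False
    then have n: "0 < a n" "a n < 1" using a(1)[of n] by (auto simp: S_def)
    define k where "k = nat \<lfloor>- ln (a n)\<rfloor>"
    have "0 \<le> - ln (a n)" using n by simp
    then have k: "real k \<le> - ln (a n)" "- ln (a n) < real (Suc k)"
      unfolding k_def by linarith+
    then have "a n \<le> exp (- real k)" "exp (- real (Suc k)) \<le> a n"
      using n by (smt (verit) exp_ln exp_le_cancel_iff)+
    then have "ennreal (a n) \<le> ennreal (exp (- real k)) * indicator (S (Suc k)) n"
      by (auto simp: S_def intro: ennreal_leI)
    also have "\<dots> \<le> (\<Sum>k. ennreal (exp (- real k)) * indicator (S (Suc k)) n)"
    proof -
      have "g k \<le> (\<Sum>k. g k)" for g :: "nat \<Rightarrow> ennreal"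
        using sum_le_suminf[OF summableI, of "{k}" g] by simp
      then show ?thesis .
    qed
    finally show ?thesis by (simp add: add_increasing)
  qed
  have summ: "summable (\<lambda>k. exp (- real k) * (K * (2 + real k)))"
  proof -
    have "summable (\<lambda>k. (2 * K) * exp (-1) ^ k)"
      by (intro summable_mult summable_geometric) simp
    moreover have "summable (\<lambda>k. K * (real k * exp (-1) ^ k))"
    proof (intro summable_mult)
      have "summable (\<lambda>n. diffs (\<lambda>_. 1 :: real) n * exp (-1) ^ n)"
        by (rule termdiff_converges[of _ 1]) (auto intro: summable_geometric)
      then have "summable (\<lambda>n. real (Suc n) * exp (-1) ^ n)" by (simp add: diffs_def)
      moreover have "summable (\<lambda>n. exp (-1 :: real) ^ n)" by (intro summable_geometric) simp
      ultimately have "summable (\<lambda>n. real (Suc n) * exp (-1) ^ n - exp (-1 :: real) ^ n)"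
        by (rule summable_diff)
      then show "summable (\<lambda>k. real k * exp (-1) ^ k)" by (simp add: algebra_simps)
    qed
    ultimately have "summable (\<lambda>k. (2 * K) * exp (-1) ^ k + K * (real k * exp (-1) ^ k))"
      by (rule summable_add)
    moreover have "exp (- real k) = exp (-1) ^ k" for k
      by (simp add: exp_of_nat_mult[symmetric])
    ultimately show ?thesis by (simp add: algebra_simps)
  qed
  have "(\<Sum>n. ennreal (a n)) = (\<integral>\<^sup>+n. ennreal (a n) \<partial>count_space UNIV)"
    by (simp add: nn_integral_count_space_nat)
  also have "\<dots> \<le> (\<integral>\<^sup>+n. ennreal A * indicator (S 0) n
      + (\<Sum>k. ennreal (exp (- real k)) * indicator (S (Suc k)) n) \<partial>count_space UNIV)"
    by (intro nn_integral_mono bound)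
  also have "\<dots> = ennreal A * emeasure (count_space UNIV) (S 0)
      + (\<Sum>k. ennreal (exp (- real k)) * emeasure (count_space UNIV) (S (Suc k)))"
    by (simp add: nn_integral_add nn_integral_suminf nn_integral_cmult_indicator)
  also have "\<dots> \<le> ennreal A * ennreal (K * (1 + real 0)) + (\<Sum>k. ennreal (exp (- real k)) * ennreal (K * (1 + real (Suc k))))"
    by (intro add_mono mult_left_mono cardS suminf_le summableI) auto
  also have "\<dots> = ennreal (A * K) + (\<Sum>k. ennreal (exp (- real k) * (K * (2 + real k))))"
    using A0 K by (simp add: ennreal_mult[symmetric] add_ac)
  also have "(\<Sum>k. ennreal (exp (- real k) * (K * (2 + real k)))) = ennreal (\<Sum>k. exp (- real k) * (K * (2 + real k)))"
    using K summ by (intro suminf_ennreal2) auto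
  also have "ennreal (A * K) + \<dots> = ennreal (A * K + (\<Sum>k. exp (- real k) * (K * (2 + real k))))"
    using A0 K summ by (intro ennreal_plus[symmetric] suminf_nonneg) auto
  finally show ?thesis .
qed

text \<open>\<open>T n\<close> is the area of the set where 4 pi h^2 >= n, and the first bound
  controls each term without giving a convergent sum. Call n nearly extremal if exp n * T n >= exp
  (-k). There are few integers below 4 K (1 + k). The first nearly extremal level beyond that
  threshold spreads the density so much that all later ones lie within a constant multiple of 1 + k
  of it.\<close>

lemma
  fixes f :: "complex \<Rightarrow> ennreal" and h :: "complex \<Rightarrow> real"
  assumes C: "0 \<le> C" and [measurable]: "f \<in> borel_measurable borel" "h \<in> borel_measurable borel"
    and f: "(\<integral>\<^sup>+w. (f w)\<^sup>2 \<partial>lborel) \<le> 1"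
    and h: "\<And>z. 0 \<le> h z"
      "\<And>z. z \<in> ball 0 1 \<Longrightarrow> ennreal (h z) \<le> (\<integral>\<^sup>+w. ennreal (ring_kernel C 0 2 z w) * f w \<partial>lborel)"
  defines "B \<equiv> adams_const C"
  defines "K \<equiv> 4 * B + 4 * (4 * pi * (1 + C))\<^sup>2"
  defines "T \<equiv> \<lambda>n::nat. measure lborel {z \<in> ball 0 1. real n \<le> 4 * pi * (h z)\<^sup>2}"
  shows level_measure_le: "exp (real n) * T n \<le> exp B"
    and level_count: "finite {n. exp (- real k) \<le> exp (real n) * T n} \<and>
      card {n. exp (- real k) \<le> exp (real n) * T n} \<le> (5 + 4 * B + 12 * K) * (1 + real k)"
proof -
  define E where "E n = {z \<in> ball 0 1. real n \<le> 4 * pi * (h z)\<^sup>2}" for n :: nat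
  have B4: "4 \<le> B" using adams_const_ge[OF C] by (simp add: B_def)
  have K1: "1 \<le> K" using B4 by (simp add: K_def add_increasing2)
  have [measurable]: "ball z r \<in> sets borel" for z :: complex and r by simp
  have Em[measurable]: "E n \<in> sets borel" for n
  proof -
    have "E n = ball 0 1 \<inter> {z \<in> space borel. real n \<le> 4 * pi * (h z)\<^sup>2}" by (auto simp: E_def)
    also have "\<dots> \<in> sets borel" by measurable
    finally show ?thesis .
  qed
  have fin: "emeasure lborel (E n) \<noteq> top" for n
  proof -
    have "emeasure lborel (E n) \<le> emeasure lborel (ball (0::complex) 1)"
      by (intro emeasure_mono) (auto simp: E_def)
    then show ?thesis by (auto simp: emeasure_lborel_ball_complex top_unique)
  qed
  have ET: "emeasure lborel (E n) = ennreal (T n)" for n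
    unfolding T_def using fin[of n] by (simp add: emeasure_eq_ennreal_measure E_def)
  have T0: "0 \<le> T n" for n by (simp add: T_def)
  have Tmono: "T m \<le> T n" if "n \<le> m" for m n
  proof -
    have "emeasure lborel (E m) \<le> emeasure lborel (E n)"
      using that by (intro emeasure_mono) (auto simp: E_def)
    then show ?thesis using T0 by (simp add: ET)
  qed
  have T4: "T n \<le> 4" for n
  proof -
    have "emeasure lborel (E n) \<le> emeasure lborel (ball (0::complex) 1)"
      by (intro emeasure_mono) (auto simp: E_def)
    then have "T n \<le> pi" by (simp add: ET emeasure_lborel_ball_complex)
    then show ?thesis using pi_less_4 by simp
  qed
  have lev: "ennreal (sqrt (real n / (4 * pi))) \<le> (\<integral>\<^sup>+w. ennreal (ring_kernel C 0 2 z w) * f w \<partial>lborel)"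
    if "z \<in> E n" for n z
  proof -
    have "real n / (4 * pi) \<le> (h z)\<^sup>2" using that by (simp add: E_def field_simps)
    then have "sqrt (real n / (4 * pi)) \<le> h z" using h by (intro real_le_lsqrt) auto
    then have "ennreal (sqrt (real n / (4 * pi))) \<le> ennreal (h z)" by (rule ennreal_leI)
    also have "\<dots> \<le> (\<integral>\<^sup>+w. ennreal (ring_kernel C 0 2 z w) * f w \<partial>lborel)"
      using h that by (simp add: E_def)
    finally show ?thesis .
  qed
  have sq: "sqrt (4 * pi) * sqrt (real n / (4 * pi)) = sqrt (real n)" for n :: nat
    by (simp flip: real_sqrt_mult)
  \<comment> \<open>Weak-type bound: no mass is singled out, so the empty set and mass 0 are
    used.\<close>
  have Ln: "real n \<le> - ln (T n) + B" if "0 < T n" for n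
  proof -
    have "sqrt (4 * pi) * sqrt (real n / (4 * pi)) \<le> sqrt ((1 - 0) * (ln (1 / T n) + adams_const C)) + 4 * pi * (1 + C) * sqrt 0"
      using C f that T4 by (intro potential_level_le[where f = f and E = "E n" and A = "{}"] lev) (auto simp: ET)
    then have "real n \<le> ln (1 / T n) + B"
      unfolding sq by (simp add: B_def)
    then show ?thesis using that by (simp add: ln_div)
  qed
  show "exp (real n) * T n \<le> exp B" for n
  proof (cases "T n = 0")
    case False
    then have T: "0 < T n" using T0[of n] by simp
    have "exp (real n) * T n = exp (real n + ln (T n))" using T by (simp add: exp_add)
    also have "\<dots> \<le> exp B" using Ln[OF T] by simp
    finally show ?thesis .
  qed simp
  \<comment> \<open>\<open>s\<close> measures how far a level may be from extremal: for n in
    \<open>S\<close>, - ln (T n) exceeds n by at most \<open>s\<close>.\<close>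
  define s where "s = real k"
  have s0: "0 \<le> s" by (simp add: s_def)
  define S where "S = {n. exp (- s) \<le> exp (real n) * T n}"
  have S: "0 < T n" "- ln (T n) \<le> real n + s" if "n \<in> S" for n
  proof -
    have "0 < exp (- s)" "exp (- s) \<le> exp (real n) * T n" using that by (auto simp: S_def)
    then have "0 < exp (real n) * T n" by linarith
    then show T: "0 < T n" by (simp add: zero_less_mult_iff)
    have "- s \<le> ln (exp (real n) * T n)"
      using \<open>exp (- s) \<le> exp (real n) * T n\<close> T by (subst ln_ge_iff) auto
    then show "- ln (T n) \<le> real n + s" using T by (simp add: ln_mult)
  qed
  \<comment> \<open>A disc of radius sqrt (T n) has area exactly pi * T n, the size allowed for the
    exceptional set in \<open>potential_level_le\<close>.\<close>
  have local: "(\<integral>\<^sup>+w. (f w)\<^sup>2 * indicator (ball z (sqrt (T n))) w \<partial>lborel)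
      \<le> ennreal ((sqrt (K * (1 + s) / (real n + s + B)))\<^sup>2)" if n: "n \<in> S" for n z
  proof -
    let ?I = "\<integral>\<^sup>+w. (f w)\<^sup>2 * indicator (ball z (sqrt (T n))) w \<partial>lborel"
    have "?I \<le> (\<integral>\<^sup>+w. (f w)\<^sup>2 \<partial>lborel)"
      by (intro nn_integral_mono) (auto split: split_indicator)
    with f have "?I \<le> 1" by simp
    then have "?I \<noteq> top" by (auto simp: top_unique)
    then obtain d where d: "?I = ennreal d" "0 \<le> d" by (cases ?I) auto
    have d1: "d \<le> 1" using \<open>?I \<le> 1\<close> d by simp
    have "sqrt (4 * pi) * sqrt (real n / (4 * pi)) \<le> sqrt ((1 - d) * (ln (1 / T n) + adams_const C)) + 4 * pi * (1 + C) * sqrt d"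
      using C f S[OF n] T4 d
      by (intro potential_level_le[where f = f and E = "E n" and A = "ball z (sqrt (T n))"] lev)
        (auto simp: ET emeasure_lborel_ball_complex)
    then have "sqrt (real n) \<le> sqrt ((1 - d) * (ln (1 / T n) + B)) + (4 * pi * (1 + C)) * sqrt d"
      unfolding sq by (simp add: B_def)
    then have "d * (real n + s + B) \<le> (4 * B + 4 * (4 * pi * (1 + C))\<^sup>2) * (1 + s)"
      using S[OF n] B4 C s0 d d1 ln_inverse_adams_nonneg[OF C, of "T n"] T4
      by (intro concentration_bound[where L = "ln (1 / T n)"]) (auto simp: ln_div B_def)
    then have "d \<le> K * (1 + s) / (real n + s + B)"
      using B4 s0 by (simp add: K_def field_simps)
    then show ?thesis using d B4 K1 s0 by (simp add: ennreal_leI)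
  qed
  have gap: "real m - real n \<le> (3 + 4 * B + 8 * K) * (1 + s)"
    if n: "n \<in> S" "4 * K * (1 + s) \<le> real n" and m: "m \<in> S" "n \<le> m" for m n
  proof (rule gap_bound)
    define d where "d = sqrt (K * (1 + s) / (real n + s + B))"
    note Sn = S[OF n(1)] and Sm = S[OF m(1)]
    have lnm: "ln (T m) \<le> ln (T n)" using Tmono[OF m(2)] Sm Sn by simp
    \<comment> \<open>The scales are split at sqrt (T n): larger ones contribute no more than level
      n allows, and the finer ones see only the small local mass forced by level n.\<close>
    have "sqrt (4 * pi) * sqrt (real m / (4 * pi)) \<le> sqrt (ln (1 / (sqrt (T n))\<^sup>2) + adams_const C)
        + d * sqrt (ln ((sqrt (T n))\<^sup>2 / T m) + adams_const C)"
      using C f Sn Sm T4[of n] Tmono[OF m(2)] local[OF n(1)] real_sqrt_le_mono[of "T n" 4] B4 K1 s0 unfolding d_def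
      by (intro potential_level_le_local[where f = f and E = "E m"] lev) (auto simp: ET)
    then have "sqrt (real m) \<le> sqrt (- ln (T n) + B) + d * sqrt (ln (T n) - ln (T m) + B)"
      using Sn Sm unfolding sq by (simp add: B_def ln_div)
    also have "sqrt (- ln (T n) + B) \<le> sqrt (real n + s + B)" using Sn by simp
    finally show "sqrt (real n + (real m - real n)) \<le> sqrt (real n + s + B) + d * sqrt (ln (T n) - ln (T m) + B)"
      by simp
    \<comment> \<open>Near extremality of m bounds - ln (T m) by m + s; the weak-type bound for n
      gives ln (T n) <= B - n.\<close>
    show "(sqrt (ln (T n) - ln (T m) + B))\<^sup>2 \<le> (real m - real n) + s + 2 * B"
      using lnm B4 Sm Ln[OF Sn(1)] by simp
    show "d\<^sup>2 * (real n + s + B) \<le> K * (1 + s)" "0 \<le> d"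
      using B4 K1 s0 by (auto simp: d_def)
    show "0 \<le> sqrt (ln (T n) - ln (T m) + B)" using lnm B4 by simp
  qed (use B4 K1 s0 n m in auto)
  define K3 where "K3 = (3 + 4 * B + 8 * K) * (1 + s)"
  have K3: "0 \<le> K3" using B4 K1 s0 by (simp add: K3_def)
  \<comment> \<open>Either no element of \<open>S\<close> passes the threshold, or the gap bound is
    applied from the least element that does.\<close>
  have "\<exists>p. S \<subseteq> {.. nat \<lfloor>4 * K * (1 + s)\<rfloor>} \<union> {p .. p + nat \<lfloor>K3\<rfloor>}"
  proof (cases "\<exists>n. n \<in> S \<and> 4 * K * (1 + s) \<le> real n")
    case True
    define p where "p = (LEAST n. n \<in> S \<and> 4 * K * (1 + s) \<le> real n)"
    have p: "p \<in> S" "4 * K * (1 + s) \<le> real p"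
      using LeastI_ex[OF True] by (auto simp: p_def)
    have "n \<in> {.. nat \<lfloor>4 * K * (1 + s)\<rfloor>} \<union> {p .. p + nat \<lfloor>K3\<rfloor>}" if n: "n \<in> S" for n
    proof (cases "4 * K * (1 + s) \<le> real n")
      case True
      then have "p \<le> n" using n by (auto simp: p_def intro: Least_le)
      from gap[OF p n this] have "real n - real p \<le> K3" by (simp add: K3_def)
      then have "n \<le> p + nat \<lfloor>K3\<rfloor>" by linarith
      with \<open>p \<le> n\<close> show ?thesis by simp
    next
      case False
      then have "n \<le> nat \<lfloor>4 * K * (1 + s)\<rfloor>" by linarith
      then show ?thesis by simp
    qed
    then show ?thesis by blast
  next
    case False
    have "n \<le> nat \<lfloor>4 * K * (1 + s)\<rfloor>" if "n \<in> S" for n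
    proof -
      have "real n < 4 * K * (1 + s)" using that False by auto
      then show ?thesis by linarith
    qed
    then show ?thesis by auto
  qed
  then obtain p where p: "S \<subseteq> {.. nat \<lfloor>4 * K * (1 + s)\<rfloor>} \<union> {p .. p + nat \<lfloor>K3\<rfloor>}" by blast
  then have finS: "finite S" by (rule finite_subset) simp
  have "card S \<le> card ({.. nat \<lfloor>4 * K * (1 + s)\<rfloor>} \<union> {p .. p + nat \<lfloor>K3\<rfloor>})"
    using p by (intro card_mono) auto
  also have "\<dots> \<le> card {.. nat \<lfloor>4 * K * (1 + s)\<rfloor>} + card {p .. p + nat \<lfloor>K3\<rfloor>}"
    by (rule card_Un_le)
  also have "\<dots> = nat \<lfloor>4 * K * (1 + s)\<rfloor> + 1 + (nat \<lfloor>K3\<rfloor> + 1)" by simp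
  finally have "real (card S) \<le> real (nat \<lfloor>4 * K * (1 + s)\<rfloor> + 1 + (nat \<lfloor>K3\<rfloor> + 1))" by (rule of_nat_mono)
  also have "\<dots> \<le> 4 * K * (1 + s) + K3 + 2"
  proof -
    have "0 \<le> 4 * K * (1 + s)" using K1 s0 by simp
    then show ?thesis using K3 by (simp add: of_nat_nat) linarith
  qed
  also have "\<dots> \<le> (5 + 4 * B + 12 * K) * (1 + s)"
    using s0 unfolding K3_def by (simp add: algebra_simps)
  finally show "finite {n. exp (- real k) \<le> exp (real n) * T n} \<and>
      card {n. exp (- real k) \<le> exp (real n) * T n} \<le> (5 + 4 * B + 12 * K) * (1 + real k)"
    using finS by (simp add: S_def s_def)
qed

text \<open>On each level the exponential is at most exp (n + 1) with n the integer part of 4 pi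
  h^2, so the integral is bounded by the series of exp (n + 1) * T n. It is enough that
  \<open>h\<close> lies below the potential, which lets |u| itself take its place; \<open>M\<close>
  depends on \<open>C\<close> alone.\<close>

lemma adams_inequality_disc:
  assumes C: "0 \<le> C"
  obtains M where "0 \<le> M" "\<And>f h. f \<in> borel_measurable borel \<Longrightarrow> h \<in> borel_measurable borel \<Longrightarrow>
    (\<integral>\<^sup>+w. (f w)\<^sup>2 \<partial>lborel) \<le> 1 \<Longrightarrow> (\<And>z. 0 \<le> h z) \<Longrightarrow>
    (\<And>z. z \<in> ball 0 1 \<Longrightarrow> ennreal (h z) \<le> (\<integral>\<^sup>+w. ennreal (ring_kernel C 0 2 z w) * f w \<partial>lborel)) \<Longrightarrow>
    (\<integral>\<^sup>+z. ennreal (exp (4 * pi * (h z)\<^sup>2)) * indicator (ball 0 1) z \<partial>lborel) \<le> ennreal M"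
proof -
  define B where "B = adams_const C"
  define K where "K = 4 * B + 4 * (4 * pi * (1 + C))\<^sup>2"
  define K4 where "K4 = 5 + 4 * B + 12 * K"
  define M where "M = exp 1 * (exp B * K4 + (\<Sum>k. exp (- real k) * (K4 * (2 + real k))))"
  have B4: "4 \<le> B" using adams_const_ge[OF C] by (simp add: B_def)
  then have K4: "0 \<le> K4" by (simp add: K4_def K_def)
  have main: "(\<integral>\<^sup>+z. ennreal (exp (4 * pi * (h z)\<^sup>2)) * indicator (ball 0 1) z \<partial>lborel) \<le> ennreal M"
    if [measurable]: "f \<in> borel_measurable borel" "h \<in> borel_measurable borel"
      and f: "(\<integral>\<^sup>+w. (f w)\<^sup>2 \<partial>lborel) \<le> 1" and h0: "\<And>z. 0 \<le> h z"
      and h: "\<And>z. z \<in> ball 0 1 \<Longrightarrow> ennreal (h z) \<le> (\<integral>\<^sup>+w. ennreal (ring_kernel C 0 2 z w) * f w \<partial>lborel)"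
    for f h
  proof -
    define E where "E n = {z \<in> ball 0 1. real n \<le> 4 * pi * (h z)\<^sup>2}" for n :: nat
    define T where "T n = measure lborel (E n)" for n
    have [measurable]: "ball z r \<in> sets borel" for z :: complex and r by simp
    have Em[measurable]: "E n \<in> sets borel" for n
    proof -
      have "E n = ball 0 1 \<inter> {z \<in> space borel. real n \<le> 4 * pi * (h z)\<^sup>2}" by (auto simp: E_def)
      also have "\<dots> \<in> sets borel" by measurable
      finally show ?thesis .
    qed
    have ET: "emeasure lborel (E n) = ennreal (T n)" for n
    proof -
      have "emeasure lborel (E n) \<le> emeasure lborel (ball (0::complex) 1)"
        by (intro emeasure_mono) (auto simp: E_def)
      then have "emeasure lborel (E n) \<noteq> top" by (auto simp: emeasure_lborel_ball_complex top_unique)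
      then show ?thesis by (simp add: T_def emeasure_eq_ennreal_measure)
    qed
    have "(\<integral>\<^sup>+z. ennreal (exp (4 * pi * (h z)\<^sup>2)) * indicator (ball 0 1) z \<partial>lborel)
      \<le> (\<integral>\<^sup>+z. (\<Sum>n. ennreal (exp (real n + 1)) * indicator (E n) z) \<partial>lborel)"
    proof (rule nn_integral_mono)
      fix z
      show "ennreal (exp (4 * pi * (h z)\<^sup>2)) * indicator (ball 0 1) z \<le> (\<Sum>n. ennreal (exp (real n + 1)) * indicator (E n) z)"
      proof (cases "z \<in> ball 0 1")
        case True
        define n where "n = nat \<lfloor>4 * pi * (h z)\<^sup>2\<rfloor>"
        have "0 \<le> 4 * pi * (h z)\<^sup>2" by simp
        then have n: "real n \<le> 4 * pi * (h z)\<^sup>2" "4 * pi * (h z)\<^sup>2 \<le> real n + 1"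
          unfolding n_def by linarith+
        then have "ennreal (exp (4 * pi * (h z)\<^sup>2)) * indicator (ball 0 1) z \<le> ennreal (exp (real n + 1)) * indicator (E n) z"
          using True by (simp add: E_def ennreal_leI)
        also have "\<dots> \<le> (\<Sum>n. ennreal (exp (real n + 1)) * indicator (E n) z)"
        proof -
          have "g n \<le> (\<Sum>n. g n)" for g :: "nat \<Rightarrow> ennreal"
            using sum_le_suminf[OF summableI, of "{n}" g] by simp
          then show ?thesis .
        qed
        finally show ?thesis .
      qed simp
    qed
    also have "\<dots> = (\<Sum>n. ennreal (exp (real n + 1)) * ennreal (T n))"
      by (simp add: nn_integral_suminf nn_integral_cmult_indicator ET)
    also have "\<dots> = (\<Sum>n. ennreal (exp 1) * ennreal (exp (real n) * T n))"
      by (simp add: ennreal_mult[symmetric] T_def exp_add mult_ac)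
    also have "\<dots> = ennreal (exp 1) * (\<Sum>n. ennreal (exp (real n) * T n))"
      by simp
    also have "\<dots> \<le> ennreal (exp 1) * ennreal (exp B * K4 + (\<Sum>k. exp (- real k) * (K4 * (2 + real k))))"
    proof (intro mult_left_mono suminf_le_of_level_counts)
      show "exp (real n) * T n \<le> exp B" for n
        using level_measure_le[OF C that, of n] by (simp add: B_def T_def E_def)
      show "finite {n. exp (- real k) \<le> exp (real n) * T n} \<and>
          card {n. exp (- real k) \<le> exp (real n) * T n} \<le> K4 * (1 + real k)" for k
        using level_count[OF C that, of k] by (simp add: K4_def K_def B_def T_def E_def)
    qed (auto simp: T_def K4)
    also have "\<dots> = ennreal M"
      by (simp add: M_def ennreal_mult'[symmetric])
    finally show ?thesis .
  qed
  \<comment> \<open>The maximum supplies nonnegativity without returning to the convergence of the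
    series inside \<open>M\<close>.\<close>
  have "ennreal M \<le> ennreal (max M 0)" by (rule ennreal_leI) simp
  then show ?thesis
    using main by (intro that[of "max M 0"]) (simp, blast intro: order_trans)
qed

subsection \<open>Gradients and representation by the gradient\<close>

definition grad :: "(complex \<Rightarrow> real) \<Rightarrow> complex \<Rightarrow> complex" where
  "grad u z = Complex (frechet_derivative u (at z) 1) (frechet_derivative u (at z) \<i>)"

lemma grad_sq_eq: "grad_sq u z = (cmod (grad u z))\<^sup>2"
  by (simp add: grad_sq_def grad_def cmod_power2)

lemma GDERIV_grad:
  assumes "u differentiable (at z)"
  shows "GDERIV u z :> grad u z"
proof -
  have D: "(u has_derivative frechet_derivative u (at z)) (at z)"
    using assms frechet_derivative_works by blast
  interpret L: linear "frechet_derivative u (at z)"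
    using D by (rule has_derivative_linear)
  have "frechet_derivative u (at z) h = h \<bullet> grad u z" for h
  proof -
    have "h = Re h *\<^sub>R 1 + Im h *\<^sub>R \<i>" by (simp add: complex_eq_iff)
    then have "frechet_derivative u (at z) h = frechet_derivative u (at z) (Re h *\<^sub>R 1 + Im h *\<^sub>R \<i>)" by simp
    also have "\<dots> = h \<bullet> grad u z"
      by (simp only: L.add L.scaleR) (simp add: inner_complex_def grad_def)
    finally show ?thesis .
  qed
  then show ?thesis using D unfolding gderiv_def by (metis ext)
qed

lemma GDERIV_transform_zero:
  fixes f :: "complex \<Rightarrow> real"
  assumes "closed K" "\<And>w. w \<notin> K \<Longrightarrow> f w = 0" "w \<notin> K"
  shows "GDERIV f w :> 0"
  unfolding gderiv_def
proof (rule has_derivative_transform_within_open)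
  show "((\<lambda>_. 0) has_derivative (\<lambda>h. h \<bullet> 0)) (at w)" by simp
  show "open (- K)" "w \<in> - K" using assms by auto
qed (use assms in auto)

lemma GDERIV_unique:
  assumes "GDERIV f w :> D" "GDERIV f w :> D'"
  shows "D = D'"
proof -
  have "(\<lambda>h. h \<bullet> D) = (\<lambda>h. h \<bullet> D')"
    using assms unfolding gderiv_def by (rule has_derivative_unique)
  then have "(D - D') \<bullet> D = (D - D') \<bullet> D'" by metis
  then have "(D - D') \<bullet> (D - D') = 0" by (simp only: inner_diff_right diff_self)
  then show ?thesis by simp
qed

text \<open>Meant for products of a Hardy weight, singular on the unit circle, with a factor
  supported in a compact subset of the disc.\<close>

lemma continuous_on_UNIV_of_closed_support:
  fixes f :: "'a::topological_space \<Rightarrow> 'b::{topological_space,zero}"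
  assumes "open U" "closed K" "K \<subseteq> U" "continuous_on U f" "\<And>w. w \<notin> K \<Longrightarrow> f w = 0"
  shows "continuous_on UNIV f"
proof -
  have "continuous_on (- K) f"
    using assms(5) by (subst continuous_on_cong[of _ "- K" _ "\<lambda>_. 0"]) auto
  then have "continuous_on (U \<union> - K) f"
    using assms by (intro continuous_on_open_Un) auto
  moreover have "U \<union> - K = UNIV" using assms by auto
  ultimately show ?thesis by simp
qed

lemma integrable_of_compact_support:
  fixes f :: "'a::euclidean_space \<Rightarrow> real"
  assumes "continuous_on UNIV f" "compact K" "\<And>w. w \<notin> K \<Longrightarrow> f w = 0"
  shows "integrable lborel f"
proof -
  have "integrable lborel (\<lambda>x. indicator K x *\<^sub>R f x)"
    using assms by (intro borel_integrable_compact) (auto intro: continuous_on_subset)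
  moreover have "(\<lambda>x. indicator K x *\<^sub>R f x) = f"
    using assms(3) by (auto simp: fun_eq_iff indicator_def)
  ultimately show ?thesis by simp
qed

lemma GDERIV_line:
  fixes f :: "complex \<Rightarrow> real"
  assumes "GDERIV f (w + t *\<^sub>R e) :> D"
  shows "((\<lambda>t. f (w + t *\<^sub>R e)) has_real_derivative e \<bullet> D) (at t within S)"
proof -
  have "((\<lambda>t. w + t *\<^sub>R e) has_derivative (\<lambda>s. s *\<^sub>R e)) (at t within S)"
    by (auto intro!: derivative_eq_intros)
  moreover have "(f has_derivative (\<lambda>h. h \<bullet> D)) (at (w + t *\<^sub>R e))"
    using assms by (simp add: gderiv_def)
  ultimately have "((\<lambda>t. f (w + t *\<^sub>R e)) has_derivative (\<lambda>s. (s *\<^sub>R e) \<bullet> D)) (at t within S)"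
    by (rule has_derivative_compose)
  then show ?thesis
    by (rule has_derivative_imp_has_field_derivative) (simp add: mult.commute)
qed

text \<open>The divergence theorem for compact support, from translation invariance alone: the
  integral of f(w + e) - f(w) vanishes, and it is the integral over t in [0, 1] of the integrals of
  e . D(w + t e), each of which equals the integral of e . D.\<close>

lemma integral_directional_derivative_zero:
  fixes f :: "complex \<Rightarrow> real"
  assumes D: "\<And>w. GDERIV f w :> D w" and cont: "continuous_on UNIV D"
    and K: "compact K" "\<And>w. w \<notin> K \<Longrightarrow> f w = 0"
  shows "integrable lborel (\<lambda>w. e \<bullet> D w)" "(\<integral>w. e \<bullet> D w \<partial>lborel) = 0"
proof -
  have D0: "D w = 0" if "w \<notin> K" for w
    using GDERIV_unique[OF D GDERIV_transform_zero[OF compact_imp_closed[OF K(1)] K(2) that]] .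
  have cf: "continuous_on UNIV f"
    using D unfolding gderiv_def by (meson continuous_at_imp_continuous_on has_derivative_continuous)
  have ie: "integrable lborel (\<lambda>w. e \<bullet> D w)"
    using D0 by (intro integrable_of_compact_support[OF _ K(1)] continuous_intros cont) auto
  then show "integrable lborel (\<lambda>w. e \<bullet> D w)" .
  have if': "integrable lborel f"
    using K cf by (intro integrable_of_compact_support) auto
  have trans: "(\<integral>w. g (w + c) \<partial>lborel) = (\<integral>w. g w \<partial>lborel)" "integrable lborel (\<lambda>w. g (w + c))"
    if "integrable lborel g" for g :: "complex \<Rightarrow> real" and c
  proof -
    have [measurable]: "g \<in> borel_measurable borel" using that by auto
    have L: "lborel = distr lborel borel ((+) c)" by (rule lborel_distr_plus[symmetric])
    show "(\<integral>w. g (w + c) \<partial>lborel) = (\<integral>w. g w \<partial>lborel)"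
      by (subst (2) L, subst integral_distr) (auto simp: add.commute)
    show "integrable lborel (\<lambda>w. g (w + c))"
      using that by (subst (asm) L, subst (asm) integrable_distr_eq) (auto simp: add.commute)
  qed
  define G where "G = (\<lambda>(t::real, w::complex). indicator {0..1} t *\<^sub>R (e \<bullet> D (w + t *\<^sub>R e)))"
  \<comment> \<open>The pairs (t, w) with t in [0, 1] and w + t e in \<open>K\<close>. This sheared
    copy is compact, which makes the joint integrand integrable for Fubini.\<close>
  define K' where "K' = (\<lambda>(t, w). (t, w - t *\<^sub>R e)) ` ({0..1} \<times> K)"
  have K': "compact K'"
    unfolding K'_def case_prod_unfold
    by (intro compact_continuous_image continuous_intros compact_Times K(1)) auto
  have "integrable lborel (\<lambda>p. indicator K' p *\<^sub>R (e \<bullet> D (snd p + fst p *\<^sub>R e)))"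
    by (intro borel_integrable_compact K' continuous_intros continuous_on_compose2[OF cont]) auto
  also have "(\<lambda>p. indicator K' p *\<^sub>R (e \<bullet> D (snd p + fst p *\<^sub>R e))) = G"
  proof
    fix p :: "real \<times> complex"
    obtain t w where p: "p = (t, w)" by force
    show "indicator K' p *\<^sub>R (e \<bullet> D (snd p + fst p *\<^sub>R e)) = G p"
    proof (cases "w + t *\<^sub>R e \<in> K")
      case True
      have "(t, w) \<in> K' \<longleftrightarrow> t \<in> {0..1}"
      proof
        assume "t \<in> {0..1}"
        then have "(\<lambda>(t, w). (t, w - t *\<^sub>R e)) (t, w + t *\<^sub>R e) \<in> K'"
          unfolding K'_def using True by (intro imageI) auto
        then show "(t, w) \<in> K'" by simp
      qed (auto simp: K'_def)
      then show ?thesis by (simp add: G_def p indicator_def)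
    next
      case False
      then show ?thesis using D0[OF False] by (simp add: G_def p)
    qed
  qed
  finally have iG: "integrable (lborel \<Otimes>\<^sub>M lborel) G" by (simp add: lborel_prod)
  have "(\<integral>w. e \<bullet> D w \<partial>lborel) = (\<integral>t. indicator {0..1::real} t *\<^sub>R (\<integral>w. e \<bullet> D w \<partial>lborel) \<partial>lborel)"
    by simp
  also have "\<dots> = (\<integral>t. (\<integral>w. G (t, w) \<partial>lborel) \<partial>lborel)"
    using trans(1)[OF ie] by (simp add: G_def)
  also have "\<dots> = (\<integral>w. (\<integral>t. G (t, w) \<partial>lborel) \<partial>lborel)"
    using lborel_pair.Fubini_integral[of "\<lambda>t w. G (t, w)"] iG by simp
  also have "\<dots> = (\<integral>w. f (w + e) - f w \<partial>lborel)"
  proof (rule Bochner_Integration.integral_cong[OF refl])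
    fix w
    have "(\<integral>t. indicator {0..1} t *\<^sub>R (e \<bullet> D (w + t *\<^sub>R e)) \<partial>lborel) = f (w + 1 *\<^sub>R e) - f (w + 0 *\<^sub>R e)"
      by (rule integral_FTC_Icc) (auto intro!: GDERIV_line D continuous_intros continuous_on_compose2[OF cont]
          simp flip: has_real_derivative_iff_has_vector_derivative)
    then show "(\<integral>t. G (t, w) \<partial>lborel) = f (w + e) - f w" by (simp add: G_def)
  qed
  also have "\<dots> = 0"
    using trans[OF if', of e] if' by simp
  finally show "(\<integral>w. e \<bullet> D w \<partial>lborel) = 0" .
qed

section \<open>Pointwise bound by the potential of the gradient\<close>

lemma emeasure_annulus: "emeasure lborel {w::complex. 1 \<le> cmod w \<and> cmod w \<le> 2} = ennreal (3 * pi)"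
proof -
  have "{w::complex. 1 \<le> cmod w \<and> cmod w \<le> 2} = cball 0 2 - ball 0 1" by auto
  also have "emeasure lborel \<dots> = emeasure lborel (cball (0::complex) 2) - emeasure lborel (ball (0::complex) 1)"
    by (rule emeasure_Diff) (auto simp: emeasure_lborel_ball_complex)
  also have "\<dots> = ennreal (3 * pi)"
    by (simp add: emeasure_lborel_ball_complex ennreal_minus)
  finally show ?thesis .
qed

text \<open>The fundamental theorem of calculus along the rays \<open>z + t w\<close>, averaged over \<open>1 \<le> |w| \<le> 2\<close>,
  yields the sharp constant without polar coordinates.\<close>

lemma norm_le_gradient_potential:
  fixes g :: "complex \<Rightarrow> real"
  assumes D: "\<And>w. GDERIV g w :> D w" and cont: "continuous_on UNIV D"
    and R: "0 \<le> R" "\<And>w. w \<notin> cball z R \<Longrightarrow> g w = 0"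
  shows "ennreal \<bar>g z\<bar> \<le> (\<integral>\<^sup>+w. ennreal (cmod (D w) / (2 * pi * cmod (z - w))) \<partial>lborel)"
proof -
  define A where "A = {w::complex. 1 \<le> cmod w \<and> cmod w \<le> 2}"
  have [measurable]: "A \<in> sets borel" unfolding A_def by measurable
  have [measurable]: "D \<in> borel_measurable borel"
    using cont by (rule borel_measurable_continuous_onI)
  have ray: "ennreal \<bar>g z\<bar> \<le> (\<integral>\<^sup>+t. ennreal (cmod w * cmod (D (z + t *\<^sub>R w))) * indicator {0<..} t \<partial>lborel)"
    if w: "w \<in> A" for w
  proof -
    \<comment> \<open>Since |w| >= 1, the ray has left the support by time R + 1, uniformly in
      w.\<close>
    have "g (z + (R + 1) *\<^sub>R w) = 0"
    proof (rule R(2))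
      have "R + 1 \<le> (R + 1) * cmod w" using w R mult_left_mono[of 1 "cmod w" "R + 1"] by (simp add: A_def)
      moreover have "dist z (z + (R + 1) *\<^sub>R w) = (R + 1) * cmod w" using R by (simp add: dist_norm)
      ultimately have "R < dist z (z + (R + 1) *\<^sub>R w)" by linarith
      then show "z + (R + 1) *\<^sub>R w \<notin> cball z R" by simp
    qed
    moreover have "(\<integral>t. indicator {0..R+1} t *\<^sub>R (w \<bullet> D (z + t *\<^sub>R w)) \<partial>lborel) = g (z + (R + 1) *\<^sub>R w) - g (z + 0 *\<^sub>R w)"
      using R by (intro integral_FTC_Icc) (auto intro!: GDERIV_line D continuous_intros continuous_on_compose2[OF cont]
          simp flip: has_real_derivative_iff_has_vector_derivative)
    ultimately have "\<bar>g z\<bar> = norm (\<integral>t. indicator {0..R+1} t *\<^sub>R (w \<bullet> D (z + t *\<^sub>R w)) \<partial>lborel)"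
      by simp
    then have "ennreal \<bar>g z\<bar> \<le> (\<integral>\<^sup>+t. norm (indicator {0..R+1} t *\<^sub>R (w \<bullet> D (z + t *\<^sub>R w))) \<partial>lborel)"
      by (simp only: integral_norm_bound_ennreal
          [OF borel_integrable_compact[OF compact_Icc continuous_on_inner[OF continuous_on_const continuous_on_compose2[OF cont]]]]
          continuous_intros subset_UNIV)
    also have "\<dots> \<le> (\<integral>\<^sup>+t. ennreal (cmod w * cmod (D (z + t *\<^sub>R w))) * indicator {0..} t \<partial>lborel)"
      by (intro nn_integral_mono) (auto split: split_indicator intro!: ennreal_leI Cauchy_Schwarz_ineq2)
    also have "\<dots> = (\<integral>\<^sup>+t. ennreal (cmod w * cmod (D (z + t *\<^sub>R w))) * indicator {0<..} t \<partial>lborel)"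
      using AE_lborel_singleton[of "0::real"]
      by (intro nn_integral_cong_AE) (auto split: split_indicator elim!: eventually_mono)
    finally show ?thesis .
  qed
  have "ennreal (3 * pi) * ennreal \<bar>g z\<bar> = (\<integral>\<^sup>+w. ennreal \<bar>g z\<bar> * indicator A w \<partial>lborel)"
    using emeasure_annulus by (simp add: nn_integral_cmult_indicator A_def mult.commute)
  also have "\<dots> \<le> (\<integral>\<^sup>+w. (\<integral>\<^sup>+t. ennreal (cmod w * cmod (D (z + t *\<^sub>R w))) * indicator {0<..} t * indicator A w \<partial>lborel) \<partial>lborel)"
    using ray by (intro nn_integral_mono) (auto split: split_indicator)
  also have "\<dots> = (\<integral>\<^sup>+t. (\<integral>\<^sup>+w. ennreal (cmod w * cmod (D (z + t *\<^sub>R w))) * indicator {0<..} t * indicator A w \<partial>lborel) \<partial>lborel)"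
    by (rule lborel_pair.Fubini'[symmetric]) measurable
  \<comment> \<open>Substitution of w for z + t w: the Jacobian gives t^-2 and the length of the
    direction another t^-1, while the annulus becomes t <= |w - z| <= 2 t.\<close>
  also have "\<dots> = (\<integral>\<^sup>+t. (\<integral>\<^sup>+w. ennreal (cmod (w - z) * cmod (D w) / t ^ 3) *
       (if 0 < t \<and> t \<le> cmod (w - z) \<and> cmod (w - z) \<le> 2 * t then 1 else 0) \<partial>lborel) \<partial>lborel)"
  proof (rule nn_integral_cong)
    fix t :: real
    show "(\<integral>\<^sup>+w. ennreal (cmod w * cmod (D (z + t *\<^sub>R w))) * indicator {0<..} t * indicator A w \<partial>lborel)
      = (\<integral>\<^sup>+w. ennreal (cmod (w - z) * cmod (D w) / t ^ 3) *
       (if 0 < t \<and> t \<le> cmod (w - z) \<and> cmod (w - z) \<le> 2 * t then 1 else 0) \<partial>lborel)"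
    proof (cases "0 < t")
      case True
      have "(\<integral>\<^sup>+w. ennreal (cmod (w - z) * cmod (D w) / t ^ 3) *
          (if 0 < t \<and> t \<le> cmod (w - z) \<and> cmod (w - z) \<le> 2 * t then 1 else 0) \<partial>lborel)
        = ennreal (t\<^sup>2) * (\<integral>\<^sup>+w. ennreal (cmod (z + t *\<^sub>R w - z) * cmod (D (z + t *\<^sub>R w)) / t ^ 3) *
          (if 0 < t \<and> t \<le> cmod (z + t *\<^sub>R w - z) \<and> cmod (z + t *\<^sub>R w - z) \<le> 2 * t then 1 else 0) \<partial>lborel)"
        using True by (intro nn_integral_lborel_affine) auto
      also have "\<dots> = (\<integral>\<^sup>+w. ennreal (t\<^sup>2) * (ennreal (cmod (z + t *\<^sub>R w - z) * cmod (D (z + t *\<^sub>R w)) / t ^ 3) *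
          (if 0 < t \<and> t \<le> cmod (z + t *\<^sub>R w - z) \<and> cmod (z + t *\<^sub>R w - z) \<le> 2 * t then 1 else 0)) \<partial>lborel)"
        by (rule nn_integral_cmult[symmetric]) measurable
      also have "\<dots> = (\<integral>\<^sup>+w. ennreal (cmod w * cmod (D (z + t *\<^sub>R w))) * indicator {0<..} t * indicator A w \<partial>lborel)"
        using True by (intro nn_integral_cong)
          (auto simp: A_def ennreal_mult'[symmetric] power2_eq_square power3_eq_cube split: split_indicator)
      finally show ?thesis by simp
    qed simp
  qed
  also have "\<dots> = (\<integral>\<^sup>+w. (\<integral>\<^sup>+t. ennreal (cmod (w - z) * cmod (D w) / t ^ 3) *
       (if 0 < t \<and> t \<le> cmod (w - z) \<and> cmod (w - z) \<le> 2 * t then 1 else 0) \<partial>lborel) \<partial>lborel)"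
    by (rule lborel_pair.Fubini') measurable
  also have "\<dots> \<le> (\<integral>\<^sup>+w. ennreal (3 * pi) * ennreal (cmod (D w) / (2 * pi * cmod (z - w))) \<partial>lborel)"
  proof (rule nn_integral_mono)
    fix w :: complex
    define \<rho> where "\<rho> = cmod (w - z)"
    show "(\<integral>\<^sup>+t. ennreal (cmod (w - z) * cmod (D w) / t ^ 3) *
       (if 0 < t \<and> t \<le> cmod (w - z) \<and> cmod (w - z) \<le> 2 * t then 1 else 0) \<partial>lborel)
       \<le> ennreal (3 * pi) * ennreal (cmod (D w) / (2 * pi * cmod (z - w)))"
    proof (cases "\<rho> = 0")
      case False
      then have \<rho>: "0 < \<rho>" by (simp add: \<rho>_def)
      have "(\<integral>\<^sup>+t. ennreal (\<rho> * cmod (D w) / t ^ 3) * (if 0 < t \<and> t \<le> \<rho> \<and> \<rho> \<le> 2 * t then 1 else 0) \<partial>lborel)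
        = (\<integral>\<^sup>+t. ennreal (\<rho> * cmod (D w) / t ^ 3) * indicator {\<rho>/2..\<rho>} t \<partial>lborel)"
        using \<rho> by (intro nn_integral_cong) (auto split: split_indicator)
      \<comment> \<open>The integral of rho / t^3 over [rho / 2, rho] is 3 / (2 rho), that is 3 pi
        times 1 / (2 pi rho); the area 3 pi of the annulus cancels exactly.\<close>
      also have "\<dots> = ennreal ((- (\<rho> * cmod (D w)) / (2 * \<rho>\<^sup>2)) - (- (\<rho> * cmod (D w)) / (2 * (\<rho> / 2)\<^sup>2)))"
        using \<rho> by (intro nn_integral_FTC_Icc)
         (auto intro!: derivative_eq_intros simp: power2_eq_square power3_eq_cube simp flip: has_real_derivative_iff_has_vector_derivative)
      also have "\<dots> = ennreal (3 * pi) * ennreal (cmod (D w) / (2 * pi * \<rho>))"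
        using \<rho> by (subst ennreal_mult[symmetric]) (auto simp: power2_eq_square field_simps)
      finally show ?thesis by (simp add: \<rho>_def norm_minus_commute)
    qed (auto simp: \<rho>_def)
  qed
  also have "\<dots> = ennreal (3 * pi) * (\<integral>\<^sup>+w. ennreal (cmod (D w) / (2 * pi * cmod (z - w))) \<partial>lborel)"
    by (rule nn_integral_cmult) measurable
  finally show ?thesis
    by (subst (asm) ennreal_mult_le_mult_iff) auto
qed

subsection \<open>A family of Hardy identities\<close>

text \<open>This is |1 - cnj a w|^2, see \<open>hardy_N_eq\<close>; the form in inner products suits
  the rules for gradients.\<close>

definition hardy_N :: "complex \<Rightarrow> complex \<Rightarrow> real" where
  "hardy_N a w = 1 - 2 * (a \<bullet> w) + (a \<bullet> a) * (w \<bullet> w)"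

definition hardy_S :: "complex \<Rightarrow> real" where
  "hardy_S w = 1 - w \<bullet> w"

definition hardy_P :: "complex \<Rightarrow> complex \<Rightarrow> complex" where
  "hardy_P a w = inverse (hardy_N a w) *\<^sub>R (a - (a \<bullet> a) *\<^sub>R w) - inverse (hardy_S w) *\<^sub>R w"

definition hardy_V :: "complex \<Rightarrow> complex \<Rightarrow> real" where
  "hardy_V a w = (1 - a \<bullet> a) / (hardy_N a w * hardy_S w)"

lemma hardy_N_eq: "hardy_N a w = (cmod (1 - cnj a * w))\<^sup>2"
  unfolding cmod_power2 hardy_N_def inner_complex_def
  by (simp add: power2_eq_square algebra_simps)

lemma hardy_S_eq: "hardy_S w = 1 - (cmod w)\<^sup>2"
  by (simp add: hardy_S_def dot_square_norm)

lemma hardy_S_pos: "cmod w < 1 \<Longrightarrow> 0 < hardy_S w"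
  by (simp add: hardy_S_eq abs_square_less_1)

lemma hardy_N_pos:
  assumes "cmod a < 1" "cmod w < 1"
  shows "0 < hardy_N a w"
proof -
  have "cmod (cnj a * w) < 1"
    using mult_strict_mono'[of "cmod a" 1 "cmod w" 1] assms by (simp add: norm_mult)
  then have "1 - cnj a * w \<noteq> 0" by auto
  then show ?thesis by (simp add: hardy_N_eq)
qed

lemma GDERIV_hardy_S: "GDERIV hardy_S w :> - 2 *\<^sub>R w"
  unfolding gderiv_def hardy_S_def
  by (auto intro!: derivative_eq_intros simp: inner_commute fun_eq_iff)

lemma GDERIV_hardy_N: "GDERIV (hardy_N a) w :> 2 *\<^sub>R ((a \<bullet> a) *\<^sub>R w - a)"
  unfolding gderiv_def hardy_N_def
  by (auto intro!: derivative_eq_intros simp: inner_commute fun_eq_iff inner_diff_right algebra_simps)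

lemma continuous_on_hardy [continuous_intros]:
  "continuous_on A hardy_S" "continuous_on A (hardy_N a)"
  unfolding hardy_S_def hardy_N_def by (intro continuous_intros)+

text \<open>The gradient of the component of \<open>hardy_P a\<close> along \<open>e\<close>.
  Pairing it with \<open>e\<close> and summing over \<open>e = 1\<close> and \<open>e = \<i>\<close>
  gives the divergence of \<open>hardy_P a\<close>, that is the Laplacian of ln phi.\<close>

definition hardy_DP :: "complex \<Rightarrow> complex \<Rightarrow> complex \<Rightarrow> complex" where
  "hardy_DP a e w = (- (a \<bullet> a) * inverse (hardy_N a w)) *\<^sub>R e
     + (e \<bullet> (a - (a \<bullet> a) *\<^sub>R w) * (inverse (hardy_N a w))\<^sup>2 * 2) *\<^sub>R (a - (a \<bullet> a) *\<^sub>R w)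
     - inverse (hardy_S w) *\<^sub>R e - ((e \<bullet> w) * (inverse (hardy_S w))\<^sup>2 * 2) *\<^sub>R w"

lemma GDERIV_hardy_P:
  assumes "cmod a < 1" "cmod w < 1"
  shows "GDERIV (\<lambda>w. e \<bullet> hardy_P a w) w :> hardy_DP a e w"
proof -
  have N: "hardy_N a w \<noteq> 0" and S: "hardy_S w \<noteq> 0"
    using hardy_N_pos[OF assms] hardy_S_pos[OF assms(2)] by auto
  have lin: "GDERIV (\<lambda>w. e \<bullet> w) w :> e" "GDERIV (\<lambda>w. e \<bullet> (a - (a \<bullet> a) *\<^sub>R w)) w :> - (a \<bullet> a) *\<^sub>R e"
    unfolding gderiv_def
    by (auto intro!: derivative_eq_intros simp: inner_commute fun_eq_iff algebra_simps)
  have eq: "(\<lambda>w. e \<bullet> hardy_P a w)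
      = (\<lambda>w. inverse (hardy_N a w) * (e \<bullet> (a - (a \<bullet> a) *\<^sub>R w)) - inverse (hardy_S w) * (e \<bullet> w))"
    by (simp add: hardy_P_def fun_eq_iff inner_diff_right)
  show ?thesis
    unfolding eq
    by (rule GDERIV_subst[OF GDERIV_diff[OF
        GDERIV_mult[OF GDERIV_inverse[OF GDERIV_hardy_N N] lin(2)]
        GDERIV_mult[OF GDERIV_inverse[OF GDERIV_hardy_S S] lin(1)]]])
      (simp add: hardy_DP_def scaleR_diff_right algebra_simps)
qed

lemma inner_one_ii: "(1 \<bullet> v)\<^sup>2 + (\<i> \<bullet> v)\<^sup>2 = v \<bullet> v" "(1 \<bullet> v) * (1 \<bullet> v') + (\<i> \<bullet> v) * (\<i> \<bullet> v') = v \<bullet> v'"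
  by (auto simp: inner_complex_def power2_eq_square)

text \<open>\<open>hardy_P a\<close> is \<open>\<nabla>\<phi>/\<phi>\<close> for \<open>\<phi> = sqrt (hardy_S / hardy_N a)\<close>, so this identity says
  \<open>-\<Delta>\<phi>/\<phi> = 1/(1 - |w|\<^sup>2)\<^sup>2 + hardy_V a\<close>: \<open>\<phi>\<close> is \<open>sqrt (1 - |w|\<^sup>2)\<close> recentred at \<open>a\<close> by a Moebius map.\<close>

lemma hardy_riccati:
  assumes "cmod a < 1" "cmod w < 1"
  shows "1 \<bullet> hardy_DP a 1 w + \<i> \<bullet> hardy_DP a \<i> w + hardy_P a w \<bullet> hardy_P a w + hardy_V a w
    = - 1 / (hardy_S w)\<^sup>2"
proof -
  define q A R N S where defs: "q = a \<bullet> a" "A = a \<bullet> w" "R = w \<bullet> w" "N = hardy_N a w" "S = hardy_S w"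
  define b where "b = a - q *\<^sub>R w"
  have N: "N \<noteq> 0" "N = 1 - 2 * A + q * R" and S: "S \<noteq> 0" "S = 1 - R"
    using hardy_N_pos[OF assms] hardy_S_pos[OF assms(2)] by (auto simp: defs hardy_N_def hardy_S_def)
  \<comment> \<open>This identity makes the \<open>N\<close> terms of the divergence cancel: ln N =
    2 ln |1 - cnj a w| is harmonic.\<close>
  have bb: "b \<bullet> b = q * N"
    unfolding N(2) b_def by (simp add: inner_diff_left inner_diff_right defs(1-3) inner_commute[of w a] algebra_simps)
  have bw: "b \<bullet> w = A - q * R"
    by (simp add: b_def inner_diff_left defs(1-3))
  have "e \<bullet> hardy_DP a e w = - q / N + 2 * (e \<bullet> b)\<^sup>2 / N\<^sup>2 - 1 / S - 2 * (e \<bullet> w)\<^sup>2 / S\<^sup>2"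
    if "e \<bullet> e = 1" for e
  proof -
    have "hardy_DP a e w = (- q * inverse N) *\<^sub>R e + ((e \<bullet> b) * (inverse N)\<^sup>2 * 2) *\<^sub>R b
        - inverse S *\<^sub>R e - ((e \<bullet> w) * (inverse S)\<^sup>2 * 2) *\<^sub>R w"
      by (simp only: hardy_DP_def defs b_def)
    then show ?thesis
      by (simp only: inner_add_right inner_diff_right inner_scaleR_right that)
        (simp add: divide_inverse power2_eq_square mult_ac)
  qed
  from this[of 1] this[of \<i>]
  have "1 \<bullet> hardy_DP a 1 w + \<i> \<bullet> hardy_DP a \<i> w
      = - 2 * q / N + 2 * ((1 \<bullet> b)\<^sup>2 + (\<i> \<bullet> b)\<^sup>2) / N\<^sup>2 - 2 / S - 2 * ((1 \<bullet> w)\<^sup>2 + (\<i> \<bullet> w)\<^sup>2) / S\<^sup>2"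
    by (simp add: inner_complex_def add_divide_distrib distrib_left)
  also have "\<dots> = - 2 * q / N + 2 * (q * N) / N\<^sup>2 - 2 / S - 2 * R / S\<^sup>2"
    by (simp only: inner_one_ii bb, simp add: defs(3))
  also have "\<dots> = - 2 / S - 2 * R / S\<^sup>2"
    using N(1) by (simp add: power2_eq_square)
  finally have 1: "1 \<bullet> hardy_DP a 1 w + \<i> \<bullet> hardy_DP a \<i> w = - 2 / S - 2 * R / S\<^sup>2" .
  have "hardy_P a w \<bullet> hardy_P a w = (b \<bullet> b) / N\<^sup>2 - 2 * (b \<bullet> w) / (N * S) + R / S\<^sup>2"
  proof -
    have "hardy_P a w = inverse N *\<^sub>R b - inverse S *\<^sub>R w"
      by (simp only: hardy_P_def defs b_def)
    then show ?thesis
      by (simp only: inner_diff_left inner_diff_right inner_scaleR_left inner_scaleR_right inner_commute[of w b] defs(3)[symmetric])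
        (simp add: divide_inverse power2_eq_square algebra_simps)
  qed
  also have "\<dots> = q / N - 2 * (A - q * R) / (N * S) + R / S\<^sup>2"
    unfolding bb bw using N(1) by (simp add: power2_eq_square)
  finally have 2: "hardy_P a w \<bullet> hardy_P a w = q / N - 2 * (A - q * R) / (N * S) + R / S\<^sup>2" .
  \<comment> \<open>The origin of \<open>hardy_V\<close>: its numerator 1 - q completes the
    numerator to \<open>N\<close>, so that all dependence on \<open>a\<close> collapses to 1 /
    S.\<close>
  have "q / N - 2 * (A - q * R) / (N * S) + (1 - q) / (N * S) = (q * S - 2 * (A - q * R) + (1 - q)) / (N * S)"
    using N(1) S(1) by (simp add: add_divide_distrib diff_divide_distrib)
  also have "q * S - 2 * (A - q * R) + (1 - q) = N"
    unfolding N(2) S(2) by (simp add: algebra_simps)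
  also have "N / (N * S) = 1 / S" using N(1) by simp
  finally have 3: "q / N - 2 * (A - q * R) / (N * S) + (1 - q) / (N * S) = 1 / S" .
  have "- 2 / S - 2 * R / S\<^sup>2 + R / S\<^sup>2 + 1 / S = - (S + R) / S\<^sup>2"
    using S(1) by (simp add: field_simps power2_eq_square)
  also have "S + R = 1" using S(2) by simp
  finally show ?thesis
    using 3 unfolding 1 2 hardy_V_def defs(1,4,5)[symmetric] by simp
qed

section \<open>Ground state form of the Hardy functional\<close>

lemma C0_inf_discE:
  assumes "C0_inf_disc u"
  obtains K where "compact K" "K \<subseteq> ball 0 1" "\<And>w. w \<notin> K \<Longrightarrow> u w = 0" "\<And>w. w \<notin> K \<Longrightarrow> grad u w = 0"
    "\<And>w. GDERIV u w :> grad u w" "continuous_on UNIV (grad u)" "continuous_on UNIV u"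
proof -
  have sm: "iter_pd vs u differentiable (at x)" for vs x
    using assms by (auto simp: C0_inf_disc_def smooth_fun_def)
  have G: "GDERIV u w :> grad u w" for w
    using sm[of "[]" w] by (intro GDERIV_grad) simp
  let ?K = "closure {z. u z \<noteq> 0}"
  have u0: "u w = 0" if "w \<notin> ?K" for w
    using that closure_subset[of "{z. u z \<noteq> 0}"] by auto
  have g0: "grad u w = 0" if "w \<notin> ?K" for w
    using GDERIV_unique[OF G GDERIV_transform_zero[OF closed_closure u0 that]] .
  have cont: "continuous_on UNIV (iter_pd vs u)" for vs
    using sm by (intro continuous_at_imp_continuous_on ballI differentiable_imp_continuous_within)
  have "continuous_on UNIV (\<lambda>x. frechet_derivative u (at x) v)" for v
    using cont[of "[v]"] by simp
  then have cgr: "continuous_on UNIV (grad u)"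
    unfolding grad_def[abs_def] Complex_eq by (intro continuous_intros)
  have cu: "continuous_on UNIV u"
    using cont[of "[]"] by simp
  have "compact ?K" "?K \<subseteq> ball 0 1"
    using assms by (auto simp: C0_inf_disc_def)
  from that[OF this u0 g0 G cgr cu] show ?thesis .
qed

definition hardy_density :: "complex \<Rightarrow> (complex \<Rightarrow> real) \<Rightarrow> complex \<Rightarrow> real" where
  "hardy_density a u w = (cmod (grad u w - u w *\<^sub>R hardy_P a w))\<^sup>2 + (u w)\<^sup>2 * hardy_V a w"

lemma hardy_V_nonneg:
  assumes "cmod a < 1" "cmod w < 1"
  shows "0 \<le> hardy_V a w"
  using hardy_N_pos[OF assms] hardy_S_pos[OF assms(2)] hardy_S_pos[OF assms(1)]
  by (simp add: hardy_V_def hardy_S_def)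

lemma hardy_density_nonneg:
  assumes "cmod a < 1" "cmod w < 1"
  shows "0 \<le> hardy_density a u w"
  using hardy_V_nonneg[OF assms] by (simp add: hardy_density_def)

text \<open>With P for \<open>hardy_P a\<close>, expanding the square gives |grad u|^2 - 2 u P .
  grad u + u^2 |P|^2. The cross term is - div (u^2 P) + u^2 div P, the divergence integrates to 0,
  and \<open>hardy_riccati\<close> turns u^2 (div P + |P|^2 + V) into - u^2 / (1 - |w|^2)^2.\<close>

lemma hardy_identity:
  assumes u: "C0_inf_disc u" and a: "cmod a < 1"
  shows "(\<integral>\<^sup>+w. ennreal (hardy_density a u w) * indicator (ball 0 1) w \<partial>lborel) = ennreal (H_norm u)"
    and "0 \<le> H_norm u"
proof -
  obtain K where K: "compact K" "K \<subseteq> ball 0 1"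
    and u0: "\<And>w. w \<notin> K \<Longrightarrow> u w = 0" and g0: "\<And>w. w \<notin> K \<Longrightarrow> grad u w = 0"
    and G: "\<And>w. GDERIV u w :> grad u w" and cG: "continuous_on UNIV (grad u)" and cu: "continuous_on UNIV u"
    by (rule C0_inf_discE[OF u]) blast
  have K1: "cmod w < 1" if "w \<in> K" for w using K that by auto
  note cont_sub = continuous_on_subset[OF cG subset_UNIV] continuous_on_subset[OF cu subset_UNIV]
  have Sne: "hardy_S w \<noteq> 0" if "w \<in> ball 0 1" for w
    using hardy_S_pos[of w] that by simp
  have Nne: "hardy_N a w \<noteq> 0" if "w \<in> ball 0 1" for w
    using hardy_N_pos[OF a, of w] that by simp
  \<comment> \<open>The components of the field u^2 P for the directions 1 and \<open>\<i>\<close>;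
    \<open>e \<bullet> DX e w\<close> are the two terms of its divergence.\<close>
  define X where "X e w = (u w)\<^sup>2 * (e \<bullet> hardy_P a w)" for e w
  define DX where "DX e w = (u w)\<^sup>2 *\<^sub>R hardy_DP a e w + (e \<bullet> hardy_P a w) *\<^sub>R ((2 * u w) *\<^sub>R grad u w)" for e w
  have DX: "GDERIV (X e) w :> DX e w" for e w
  proof (cases "w \<in> K")
    case True
    have "((\<lambda>x::real. x\<^sup>2) has_real_derivative 2 * x) (at x)" for x
      by (auto intro!: derivative_eq_intros)
    from GDERIV_mult[OF GDERIV_DERIV_compose[OF G[of w] this] GDERIV_hardy_P[OF a K1[OF True], of e]]
    show ?thesis by (simp add: X_def[abs_def] DX_def)
  next
    case False
    then have "DX e w = 0" by (simp add: DX_def u0)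
    moreover have "GDERIV (X e) w :> 0"
      using False u0 by (intro GDERIV_transform_zero[OF compact_imp_closed[OF K(1)]]) (auto simp: X_def)
    ultimately show ?thesis by simp
  qed
  have cP: "continuous_on (ball 0 1) (hardy_P a)" "continuous_on (ball 0 1) (hardy_DP a e)" for e
  proof -
    have "continuous_on (ball 0 1) (\<lambda>w. inverse (hardy_N a w))" "continuous_on (ball 0 1) (\<lambda>w. inverse (hardy_S w))"
      by (intro continuous_intros ballI Nne Sne; assumption)+
    note cont = continuous_on_diff continuous_on_add continuous_on_scaleR continuous_on_mult continuous_on_power
      continuous_on_inner continuous_on_const continuous_on_id this
    show "continuous_on (ball 0 1) (hardy_P a)" "continuous_on (ball 0 1) (hardy_DP a e)"
      unfolding hardy_P_def[abs_def] hardy_DP_def[abs_def] by (intro cont)+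
  qed
  have cDX: "continuous_on UNIV (DX e)" for e
  proof (rule continuous_on_UNIV_of_closed_support[OF open_ball compact_imp_closed[OF K(1)] K(2)])
    show "continuous_on (ball 0 1) (DX e)"
      unfolding DX_def[abs_def] by (intro continuous_intros cP cont_sub)
  qed (simp add: DX_def u0)
  have div: "integrable lborel (\<lambda>w. e \<bullet> DX e w)" "(\<integral>w. e \<bullet> DX e w \<partial>lborel) = 0" for e
    by (rule integral_directional_derivative_zero[OF DX cDX K(1)], simp add: X_def u0)+
  have igr: "integrable lborel (\<lambda>w. (cmod (grad u w))\<^sup>2)"
    using g0 by (intro integrable_of_compact_support[OF _ K(1)] continuous_intros cG) auto
  have iS: "integrable lborel (\<lambda>w. (u w)\<^sup>2 / (hardy_S w)\<^sup>2)"
  proof (rule integrable_of_compact_support[OF continuous_on_UNIV_of_closed_support[OF open_ball compact_imp_closed[OF K(1)] K(2)] K(1)])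
    show "continuous_on (ball 0 1) (\<lambda>w. (u w)\<^sup>2 / (hardy_S w)\<^sup>2)"
      using Sne by (intro continuous_intros cont_sub) force
  qed (simp_all add: u0)
  have dens: "hardy_density a u w = (cmod (grad u w))\<^sup>2 - (u w)\<^sup>2 / (hardy_S w)\<^sup>2 - (1 \<bullet> DX 1 w + \<i> \<bullet> DX \<i> w)" for w
  proof (cases "w \<in> K")
    case True
    have ric: "1 \<bullet> hardy_DP a 1 w + \<i> \<bullet> hardy_DP a \<i> w = - 1 / (hardy_S w)\<^sup>2 - hardy_P a w \<bullet> hardy_P a w - hardy_V a w"
      using hardy_riccati[OF a K1[OF True]] by simp
    have "1 \<bullet> DX 1 w + \<i> \<bullet> DX \<i> w = (u w)\<^sup>2 * (1 \<bullet> hardy_DP a 1 w + \<i> \<bullet> hardy_DP a \<i> w)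
       + 2 * u w * ((1 \<bullet> hardy_P a w) * (1 \<bullet> grad u w) + (\<i> \<bullet> hardy_P a w) * (\<i> \<bullet> grad u w))"
      by (simp add: DX_def inner_add_right distrib_left mult_ac)
    also have "\<dots> = (u w)\<^sup>2 * (- 1 / (hardy_S w)\<^sup>2 - hardy_P a w \<bullet> hardy_P a w - hardy_V a w)
       + 2 * u w * (hardy_P a w \<bullet> grad u w)"
      by (simp only: ric inner_one_ii)
    finally have DX_eq: "1 \<bullet> DX 1 w + \<i> \<bullet> DX \<i> w = (u w)\<^sup>2 * (- 1 / (hardy_S w)\<^sup>2 - hardy_P a w \<bullet> hardy_P a w - hardy_V a w)
       + 2 * u w * (hardy_P a w \<bullet> grad u w)" .
    have sq: "(cmod (grad u w - u w *\<^sub>R hardy_P a w))\<^sup>2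
      = (cmod (grad u w))\<^sup>2 - 2 * u w * (hardy_P a w \<bullet> grad u w) + (u w)\<^sup>2 * (hardy_P a w \<bullet> hardy_P a w)"
      unfolding power2_norm_eq_inner
      by (simp add: inner_diff_left inner_diff_right inner_commute[of "hardy_P a w" "grad u w"] power2_eq_square
          algebra_simps)
    show ?thesis
      unfolding hardy_density_def sq DX_eq by (simp add: algebra_simps)
  qed (simp add: hardy_density_def u0 g0 DX_def)
  have idens: "integrable lborel (hardy_density a u)"
    unfolding dens[abs_def] by (intro Bochner_Integration.integrable_diff Bochner_Integration.integrable_add igr iS div)
  have ind: "hardy_density a u w * indicator (ball 0 1) w = hardy_density a u w"
    "indicator (ball 0 1) w *\<^sub>R grad_sq u w = (cmod (grad u w))\<^sup>2"
    "indicator (ball 0 1) w *\<^sub>R ((u w)\<^sup>2 / (1 - (cmod w)\<^sup>2)\<^sup>2) = (u w)\<^sup>2 / (hardy_S w)\<^sup>2" for w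
    using K(2) u0[of w] g0[of w]
    by (cases "w \<in> K"; auto simp: hardy_density_def grad_sq_eq hardy_S_eq indicator_def)+
  have "(\<integral>w. hardy_density a u w \<partial>lborel) = (\<integral>w. (cmod (grad u w))\<^sup>2 \<partial>lborel) - (\<integral>w. (u w)\<^sup>2 / (hardy_S w)\<^sup>2 \<partial>lborel)"
    unfolding dens
    by (simp only: Bochner_Integration.integral_diff[OF Bochner_Integration.integrable_diff[OF igr iS]
          Bochner_Integration.integrable_add[OF div(1) div(1)]] Bochner_Integration.integral_diff[OF igr iS]
          Bochner_Integration.integral_add[OF div(1) div(1)] div(2) add_0_right diff_0_right)
  also have "\<dots> = H_norm u"
    unfolding H_norm_def set_lebesgue_integral_def ind ..
  finally have H: "(\<integral>w. hardy_density a u w \<partial>lborel) = H_norm u" .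
  have nn: "0 \<le> hardy_density a u w" for w
    using hardy_density_nonneg[OF a K1, of w u] by (cases "w \<in> K") (auto simp: hardy_density_def u0 g0)
  have "(\<integral>\<^sup>+w. ennreal (hardy_density a u w) * indicator (ball 0 1) w \<partial>lborel) = (\<integral>\<^sup>+w. ennreal (hardy_density a u w) \<partial>lborel)"
  proof (rule nn_integral_cong)
    fix w
    show "ennreal (hardy_density a u w) * indicator (ball 0 1) w = ennreal (hardy_density a u w)"
      using ind(1)[of w] by (cases "w \<in> ball 0 1") auto
  qed
  also have "\<dots> = ennreal (H_norm u)"
    using nn H idens by (subst nn_integral_eq_integral) auto
  finally show "(\<integral>\<^sup>+w. ennreal (hardy_density a u w) * indicator (ball 0 1) w \<partial>lborel) = ennreal (H_norm u)" .
  show "0 \<le> H_norm u"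
    unfolding H[symmetric] using nn by (intro Bochner_Integration.integral_nonneg) auto
qed

subsection \<open>Local representation of u by its Hardy density\<close>

text \<open>As d <= 2 (1 - |a|), the ball of radius d / 4 uses at most half of the distance to the
  circle, and all factors of the weights stay comparable to powers of d. The last bound has room:
  (5/4)^2 * (3/2) < 4.\<close>

lemma hardy_geometry:
  assumes a: "cmod a < 1" and w: "cmod (w - a) < (1 - (cmod a)\<^sup>2) / 4"
  defines "d \<equiv> 1 - (cmod a)\<^sup>2"
  shows "cmod w < 1" "d / 2 \<le> hardy_S w" "hardy_S w \<le> 3 * d / 2"
    "3 * d / 4 \<le> cmod (1 - cnj a * w)" "cmod (1 - cnj a * w) \<le> 5 * d / 4"
    "1 / (4 * d\<^sup>2) \<le> hardy_V a w"
proof -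
  have d: "0 < d" using a by (simp add: d_def abs_square_less_1)
  have w': "cmod (w - a) < d / 4" using w by (simp add: d_def)
  have "d = (1 - cmod a) * (1 + cmod a)" by (simp add: d_def power2_eq_square algebra_simps)
  also have "\<dots> \<le> (1 - cmod a) * 2" using a by (intro mult_left_mono) auto
  finally have "d \<le> 2 * (1 - cmod a)" by simp
  moreover have "cmod w \<le> cmod a + cmod (w - a)"
    using norm_triangle_ineq[of a "w - a"] by simp
  ultimately have "cmod w < cmod a + (1 - cmod a) / 2" using w' by argo
  then show w1: "cmod w < 1" using a by argo
  have Sd: "\<bar>hardy_S w - d\<bar> \<le> 2 * cmod (w - a)"
  proof -
    have "hardy_S w - d = (cmod a - cmod w) * (cmod a + cmod w)"
      by (simp add: hardy_S_eq d_def power2_eq_square algebra_simps)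
    then have "\<bar>hardy_S w - d\<bar> = \<bar>cmod a - cmod w\<bar> * (cmod a + cmod w)"
      by (simp add: abs_mult)
    also have "\<dots> \<le> cmod (w - a) * 2"
      using norm_triangle_ineq3[of a w] w1 a by (intro mult_mono) (auto simp: norm_minus_commute)
    finally show ?thesis by simp
  qed
  then show S: "d / 2 \<le> hardy_S w" "hardy_S w \<le> 3 * d / 2" using w' by linarith+
  \<comment> \<open>Expansion around w = a, where 1 - cnj a * a = d.\<close>
  have "1 - cnj a * w = of_real d - cnj a * (w - a)"
    by (simp add: d_def complex_norm_square algebra_simps flip: of_real_power)
  then have "\<bar>cmod (1 - cnj a * w) - d\<bar> \<le> cmod (cnj a * (w - a))"
    using norm_triangle_ineq3[of "of_real d - cnj a * (w - a)" "of_real d"] d by simp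
  also have "\<dots> \<le> 1 * cmod (w - a)"
    using a unfolding norm_mult by (intro mult_right_mono) auto
  finally have m: "\<bar>cmod (1 - cnj a * w) - d\<bar> \<le> cmod (w - a)" by simp
  then show M: "3 * d / 4 \<le> cmod (1 - cnj a * w)" "cmod (1 - cnj a * w) \<le> 5 * d / 4" using w' by linarith+
  have "hardy_N a w * hardy_S w \<le> (5 * d / 4)\<^sup>2 * (3 * d / 2)"
    unfolding hardy_N_eq using M S d by (intro mult_mono power_mono) auto
  also have "\<dots> \<le> 4 * d ^ 3"
    using d by (simp add: power2_eq_square power3_eq_cube)
  finally have NS: "hardy_N a w * hardy_S w \<le> 4 * d ^ 3" .
  have "1 / (4 * d\<^sup>2) = d / (4 * d ^ 3)" using d by (simp add: power2_eq_square power3_eq_cube)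
  also have "\<dots> \<le> d / (hardy_N a w * hardy_S w)"
    using NS d hardy_N_pos[OF a w1] hardy_S_pos[OF w1] by (intro divide_left_mono mult_pos_pos) auto
  also have "\<dots> = hardy_V a w" by (simp add: hardy_V_def d_def dot_square_norm)
  finally show "1 / (4 * d\<^sup>2) \<le> hardy_V a w" .
qed

text \<open>The reciprocal \<open>1/\<phi>\<close> of the positive function above.\<close>

definition hardy_eta :: "complex \<Rightarrow> complex \<Rightarrow> real" where
  "hardy_eta a w = sqrt (hardy_N a w * inverse (hardy_S w))"

lemma hardy_eta_pos: "cmod a < 1 \<Longrightarrow> cmod w < 1 \<Longrightarrow> 0 < hardy_eta a w"
  using hardy_N_pos[of a w] hardy_S_pos[of w] by (simp add: hardy_eta_def)

lemma GDERIV_hardy_eta: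
  assumes "cmod a < 1" "cmod w < 1"
  shows "GDERIV (hardy_eta a) w :> - hardy_eta a w *\<^sub>R hardy_P a w"
proof -
  have N: "0 < hardy_N a w" and S: "0 < hardy_S w"
    using hardy_N_pos[OF assms] hardy_S_pos[OF assms(2)] by auto
  define Y where "Y = hardy_N a w * inverse (hardy_S w)"
  have Y: "0 < Y" using N S by (simp add: Y_def)
  have "GDERIV (\<lambda>w. hardy_N a w * inverse (hardy_S w)) w :>
      hardy_N a w *\<^sub>R (- (inverse (hardy_S w))\<^sup>2 *\<^sub>R (- 2 *\<^sub>R w)) + inverse (hardy_S w) *\<^sub>R (2 *\<^sub>R ((a \<bullet> a) *\<^sub>R w - a))"
    using S by (intro GDERIV_mult GDERIV_inverse GDERIV_hardy_N GDERIV_hardy_S) auto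
  also have "hardy_N a w *\<^sub>R (- (inverse (hardy_S w))\<^sup>2 *\<^sub>R (- 2 *\<^sub>R w)) + inverse (hardy_S w) *\<^sub>R (2 *\<^sub>R ((a \<bullet> a) *\<^sub>R w - a))
      = (- 2 * Y) *\<^sub>R hardy_P a w"
    unfolding hardy_P_def Y_def using N S by (simp add: scaleR_diff_right power2_eq_square mult_ac)
  finally have 1: "GDERIV (\<lambda>w. hardy_N a w * inverse (hardy_S w)) w :> (- 2 * Y) *\<^sub>R hardy_P a w" .
  have 2: "(sqrt has_real_derivative inverse (sqrt Y) / 2) (at (hardy_N a w * inverse (hardy_S w)))"
    using DERIV_real_sqrt[OF Y] by (simp add: Y_def)
  have "inverse (sqrt Y) / 2 * (- 2 * Y) = - sqrt Y"
    using Y by (simp add: field_simps)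
  then show ?thesis
    using GDERIV_DERIV_compose[OF 1 2] by (simp add: hardy_eta_def[abs_def] Y_def)
qed

text \<open>The ratio of eta at w and z multiplies the kernel 1 / |z - w|. The first bound shows
  that this changes the kernel only by 5 / d, leaving the leading coefficient intact; the crude
  second bound suffices for the cutoff term. One factor 1 + 2 tau comes from |1 - cnj a w|, the
  other from sqrt (1 - |w|^2), and tau <= 1/8.\<close>

lemma hardy_eta_ratio:
  assumes a: "cmod a < 1" and z: "cmod (z - a) < (1 - (cmod a)\<^sup>2) / 8"
    and w: "cmod (w - z) < (1 - (cmod a)\<^sup>2) / 8"
  defines "d \<equiv> 1 - (cmod a)\<^sup>2"
  shows "hardy_eta a w \<le> (1 + 5 * cmod (z - w) / d) * hardy_eta a z"
    and "hardy_eta a w \<le> 2 * hardy_eta a z"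
proof -
  define \<tau> where "\<tau> = cmod (z - w) / d"
  have d: "0 < d" using a by (simp add: d_def abs_square_less_1)
  have za: "cmod (z - a) < (1 - (cmod a)\<^sup>2) / 4" using z d by (simp add: d_def)
  have wa: "cmod (w - a) < (1 - (cmod a)\<^sup>2) / 4"
    using norm_triangle_ineq[of "w - z" "z - a"] z w by simp
  note gz = hardy_geometry[OF a za, folded d_def] and gw = hardy_geometry[OF a wa, folded d_def]
  have \<tau>: "0 \<le> \<tau>" "\<tau> \<le> 1 / 8" using w d by (auto simp: \<tau>_def field_simps norm_minus_commute d_def)
  have zw: "cmod (z - w) = \<tau> * d" using d by (simp add: \<tau>_def)
  have eta: "hardy_eta a v = cmod (1 - cnj a * v) / sqrt (hardy_S v)" for v
    by (simp add: hardy_eta_def hardy_N_eq real_sqrt_mult real_sqrt_inverse divide_inverse)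
  have m: "cmod (1 - cnj a * w) \<le> (1 + 2 * \<tau>) * cmod (1 - cnj a * z)"
  proof -
    have "cmod (1 - cnj a * w) \<le> cmod (1 - cnj a * z) + cmod (cnj a * (z - w))"
      using norm_triangle_ineq[of "1 - cnj a * z" "cnj a * (z - w)"] by (simp add: algebra_simps)
    also have "cmod (cnj a * (z - w)) \<le> 1 * cmod (z - w)"
      using a unfolding norm_mult by (intro mult_right_mono) auto
    also have "1 * cmod (z - w) \<le> \<tau> * (2 * cmod (1 - cnj a * z))"
      unfolding zw using \<tau> gz d by (simp add: mult_left_mono)
    finally show ?thesis by (simp add: algebra_simps)
  qed
  have s: "sqrt (hardy_S z) \<le> (1 + 2 * \<tau>) * sqrt (hardy_S w)"
  proof -
    have "hardy_S z - hardy_S w = (cmod w - cmod z) * (cmod w + cmod z)"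
      by (simp add: hardy_S_eq power2_eq_square algebra_simps)
    also have "\<dots> \<le> cmod (z - w) * (cmod w + cmod z)"
      using norm_triangle_ineq2[of w z] by (intro mult_right_mono) (auto simp: norm_minus_commute)
    also have "\<dots> \<le> cmod (z - w) * 2"
      using gz(1) gw(1) by (intro mult_left_mono) auto
    also have "\<dots> = 4 * \<tau> * (d / 2)" using zw by simp
    also have "\<dots> \<le> 4 * \<tau> * hardy_S w" using gw \<tau> by (intro mult_left_mono) auto
    finally have "hardy_S z \<le> (1 + 4 * \<tau>) * hardy_S w" by (simp add: algebra_simps)
    also have "\<dots> \<le> (1 + 2 * \<tau>)\<^sup>2 * hardy_S w"
      using gw d by (intro mult_right_mono) (auto simp: power2_eq_square algebra_simps)
    finally have "sqrt (hardy_S z) \<le> sqrt ((1 + 2 * \<tau>)\<^sup>2 * hardy_S w)" by simp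
    then show ?thesis using \<tau> by (simp add: real_sqrt_mult)
  qed
  have sw: "0 < sqrt (hardy_S w)" "0 < sqrt (hardy_S z)" using gw gz d by auto
  have "hardy_eta a w \<le> (1 + 2 * \<tau>) * cmod (1 - cnj a * z) / sqrt (hardy_S w)"
    unfolding eta using m sw by (intro divide_right_mono) auto
  also have "\<dots> \<le> (1 + 2 * \<tau>) * cmod (1 - cnj a * z) * ((1 + 2 * \<tau>) / sqrt (hardy_S z))"
  proof -
    have "1 / sqrt (hardy_S w) \<le> (1 + 2 * \<tau>) / sqrt (hardy_S z)"
      using s sw by (simp add: field_simps)
    from mult_left_mono[OF this, of "(1 + 2 * \<tau>) * cmod (1 - cnj a * z)"] show ?thesis using \<tau> by simp
  qed
  also have "\<dots> = (1 + 2 * \<tau>)\<^sup>2 * hardy_eta a z"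
    by (simp add: eta power2_eq_square)
  finally have le: "hardy_eta a w \<le> (1 + 2 * \<tau>)\<^sup>2 * hardy_eta a z" .
  have "(1 + 2 * \<tau>)\<^sup>2 \<le> 1 + 5 * \<tau>"
  proof -
    have "\<tau> * \<tau> \<le> \<tau> * (1 / 8)" using \<tau> by (intro mult_left_mono) auto
    then show ?thesis using \<tau> by (simp add: power2_eq_square algebra_simps)
  qed
  then have "(1 + 2 * \<tau>)\<^sup>2 * hardy_eta a z \<le> (1 + 5 * \<tau>) * hardy_eta a z"
    using hardy_eta_pos[OF a gz(1)] by (intro mult_right_mono) auto
  with le have le5: "hardy_eta a w \<le> (1 + 5 * \<tau>) * hardy_eta a z" by linarith
  then show "hardy_eta a w \<le> (1 + 5 * cmod (z - w) / d) * hardy_eta a z" by (simp add: \<tau>_def)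
  have "(1 + 5 * \<tau>) * hardy_eta a z \<le> 2 * hardy_eta a z"
    using \<tau> hardy_eta_pos[OF a gz(1)] by (intro mult_right_mono) auto
  with le5 show "hardy_eta a w \<le> 2 * hardy_eta a z" by linarith
qed

text \<open>The outer square makes the truncated paraboloid continuously differentiable, which is
  all that the gradient representation asks for. Its gradient is O(|w - z|) at the centre, and this
  factor cancels the singularity of the kernel.\<close>

definition cutoff :: "real \<Rightarrow> complex \<Rightarrow> complex \<Rightarrow> real" where
  "cutoff r z w = (max 0 (1 - (w - z) \<bullet> (w - z) / r\<^sup>2))\<^sup>2"

definition grad_cutoff :: "real \<Rightarrow> complex \<Rightarrow> complex \<Rightarrow> complex" where
  "grad_cutoff r z w = (2 * max 0 (1 - (w - z) \<bullet> (w - z) / r\<^sup>2)) *\<^sub>R ((- 2 / r\<^sup>2) *\<^sub>R (w - z))"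

lemma DERIV_max_0_sq: "((\<lambda>x. (max 0 x)\<^sup>2) has_real_derivative 2 * max 0 x) (at x)" for x :: real
proof (cases x "0 :: real" rule: linorder_cases)
  case less
  have "((\<lambda>x. 0) has_real_derivative 2 * max 0 x) (at x)" using less by simp
  then show ?thesis
    by (rule has_field_derivative_transform_within_open[where S = "{..<0}"]) (use less in auto)
next
  case greater
  have "((\<lambda>x. x\<^sup>2) has_real_derivative 2 * max 0 x) (at x)"
    using greater by (auto intro!: derivative_eq_intros)
  then show ?thesis
    by (rule has_field_derivative_transform_within_open[where S = "{0<..}"]) (use greater in auto)
next
  case equal
  have "((\<lambda>h. \<bar>h\<bar>) \<longlongrightarrow> \<bar>0\<bar>) (at (0::real))"
    by (intro tendsto_rabs tendsto_ident_at)
  then have lim: "((\<lambda>h. \<bar>h\<bar>) \<longlongrightarrow> 0) (at (0::real))" by simp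
  have "norm (((max 0 (0 + h))\<^sup>2 - (max 0 0)\<^sup>2) / h) \<le> \<bar>h\<bar>" for h :: real
    by (cases "0 \<le> h") (auto simp: max_def power2_eq_square)
  then have "((\<lambda>h. ((max 0 (0 + h))\<^sup>2 - (max 0 0)\<^sup>2) / h) \<longlongrightarrow> 0) (at (0::real))"
    by (intro Lim_null_comparison[OF always_eventually lim]) blast
  then have "((\<lambda>x. (max 0 x)\<^sup>2) has_real_derivative 0) (at (0::real))"
    unfolding DERIV_def .
  then show ?thesis
    unfolding equal by simp
qed

lemma GDERIV_cutoff: "GDERIV (cutoff r z) w :> grad_cutoff r z w"
proof -
  have "GDERIV (\<lambda>w. 1 - (w - z) \<bullet> (w - z) / r\<^sup>2) w :> (- 2 / r\<^sup>2) *\<^sub>R (w - z)"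
  proof -
    have "((\<lambda>w. (w - z) \<bullet> (w - z)) has_derivative (\<lambda>h. (w - z) \<bullet> (h - 0) + (h - 0) \<bullet> (w - z))) (at w)"
      by (intro has_derivative_inner has_derivative_diff has_derivative_ident has_derivative_const)
    then have "((\<lambda>w. 1 - inverse (r\<^sup>2) * ((w - z) \<bullet> (w - z))) has_derivative
        (\<lambda>h. 0 - inverse (r\<^sup>2) * ((w - z) \<bullet> (h - 0) + (h - 0) \<bullet> (w - z)))) (at w)"
      by (intro has_derivative_diff has_derivative_const has_derivative_mult_right)
    moreover have "(\<lambda>h. 0 - inverse (r\<^sup>2) * ((w - z) \<bullet> (h - 0) + (h - 0) \<bullet> (w - z))) = (\<lambda>h. h \<bullet> ((- 2 / r\<^sup>2) *\<^sub>R (w - z)))"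
      by (simp add: inner_commute[of "w - z"] fun_eq_iff divide_inverse)
    ultimately show ?thesis
      unfolding gderiv_def by (simp add: divide_inverse mult.commute)
  qed
  from GDERIV_DERIV_compose[OF this DERIV_max_0_sq]
  show ?thesis unfolding cutoff_def[abs_def] grad_cutoff_def .
qed

lemma cutoff_bounds:
  assumes "0 < r"
  shows "0 \<le> cutoff r z w" "cutoff r z w \<le> 1" "cutoff r z z = 1"
    "cmod (grad_cutoff r z w) \<le> 4 / r\<^sup>2 * cmod (w - z)"
    "r \<le> cmod (w - z) \<Longrightarrow> cutoff r z w = 0" "r \<le> cmod (w - z) \<Longrightarrow> grad_cutoff r z w = 0"
proof -
  define m where "m = max 0 (1 - (w - z) \<bullet> (w - z) / r\<^sup>2)"
  have m: "0 \<le> m" "m \<le> 1" by (auto simp: m_def)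
  show "0 \<le> cutoff r z w" "cutoff r z z = 1" by (simp_all add: cutoff_def)
  show "cutoff r z w \<le> 1" using m by (simp add: cutoff_def m_def[symmetric] power_le_one)
  have "cmod (grad_cutoff r z w) = 2 * m * (2 / r\<^sup>2 * cmod (w - z))"
    using m by (simp add: grad_cutoff_def m_def[symmetric])
  also have "\<dots> \<le> 2 * 1 * (2 / r\<^sup>2 * cmod (w - z))"
    using m by (intro mult_right_mono) auto
  finally show "cmod (grad_cutoff r z w) \<le> 4 / r\<^sup>2 * cmod (w - z)" by simp
  assume "r \<le> cmod (w - z)"
  then have "r\<^sup>2 \<le> (w - z) \<bullet> (w - z)"
    using assms unfolding dot_square_norm by (intro power_mono) auto
  then have "m = 0" using assms by (simp add: m_def)
  then show "cutoff r z w = 0" "grad_cutoff r z w = 0" by (simp_all add: cutoff_def grad_cutoff_def m_def)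
qed

text \<open>The gradient representation is applied to psi u eta with eta = 1 / phi and psi the
  cutoff around z: the gradient of u eta is eta (grad u - u P), controlled by the density. The
  cutoff term is controlled through |u| <= 2 d f, which is where the lower bound on
  \<open>hardy_V\<close> enters.\<close>

lemma local_representation:
  assumes u: "C0_inf_disc u" and a: "cmod a < 1" and z: "cmod (z - a) < (1 - (cmod a)\<^sup>2) / 8"
  defines "d \<equiv> 1 - (cmod a)\<^sup>2"
  shows "ennreal \<bar>u z\<bar> \<le> (\<integral>\<^sup>+w. ennreal ((1 / cmod (z - w) + 1029 / d) / (2 * pi) * sqrt (hardy_density a u w))
      * indicator (ball a (d / 4)) w \<partial>lborel)"
proof -
  obtain K where "compact K" "K \<subseteq> ball 0 1" "\<And>w. w \<notin> K \<Longrightarrow> u w = 0" "\<And>w. w \<notin> K \<Longrightarrow> grad u w = 0"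
    and G: "\<And>w. GDERIV u w :> grad u w" and cG: "continuous_on UNIV (grad u)" and cu: "continuous_on UNIV u"
    by (rule C0_inf_discE[OF u]) blast
  define r where "r = d / 8"
  have d: "0 < d" using a by (simp add: d_def abs_square_less_1)
  have r: "0 < r" using d by (simp add: r_def)
  have z': "cmod (z - a) < d / 8" using z by (simp add: d_def)
  have wa: "cmod (w - a) < d / 4" if "w \<in> cball z r" for w
    using norm_triangle_ineq[of "w - z" "z - a"] that z' by (simp add: r_def dist_norm norm_minus_commute)
  have w1: "cmod w < 1" if "w \<in> cball z r" for w
    using hardy_geometry(1)[OF a] wa[OF that] by (simp add: d_def)
  have z1: "cmod z < 1" using w1[of z] r by simp
  let ?\<psi> = "cutoff r z" and ?\<eta> = "hardy_eta a" and ?G = "\<lambda>w. grad u w - u w *\<^sub>R hardy_P a w"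
  define g where "g w = (?\<psi> w * u w) * ?\<eta> w" for w
  define Dg where "Dg w = (?\<psi> w * u w) *\<^sub>R (- ?\<eta> w *\<^sub>R hardy_P a w)
      + ?\<eta> w *\<^sub>R (?\<psi> w *\<^sub>R grad u w + u w *\<^sub>R grad_cutoff r z w)" for w
  have out: "g w = 0" "Dg w = 0" if "w \<notin> cball z r" for w
    using cutoff_bounds(5,6)[OF r, of w z] that by (auto simp: g_def Dg_def dist_norm norm_minus_commute)
  have Dg: "GDERIV g w :> Dg w" for w
  proof (cases "cmod w < 1")
    case True
    then show ?thesis
      unfolding g_def[abs_def] Dg_def
      by (intro GDERIV_mult GDERIV_cutoff G GDERIV_hardy_eta a)
  next
    case False
    then have "w \<notin> cball z r" using w1 by blast
    then show ?thesis
      using GDERIV_transform_zero[of "cball z r" g w] out by auto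
  qed
  have Sne: "hardy_S w \<noteq> 0" and Nne: "hardy_N a w \<noteq> 0" if "w \<in> ball 0 1" for w
    using hardy_S_pos[of w] hardy_N_pos[OF a, of w] that by auto
  have cDg: "continuous_on UNIV Dg"
  proof (rule continuous_on_UNIV_of_closed_support[OF open_ball closed_cball _ _ out(2)])
    show "cball z r \<subseteq> ball 0 1" using w1 by auto
    have inv: "continuous_on (ball 0 1) (\<lambda>w. inverse (hardy_N a w))" "continuous_on (ball 0 1) (\<lambda>w. inverse (hardy_S w))"
      by (intro continuous_intros ballI Nne Sne; assumption)+
    note cont = continuous_on_diff continuous_on_add continuous_on_scaleR continuous_on_mult continuous_on_power
      continuous_on_inner continuous_on_const continuous_on_id continuous_on_max continuous_on_real_sqrt
      continuous_on_minus inv continuous_on_hardy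
      continuous_on_subset[OF cG subset_UNIV] continuous_on_subset[OF cu subset_UNIV]
    have c1: "continuous_on (ball 0 1) (hardy_P a)" unfolding hardy_P_def[abs_def] by (intro cont)
    have c2: "continuous_on (ball 0 1) ?\<eta>" unfolding hardy_eta_def[abs_def] by (intro cont)
    have c3: "continuous_on (ball 0 1) ?\<psi>" unfolding cutoff_def[abs_def] divide_inverse by (intro cont)
    have c4: "continuous_on (ball 0 1) (grad_cutoff r z)" unfolding grad_cutoff_def[abs_def] divide_inverse by (intro cont)
    show "continuous_on (ball 0 1) Dg"
      unfolding Dg_def[abs_def] by (intro cont c1 c2 c3 c4)
  qed
  then have rep: "ennreal \<bar>g z\<bar> \<le> (\<integral>\<^sup>+w. ennreal (cmod (Dg w) / (2 * pi * cmod (z - w))) \<partial>lborel)"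
    using r out(1) by (intro norm_le_gradient_potential[OF Dg, where R = r]) auto
  have [measurable]: "Dg \<in> borel_measurable borel"
    using cDg by (rule borel_measurable_continuous_onI)
  have \<eta>z: "0 < ?\<eta> z" using hardy_eta_pos[OF a z1] .
  have gz: "g z = u z * ?\<eta> z" using cutoff_bounds(3)[OF r] by (simp add: g_def)
  have "ennreal \<bar>u z\<bar> = ennreal (inverse (?\<eta> z)) * ennreal \<bar>g z\<bar>"
    using \<eta>z by (simp add: gz abs_mult ennreal_mult'[symmetric])
  also have "\<dots> \<le> ennreal (inverse (?\<eta> z)) * (\<integral>\<^sup>+w. ennreal (cmod (Dg w) / (2 * pi * cmod (z - w))) \<partial>lborel)"
    by (intro mult_left_mono rep) auto
  also have "\<dots> = (\<integral>\<^sup>+w. ennreal (inverse (?\<eta> z)) * ennreal (cmod (Dg w) / (2 * pi * cmod (z - w))) \<partial>lborel)"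
    by (rule nn_integral_cmult[symmetric]) measurable
  also have "\<dots> \<le> (\<integral>\<^sup>+w. ennreal ((1 / cmod (z - w) + 1029 / d) / (2 * pi) * sqrt (hardy_density a u w))
      * indicator (ball a (d / 4)) w \<partial>lborel)"
  proof (rule nn_integral_mono)
    fix w
    show "ennreal (inverse (?\<eta> z)) * ennreal (cmod (Dg w) / (2 * pi * cmod (z - w)))
      \<le> ennreal ((1 / cmod (z - w) + 1029 / d) / (2 * pi) * sqrt (hardy_density a u w)) * indicator (ball a (d / 4)) w"
    \<comment> \<open>At w = z the left side is 0 by division by zero, so the diagonal joins the
      region outside the cutoff.\<close>
    proof (cases "r \<le> cmod (w - z) \<or> w = z")
      case True
      then have eq0: "cmod (Dg w) / (2 * pi * cmod (z - w)) = 0"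
        using cutoff_bounds(5,6)[OF r, of w z] by (auto simp: Dg_def)
      show ?thesis unfolding eq0 by simp
    next
      case False
      then have wz: "cmod (w - z) < r" "w \<noteq> z" by auto
      then have wc: "w \<in> cball z r" by (simp add: dist_norm norm_minus_commute)
      define \<rho> where "\<rho> = cmod (z - w)"
      have \<rho>: "0 < \<rho>" "cmod (w - z) = \<rho>" using wz by (auto simp: \<rho>_def norm_minus_commute)
      define f where "f = sqrt (hardy_density a u w)"
      have V0: "0 \<le> hardy_V a w" using hardy_V_nonneg[OF a w1[OF wc]] .
      have V: "1 / (4 * d\<^sup>2) \<le> hardy_V a w"
        using hardy_geometry(6)[OF a] wa[OF wc] by (simp add: d_def)
      have f: "0 \<le> f" "cmod (?G w) \<le> f" "\<bar>u w\<bar> \<le> 2 * d * f"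
      proof -
        show "0 \<le> f" using hardy_density_nonneg[OF a w1[OF wc]] by (simp add: f_def)
        show "cmod (?G w) \<le> f" unfolding f_def hardy_density_def
          using V0 by (intro real_le_rsqrt) auto
        have "\<bar>u w\<bar> / (2 * d) = sqrt ((u w)\<^sup>2 * (1 / (4 * d\<^sup>2)))"
          using d by (simp add: real_sqrt_mult real_sqrt_divide)
        also have "\<dots> \<le> f" unfolding f_def hardy_density_def
          using V by (intro real_sqrt_le_mono add_increasing mult_left_mono) auto
        finally show "\<bar>u w\<bar> \<le> 2 * d * f" using d by (simp add: field_simps)
      qed
      have Dg_eq: "Dg w = ?\<eta> w *\<^sub>R (?\<psi> w *\<^sub>R ?G w + u w *\<^sub>R grad_cutoff r z w)"
        by (simp add: Dg_def algebra_simps)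
      have e: "0 < ?\<eta> w" "?\<eta> w \<le> (1 + 5 * \<rho> / d) * ?\<eta> z" "?\<eta> w \<le> 2 * ?\<eta> z"
        using hardy_eta_pos[OF a w1[OF wc]] hardy_eta_ratio[OF a z, of w] wz
        by (auto simp: \<rho>_def d_def r_def)
      have "cmod (Dg w) \<le> ?\<eta> w * (?\<psi> w * cmod (?G w) + \<bar>u w\<bar> * cmod (grad_cutoff r z w))"
        unfolding Dg_eq norm_scaleR using e cutoff_bounds(1)[OF r, of z w]
        by (simp only: abs_of_pos) (intro mult_left_mono order_trans[OF norm_triangle_ineq], simp_all)
      also have "\<dots> = ?\<eta> w * (?\<psi> w * cmod (?G w)) + ?\<eta> w * (\<bar>u w\<bar> * cmod (grad_cutoff r z w))"
        by (rule distrib_left)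
      \<comment> \<open>The constant 1029 is 5 + 1024: 5 from the ratio of eta, and 2 * 2 d * 4 /
        r^2 = 1024 / d for r = d / 8.\<close>
      also have "\<dots> \<le> ((1 + 5 * \<rho> / d) * ?\<eta> z) * (1 * f) + (2 * ?\<eta> z) * (2 * d * f * (4 / r\<^sup>2 * \<rho>))"
        using e \<eta>z f \<rho> d cutoff_bounds(1,2,4)[OF r, of z w]
        by (intro add_mono mult_mono) (auto intro!: mult_nonneg_nonneg)
      also have "\<dots> = ?\<eta> z * (f * (1 + 1029 / d * \<rho>))"
        using d by (simp add: r_def field_simps power2_eq_square)
      finally have "inverse (?\<eta> z) * cmod (Dg w) \<le> f * (1 + 1029 / d * \<rho>)"
        using \<eta>z by (simp add: field_simps)
      then have "inverse (?\<eta> z) * cmod (Dg w) / (2 * pi * \<rho>) \<le> f * (1 + 1029 / d * \<rho>) / (2 * pi * \<rho>)"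
        using \<rho> by (intro divide_right_mono) auto
      also have "\<dots> = (1 / \<rho> + 1029 / d) / (2 * pi) * f"
        using \<rho> d by (simp add: field_simps)
      finally have "inverse (?\<eta> z) * (cmod (Dg w) / (2 * pi * cmod (z - w))) \<le> (1 / cmod (z - w) + 1029 / d) / (2 * pi) * f"
        by (simp add: \<rho>_def)
      moreover have "w \<in> ball a (d / 4)" using wa[OF wc] by (simp add: dist_norm norm_minus_commute)
      ultimately show ?thesis
        using \<eta>z by (simp add: ennreal_mult'[symmetric] f_def[symmetric] ennreal_leI)
    qed
  qed
  finally show ?thesis .
qed

subsection \<open>The inequality\<close>

lemma hardy_density_measurable:
  assumes "C0_inf_disc u"
  shows "hardy_density a u \<in> borel_measurable borel"
proof -
  have cG: "continuous_on UNIV (grad u)" and cu: "continuous_on UNIV u"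
    by (rule C0_inf_discE[OF assms]; blast)+
  have [measurable]: "grad u \<in> borel_measurable borel" "u \<in> borel_measurable borel"
    using cG cu by (auto intro: borel_measurable_continuous_onI)
  show ?thesis
    unfolding hardy_density_def[abs_def] hardy_V_def hardy_P_def hardy_N_def hardy_S_def by measurable
qed

text \<open>The map w to a + R w with R = d / 4 carries the unit disc onto the ball of the local
  representation. The kernel becomes one with a constant perturbation for all \<open>a\<close>, so a
  single Adams constant serves, and the factor d^2 is the Jacobian.\<close>

lemma local_moser_inequality:
  obtains M where "0 \<le> M" "\<And>u a. C0_inf_disc u \<Longrightarrow> cmod a < 1 \<Longrightarrow> 0 < H_norm u \<Longrightarrow>
    (\<integral>\<^sup>+z. ennreal (exp (4 * pi * (u z)\<^sup>2 / H_norm u)) * indicator (ball a ((1 - (cmod a)\<^sup>2) / 8)) z \<partial>lborel)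
      \<le> ennreal (M * (1 - (cmod a)\<^sup>2)\<^sup>2)"
proof -
  \<comment> \<open>The product of R = d / 4 and the perturbation 1029 / d.\<close>
  define C :: real where "C = 1029 / 4"
  have C: "0 \<le> C" by (simp add: C_def)
  from adams_inequality_disc[OF C] obtain M where M: "0 \<le> M" "\<And>f h. f \<in> borel_measurable borel \<Longrightarrow> h \<in> borel_measurable borel \<Longrightarrow>
    (\<integral>\<^sup>+w. (f w)\<^sup>2 \<partial>lborel) \<le> 1 \<Longrightarrow> (\<And>z. 0 \<le> h z) \<Longrightarrow>
    (\<And>z. z \<in> ball 0 1 \<Longrightarrow> ennreal (h z) \<le> (\<integral>\<^sup>+w. ennreal (ring_kernel C 0 2 z w) * f w \<partial>lborel)) \<Longrightarrow>
    (\<integral>\<^sup>+z. ennreal (exp (4 * pi * (h z)\<^sup>2)) * indicator (ball 0 1) z \<partial>lborel) \<le> ennreal M"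
    by blast
  have main: "(\<integral>\<^sup>+z. ennreal (exp (4 * pi * (u z)\<^sup>2 / H_norm u)) * indicator (ball a ((1 - (cmod a)\<^sup>2) / 8)) z \<partial>lborel)
      \<le> ennreal (M / 16 * (1 - (cmod a)\<^sup>2)\<^sup>2)"
    if u: "C0_inf_disc u" and a: "cmod a < 1" and Q: "0 < H_norm u" for u a
  proof -
    define d where "d = 1 - (cmod a)\<^sup>2"
    define R where "R = d / 4"
    define Q where "Q = H_norm u"
    have Q0: "0 < Q" using Q by (simp add: Q_def)
    have d: "0 < d" using a by (simp add: d_def abs_square_less_1)
    have R: "0 < R" using d by (simp add: R_def)
    have cu: "continuous_on UNIV u" by (rule C0_inf_discE[OF u]; blast)
    have [measurable]: "u \<in> borel_measurable borel"
      using cu by (rule borel_measurable_continuous_onI)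
    have [measurable]: "hardy_density a u \<in> borel_measurable borel"
      using u by (rule hardy_density_measurable)
    have [measurable]: "ball z r \<in> sets borel" for z :: complex and r by simp
    have ball_R: "a + R *\<^sub>R w \<in> ball a R \<longleftrightarrow> w \<in> ball 0 1" for w
      using R by (simp add: dist_norm)
    have ball_d: "a + R *\<^sub>R w \<in> ball a (d / 8) \<longleftrightarrow> cmod w < 1 / 2" for w
      using d by (auto simp: dist_norm R_def)
    have in1: "cmod w < 1" if "w \<in> ball a R" for w
      using hardy_geometry(1)[OF a, of w] that by (simp add: R_def d_def dist_norm norm_minus_commute)
    define F where "F w = sqrt (hardy_density a u w)" for w
    have [measurable]: "F \<in> borel_measurable borel" unfolding F_def by measurable
    have F0: "0 \<le> F w" "(F w)\<^sup>2 = hardy_density a u w" if "w \<in> ball a R" for w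
      using hardy_density_nonneg[OF a in1[OF that], of u] by (auto simp: F_def)
    \<comment> \<open>The factor \<open>R\<close> preserves the L^2 norm under the scaling; dividing
      by sqrt Q then brings it below 1 by the Hardy identity.\<close>
    define f where "f w = ennreal (R * F (a + R *\<^sub>R w) / sqrt Q) * indicator (ball 0 1) w" for w
    \<comment> \<open>The representation holds only within d / 8 = R / 2 of \<open>a\<close>, so
      \<open>h\<close> is set to 0 elsewhere in the disc.\<close>
    define h where "h w = (if cmod w < 1 / 2 then \<bar>u (a + R *\<^sub>R w)\<bar> / sqrt Q else 0)" for w
    have [measurable]: "f \<in> borel_measurable borel" "h \<in> borel_measurable borel"
      unfolding f_def h_def by measurable
    have "(\<integral>\<^sup>+w. (f w)\<^sup>2 \<partial>lborel) =
      (\<integral>\<^sup>+w. ennreal (1 / Q) * (ennreal (R\<^sup>2) * (ennreal (hardy_density a u (a + R *\<^sub>R w)) * indicator (ball a R) (a + R *\<^sub>R w))) \<partial>lborel)"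
    proof (rule nn_integral_cong)
      fix w :: complex
      show "(f w)\<^sup>2 = ennreal (1 / Q) * (ennreal (R\<^sup>2) * (ennreal (hardy_density a u (a + R *\<^sub>R w)) * indicator (ball a R) (a + R *\<^sub>R w)))"
      proof (cases "w \<in> ball 0 1")
        case True
        then have w: "a + R *\<^sub>R w \<in> ball a R" using ball_R by blast
        have "(R * F (a + R *\<^sub>R w) / sqrt Q)\<^sup>2 = 1 / Q * (R\<^sup>2 * hardy_density a u (a + R *\<^sub>R w))"
          using Q0 F0[OF w] by (simp add: power_mult_distrib power_divide)
        moreover have "0 \<le> R * F (a + R *\<^sub>R w) / sqrt Q" using F0[OF w] R Q0 by simp
        ultimately have "(f w)\<^sup>2 = ennreal (1 / Q * (R\<^sup>2 * hardy_density a u (a + R *\<^sub>R w)))"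
          using True by (simp add: f_def ennreal_power del: ball_simps)
        then show ?thesis using w Q0 by (simp add: ennreal_mult'[symmetric] del: mem_ball)
      next
        case False
        then have "a + R *\<^sub>R w \<notin> ball a R" using ball_R by blast
        then show ?thesis using False by (simp add: f_def del: mem_ball)
      qed
    qed
    also have "\<dots> = ennreal (1 / Q) * (ennreal (R\<^sup>2) * (\<integral>\<^sup>+w. ennreal (hardy_density a u (a + R *\<^sub>R w)) * indicator (ball a R) (a + R *\<^sub>R w) \<partial>lborel))"
      by (simp add: nn_integral_cmult)
    also have "ennreal (R\<^sup>2) * (\<integral>\<^sup>+w. ennreal (hardy_density a u (a + R *\<^sub>R w)) * indicator (ball a R) (a + R *\<^sub>R w) \<partial>lborel)
        = (\<integral>\<^sup>+w. ennreal (hardy_density a u w) * indicator (ball a R) w \<partial>lborel)"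
      using R by (intro nn_integral_lborel_affine[symmetric]) auto
    also have "\<dots> \<le> (\<integral>\<^sup>+w. ennreal (hardy_density a u w) * indicator (ball 0 1) w \<partial>lborel)"
      using in1 by (intro nn_integral_mono) (auto split: split_indicator)
    also have "\<dots> = ennreal Q" using hardy_identity(1)[OF u a] by (simp add: Q_def)
    also have "ennreal (1 / Q) * ennreal Q = 1"
      using Q0 by (simp add: ennreal_mult'[symmetric])
    finally have f1: "(\<integral>\<^sup>+w. (f w)\<^sup>2 \<partial>lborel) \<le> 1" by (simp add: mult_left_mono)
    have h_le: "ennreal (h z) \<le> (\<integral>\<^sup>+w. ennreal (ring_kernel C 0 2 z w) * f w \<partial>lborel)" if z: "z \<in> ball 0 1" for z
    proof (cases "cmod z < 1 / 2")
      case True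
      define \<zeta> where "\<zeta> = a + R *\<^sub>R z"
      have "cmod (\<zeta> - a) < d / 8" using ball_d[of z] True by (simp add: \<zeta>_def dist_norm norm_minus_commute)
      then have rep: "ennreal \<bar>u \<zeta>\<bar> \<le> (\<integral>\<^sup>+w. ennreal ((1 / cmod (\<zeta> - w) + 1029 / d) / (2 * pi) * F w) * indicator (ball a R) w \<partial>lborel)"
        using local_representation[OF u a, of \<zeta>] by (simp add: d_def R_def F_def)
      have "ennreal (h z) = ennreal (1 / sqrt Q) * ennreal \<bar>u \<zeta>\<bar>"
        using True Q0 by (simp add: h_def \<zeta>_def ennreal_mult'[symmetric])
      also have "\<dots> \<le> ennreal (1 / sqrt Q) * (\<integral>\<^sup>+w. ennreal ((1 / cmod (\<zeta> - w) + 1029 / d) / (2 * pi) * F w) * indicator (ball a R) w \<partial>lborel)"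
        by (intro mult_left_mono rep) auto
      also have "(\<integral>\<^sup>+w. ennreal ((1 / cmod (\<zeta> - w) + 1029 / d) / (2 * pi) * F w) * indicator (ball a R) w \<partial>lborel)
        = ennreal (R\<^sup>2) * (\<integral>\<^sup>+w. ennreal ((1 / cmod (\<zeta> - (a + R *\<^sub>R w)) + 1029 / d) / (2 * pi) * F (a + R *\<^sub>R w)) * indicator (ball a R) (a + R *\<^sub>R w) \<partial>lborel)"
        using R by (intro nn_integral_lborel_affine) auto
      also have "ennreal (1 / sqrt Q) * \<dots> = (\<integral>\<^sup>+w. ennreal (1 / sqrt Q) * (ennreal (R\<^sup>2) *
          (ennreal ((1 / cmod (\<zeta> - (a + R *\<^sub>R w)) + 1029 / d) / (2 * pi) * F (a + R *\<^sub>R w)) * indicator (ball a R) (a + R *\<^sub>R w))) \<partial>lborel)"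
        by (simp add: nn_integral_cmult)
      also have "\<dots> = (\<integral>\<^sup>+w. ennreal (ring_kernel C 0 2 z w) * f w \<partial>lborel)"
      proof (rule nn_integral_cong)
        fix w :: complex
        show "ennreal (1 / sqrt Q) * (ennreal (R\<^sup>2) *
          (ennreal ((1 / cmod (\<zeta> - (a + R *\<^sub>R w)) + 1029 / d) / (2 * pi) * F (a + R *\<^sub>R w)) * indicator (ball a R) (a + R *\<^sub>R w)))
          = ennreal (ring_kernel C 0 2 z w) * f w"
        proof (cases "w \<in> ball 0 1")
          case w: True
          then have wR: "a + R *\<^sub>R w \<in> ball a R" using ball_R by blast
          define G where "G = F (a + R *\<^sub>R w)"
          have G0: "0 \<le> G" using F0[OF wR] by (simp add: G_def)
          have "\<zeta> - (a + R *\<^sub>R w) = R *\<^sub>R (z - w)" by (simp add: \<zeta>_def scaleR_diff_right)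
          then have n: "cmod (\<zeta> - (a + R *\<^sub>R w)) = R * cmod (z - w)" using R by simp
          have "cmod (z - w) < 2"
            using norm_triangle_ineq4[of z w] w z by simp
          then have k: "ring_kernel C 0 2 z w = (1 / cmod (z - w) + C) / (2 * pi)"
            by (simp add: ring_kernel_def)
          have eq: "1 / sqrt Q * (R\<^sup>2 * ((1 / (R * cmod (z - w)) + 1029 / d) / (2 * pi) * G))
              = (1 / cmod (z - w) + C) / (2 * pi) * (R * G / sqrt Q)"
          proof -
            have *: "R * (1 / (R * cmod (z - w)) + 1029 / d) = 1 / cmod (z - w) + C"
              using R d by (simp add: distrib_left C_def) (simp add: R_def)
            have "1 / sqrt Q * (R\<^sup>2 * (Y / (2 * pi) * G)) = R * Y / (2 * pi) * (R * G / sqrt Q)" for Y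
              by (simp add: power2_eq_square mult_ac)
            then show ?thesis unfolding *[symmetric] .
          qed
          have ennreal_eq: "ennreal p * (ennreal q * ennreal x) = ennreal y * ennreal v"
            if "p * (q * x) = y * v" "0 \<le> p" "0 \<le> q" "0 \<le> x" "0 \<le> y" "0 \<le> v" for p q x y v
            using that by (simp add: ennreal_mult[symmetric])
          have "f w = ennreal (R * G / sqrt Q)" using w by (simp add: f_def G_def)
          moreover have "indicator (ball a R) (a + R *\<^sub>R w) = (1 :: ennreal)" using wR by (simp del: mem_ball)
          ultimately show ?thesis
            unfolding n k G_def[symmetric] using Q0 R d G0 C by (simp only: mult_1_right) (intro ennreal_eq eq, auto)
        next
          case False
          then have "a + R *\<^sub>R w \<notin> ball a R" using ball_R by blast
          then show ?thesis using False by (simp add: f_def del: mem_ball)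
        qed
      qed
      finally show ?thesis .
    qed (simp add: h_def)
    have h0: "0 \<le> h z" for z using Q0 by (simp add: h_def)
    have "(\<integral>\<^sup>+z. ennreal (exp (4 * pi * (u z)\<^sup>2 / Q)) * indicator (ball a (d / 8)) z \<partial>lborel)
      = ennreal (R\<^sup>2) * (\<integral>\<^sup>+z. ennreal (exp (4 * pi * (u (a + R *\<^sub>R z))\<^sup>2 / Q)) * indicator (ball a (d / 8)) (a + R *\<^sub>R z) \<partial>lborel)"
      using R by (intro nn_integral_lborel_affine) auto
    also have "\<dots> \<le> ennreal (R\<^sup>2) * (\<integral>\<^sup>+z. ennreal (exp (4 * pi * (h z)\<^sup>2)) * indicator (ball 0 1) z \<partial>lborel)"
    proof (intro mult_left_mono nn_integral_mono)
      fix z :: complex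
      show "ennreal (exp (4 * pi * (u (a + R *\<^sub>R z))\<^sup>2 / Q)) * indicator (ball a (d / 8)) (a + R *\<^sub>R z)
        \<le> ennreal (exp (4 * pi * (h z)\<^sup>2)) * indicator (ball 0 1) z"
      proof (cases "cmod z < 1 / 2")
        case True
        then have "4 * pi * (h z)\<^sup>2 = 4 * pi * (u (a + R *\<^sub>R z))\<^sup>2 / Q"
          using Q0 by (simp add: h_def power_divide)
        then show ?thesis using True by (simp add: indicator_def)
      next
        case False
        then have "a + R *\<^sub>R z \<notin> ball a (d / 8)" using ball_d by blast
        then show ?thesis by (simp del: mem_ball)
      qed
    qed auto
    also have "\<dots> \<le> ennreal (R\<^sup>2) * ennreal M"
      using f1 h0 h_le by (intro mult_left_mono M(2)[of f h]) auto
    also have "\<dots> = ennreal (M / 16 * d\<^sup>2)"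
      using M(1) by (simp add: ennreal_mult'[symmetric] R_def power_divide mult.commute)
    finally show ?thesis by (simp add: Q_def d_def)
  qed
  show ?thesis by (rule that[of "M / 16"]) (use M(1) main in auto)
qed

theorem theorem1p1:
  shows "\<exists>C1::real. \<forall>u. C0_inf_disc u \<and> u \<noteq> (\<lambda>_. 0) \<longrightarrow>
    (\<integral>\<^sup>+ z \<in> ball 0 1. ennreal (exp (4 * pi * (u z)\<^sup>2 / H_norm u)) \<partial>lborel) \<le> ennreal C1"
proof -
  from local_moser_inequality obtain M where M0: "0 \<le> M" and M: "\<And>u a. C0_inf_disc u \<Longrightarrow> cmod a < 1 \<Longrightarrow> 0 < H_norm u \<Longrightarrow>
    (\<integral>\<^sup>+z. ennreal (exp (4 * pi * (u z)\<^sup>2 / H_norm u)) * indicator (ball a ((1 - (cmod a)\<^sup>2) / 8)) z \<partial>lborel)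
      \<le> ennreal (M * (1 - (cmod a)\<^sup>2)\<^sup>2)"
    by blast
  have "(\<integral>\<^sup>+ z \<in> ball 0 1. ennreal (exp (4 * pi * (u z)\<^sup>2 / H_norm u)) \<partial>lborel) \<le> ennreal (1024 * M + pi)"
    if u: "C0_inf_disc u" for u
  proof (cases "H_norm u = 0")
    \<comment> \<open>Since x / 0 = 0 the integrand is 1, and the area of the disc is the summand pi
      in the bound.\<close>
    case True
    then show ?thesis
      using M0 by (simp add: emeasure_lborel_ball_complex ennreal_leI)
  next
    case False
    then have Q: "0 < H_norm u" using hardy_identity(2)[OF u, of 0] by simp
    have cu: "continuous_on UNIV u" by (rule C0_inf_discE[OF u]; blast)
    have [measurable]: "u \<in> borel_measurable borel"
      using cu by (rule borel_measurable_continuous_onI)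
    have [measurable]: "ball z r \<in> sets borel" for z :: complex and r by simp
    define e where "e z = ennreal (exp (4 * pi * (u z)\<^sup>2 / H_norm u))" for z
    have [measurable]: "e \<in> borel_measurable borel" unfolding e_def by measurable
    define d where "d z = 1 - (cmod z)\<^sup>2" for z
    have [measurable]: "d \<in> borel_measurable borel" unfolding d_def by measurable
    have d0: "0 < d z" if "z \<in> ball 0 1" for z using that by (simp add: d_def abs_square_less_1)
    \<comment> \<open>The averaging kernel: the weight (d a)^-2 cancels the factor (d a)^2 of the
      local inequality, and the condition says that z lies in the local ball of
      \<open>a\<close>.\<close>
    let ?k = "\<lambda>a z. ennreal (1 / (d a)\<^sup>2) * (if cmod a < 1 \<and> cmod (z - a) < d a / 8 then 1 else 0 :: ennreal)"
    \<comment> \<open>For |a - z| < d z / 16 one has d z / 2 <= d a <= 2 d z, so z lies in the ball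
      of \<open>a\<close> and the weight is at least 1 / (4 (d z)^2). Multiplied by the area pi (d
      z)^2 / 256 this is pi / 1024.\<close>
    have lower: "ennreal (pi / 1024) \<le> (\<integral>\<^sup>+a. ?k a z \<partial>lborel)" if z: "z \<in> ball 0 1" for z
    proof -
      have "ennreal (pi / 1024) = ennreal (1 / (4 * (d z)\<^sup>2)) * emeasure lborel (ball z (d z / 16))"
        using d0[OF z] by (simp add: emeasure_lborel_ball_complex ennreal_mult'[symmetric] power_divide)
      also have "\<dots> = (\<integral>\<^sup>+a. ennreal (1 / (4 * (d z)\<^sup>2)) * indicator (ball z (d z / 16)) a \<partial>lborel)"
        by (simp add: nn_integral_cmult_indicator)
      also have "\<dots> \<le> (\<integral>\<^sup>+a. ?k a z \<partial>lborel)"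
      proof (rule nn_integral_mono)
        fix a
        show "ennreal (1 / (4 * (d z)\<^sup>2)) * indicator (ball z (d z / 16)) a \<le> ?k a z"
        proof (cases "a \<in> ball z (d z / 16)")
          case True
          then have az: "cmod (a - z) < d z / 16" by (simp add: dist_norm norm_minus_commute)
          have z1: "cmod z < 1" using z by simp
          have "cmod (a - z) < (1 - (cmod z)\<^sup>2) / 4" using az d0[OF z] by (simp add: d_def)
          note geo = hardy_geometry[OF z1 this, folded d_def]
          have da: "d a = hardy_S a" by (simp add: d_def hardy_S_eq)
          have dd: "d z / 2 \<le> d a" "d a \<le> 2 * d z" using geo(2,3) d0[OF z] da by linarith+
          have "(d a)\<^sup>2 \<le> (2 * d z)\<^sup>2" using dd d0[OF z] by (intro power_mono) auto
          then have "1 / (4 * (d z)\<^sup>2) \<le> 1 / (d a)\<^sup>2"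
            using dd d0[OF z] by (intro divide_left_mono) (auto simp: power_mult_distrib)
          moreover have "cmod (z - a) < d a / 8" using az dd by (simp add: norm_minus_commute)
          ultimately show ?thesis using True geo(1) by (simp add: ennreal_leI)
        qed simp
      qed
      finally show ?thesis .
    qed
    have "ennreal (pi / 1024) * (\<integral>\<^sup>+z. e z * indicator (ball 0 1) z \<partial>lborel)
      = (\<integral>\<^sup>+z. ennreal (pi / 1024) * (e z * indicator (ball 0 1) z) \<partial>lborel)"
      by (rule nn_integral_cmult[symmetric]) measurable
    also have "\<dots> \<le> (\<integral>\<^sup>+z. (\<integral>\<^sup>+a. ?k a z \<partial>lborel) * e z \<partial>lborel)"
      using lower by (intro nn_integral_mono) (auto split: split_indicator intro!: mult_right_mono)
    also have "\<dots> = (\<integral>\<^sup>+z. (\<integral>\<^sup>+a. ?k a z * e z \<partial>lborel) \<partial>lborel)"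
      by (rule nn_integral_cong, rule nn_integral_multc[symmetric]) measurable
    also have "\<dots> = (\<integral>\<^sup>+a. (\<integral>\<^sup>+z. ?k a z * e z \<partial>lborel) \<partial>lborel)"
      by (rule lborel_pair.Fubini') measurable
    also have "\<dots> \<le> (\<integral>\<^sup>+a. ennreal M * indicator (ball (0::complex) 1) a \<partial>lborel)"
    proof (rule nn_integral_mono)
      fix a
      show "(\<integral>\<^sup>+z. ?k a z * e z \<partial>lborel) \<le> ennreal M * indicator (ball 0 1) a"
      proof (cases "cmod a < 1")
        case True
        then have da: "0 < d a" using d0[of a] by simp
        have "(\<integral>\<^sup>+z. ?k a z * e z \<partial>lborel) = (\<integral>\<^sup>+z. ennreal (1 / (d a)\<^sup>2) * (e z * indicator (ball a (d a / 8)) z) \<partial>lborel)"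
          using True by (intro nn_integral_cong) (auto simp: dist_norm norm_minus_commute split: split_indicator)
        also have "\<dots> = ennreal (1 / (d a)\<^sup>2) * (\<integral>\<^sup>+z. e z * indicator (ball a (d a / 8)) z \<partial>lborel)"
          by (rule nn_integral_cmult) measurable
        also have "\<dots> \<le> ennreal (1 / (d a)\<^sup>2) * ennreal (M * (d a)\<^sup>2)"
          using M[OF u True Q] unfolding e_def d_def by (intro mult_left_mono) auto
        also have "\<dots> = ennreal M" using da by (simp add: ennreal_mult'[symmetric])
        finally show ?thesis using True by simp
      qed simp
    qed
    also have "\<dots> = ennreal (M * pi)"
      by (simp add: nn_integral_cmult_indicator emeasure_lborel_ball_complex ennreal_mult'')
    also have "\<dots> = ennreal (pi / 1024) * ennreal (1024 * M)"
      using M0 by (subst ennreal_mult[symmetric]) auto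
    finally have "(\<integral>\<^sup>+z. e z * indicator (ball 0 1) z \<partial>lborel) \<le> ennreal (1024 * M)"
      by (subst (asm) ennreal_mult_le_mult_iff) auto
    also have "\<dots> \<le> ennreal (1024 * M + pi)" by (rule ennreal_leI) simp
    finally show ?thesis by (simp add: e_def)
  qed
  then show ?thesis by blast
qed

end
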